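(* The problem Capacitated Vertex Cover Above Tight Lower Bound-1 (CVCL1), parameterized by $k$, is W[2]-hard.
   Context: Given a graph with vertex capacities $c:V\to\mathbb{Z}_{\ge 0}$, a capacitated vertex cover is a set $C$ of vertices together with an assignment of every edge to one of its endpoints lying in $C$ such that each $w\in C$ is assigned at most $c(w)$ edges. CVCL1: given a positive integer $B$, a graph $G=(V,E)$ with $m=|E|$ edges and maximum degree at most $B$, vertex capacities $c$, and a positive integer $k$, decide whether $G$ has a capacitated vertex cover with at most $m/B+k$ vertices; the only parameter is $k$ ($B$ is part of the input). W[2]-hardness is with respect to parameterized (fpt) reductions; Dominating Set parameterized by solution size is W[2]-hard. *)

theory Defs
  imports Complex_Main
begin

text \<open>Alphabet: symbol 0 is the blank, 1 = bit 0, 2 = bit 1, 3 = separator.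
  Numbers are written in binary, least significant bit first, without leading zeros.\<close>

fun bin :: "nat \<Rightarrow> nat list" where
  "bin n = (if n = 0 then [] else (if even n then 1 else 2) # bin (n div 2))"

definition enc_nat :: "nat \<Rightarrow> nat list" where
  "enc_nat n = bin n @ [3]"

definition str :: "nat list \<Rightarrow> nat list" where
  "str l = concat (map enc_nat l)"

definition pairs :: "(nat \<times> nat) list \<Rightarrow> nat list" where
  "pairs E = concat (map (\<lambda>(u, v). [u, v]) E)"

datatype dir = Lft | Rgt | Stay

text \<open>A machine is (number of states, number of tape symbols, transition function).
  Start state 0, halting state 1, blank symbol 0.\<close>
type_synonym tm = "nat \<times> nat \<times> (nat \<Rightarrow> nat \<Rightarrow> nat \<times> nat \<times> dir)"

definition wf_tm :: "tm \<Rightarrow> bool" where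
  "wf_tm M = (case M of (Q, S, \<delta>) \<Rightarrow>
     2 \<le> Q \<and> 4 \<le> S \<and>
     (\<forall>q<Q. \<forall>a<S. fst (\<delta> q a) < Q \<and> fst (snd (\<delta> q a)) < S))"

text \<open>Configuration: (state, tape left of head (nearest first), tape from head on).\<close>
definition tm_step :: "(nat \<Rightarrow> nat \<Rightarrow> nat \<times> nat \<times> dir) \<Rightarrow>
    nat \<times> nat list \<times> nat list \<Rightarrow> nat \<times> nat list \<times> nat list" where
  "tm_step \<delta> cfg = (case cfg of (q, ls, rs) \<Rightarrow>
     if q = 1 then (q, ls, rs) else
     (let a = (case rs of [] \<Rightarrow> 0 | x # _ \<Rightarrow> x) in
      case \<delta> q a of (q', b, d) \<Rightarrow>
        (case d of
           Stay \<Rightarrow> (q', ls, b # tl rs)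
         | Rgt \<Rightarrow> (q', b # ls, tl rs)
         | Lft \<Rightarrow> (q', tl ls, (case ls of [] \<Rightarrow> 0 | x # _ \<Rightarrow> x) # b # tl rs))))"

definition tm_output :: "nat list \<Rightarrow> nat list" where
  "tm_output rs = rev (dropWhile (\<lambda>a. a = 0) (rev rs))"

definition halts_with :: "tm \<Rightarrow> nat list \<Rightarrow> nat \<Rightarrow> nat list \<Rightarrow> bool" where
  "halts_with M w t out = (case (tm_step (snd (snd M)) ^^ t) (0, [], w) of
     (q, ls, rs) \<Rightarrow> q = 1 \<and> tm_output rs = out)"

definition computes_in_time :: "tm \<Rightarrow> (nat list \<Rightarrow> nat list) \<Rightarrow> (nat list \<Rightarrow> nat) \<Rightarrow> bool" where
  "computes_in_time M R T = (wf_tm M \<and>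
     (\<forall>w \<in> lists {1, 2, 3}. \<exists>t \<le> T w. halts_with M w t (R w)))"

definition computable_nat :: "(nat \<Rightarrow> nat) \<Rightarrow> bool" where
  "computable_nat f = (\<exists>M. wf_tm M \<and> (\<forall>n. \<exists>t. halts_with M (bin n) t (bin (f n))))"

definition fpt_reducible ::
  "nat list set \<Rightarrow> (nat list \<Rightarrow> nat) \<Rightarrow> nat list set \<Rightarrow> (nat list \<Rightarrow> nat) \<Rightarrow> bool" where
  "fpt_reducible L1 \<kappa>1 L2 \<kappa>2 = (\<exists>R M f g (c::nat).
     computable_nat f \<and> computable_nat g \<and>
     computes_in_time M R (\<lambda>w. f (\<kappa>1 w) * (length w + 1) ^ c) \<and>
     (\<forall>w \<in> lists {1, 2, 3}. (w \<in> L1 \<longleftrightarrow> R w \<in> L2) \<and> \<kappa>2 (R w) \<le> g (\<kappa>1 w)))"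

text \<open>Parameterization used for both problems: the number at position 1 of the
  encoded instance (this is k in both encodings below); 0 for malformed strings.\<close>
definition kappa :: "nat list \<Rightarrow> nat" where
  "kappa w = (if \<exists>l. w = str l \<and> 2 \<le> length l then (SOME l. w = str l) ! 1 else 0)"

definition valid_graph :: "nat \<Rightarrow> (nat \<times> nat) list \<Rightarrow> bool" where
  "valid_graph n E = (\<forall>(u, v) \<in> set E. u < n \<and> v < n \<and> u \<noteq> v)"

definition edges :: "(nat \<times> nat) list \<Rightarrow> nat set set" where
  "edges E = {{u, v} | u v. (u, v) \<in> set E}"

definition ds_yes :: "nat \<Rightarrow> nat \<Rightarrow> (nat \<times> nat) list \<Rightarrow> bool" where
  "ds_yes n k E = (valid_graph n E \<and>
     (\<exists>D \<subseteq> {0..<n}. card D \<le> k \<and>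
        (\<forall>v < n. v \<in> D \<or> (\<exists>u \<in> D. {u, v} \<in> edges E))))"

definition DS_lang :: "nat list set" where
  "DS_lang = {str ([n, k] @ pairs E) | n k E. ds_yes n k E}"

definition is_cap_vc :: "nat \<Rightarrow> (nat \<times> nat) list \<Rightarrow> nat list \<Rightarrow> nat set \<Rightarrow> bool" where
  "is_cap_vc n E c C = (C \<subseteq> {0..<n} \<and>
     (\<exists>\<alpha> :: nat set \<Rightarrow> nat. (\<forall>e \<in> edges E. \<alpha> e \<in> e \<and> \<alpha> e \<in> C) \<and>
        (\<forall>w \<in> C. card {e \<in> edges E. \<alpha> e = w} \<le> c ! w)))"

definition cvcl1_yes :: "nat \<Rightarrow> nat \<Rightarrow> nat \<Rightarrow> nat list \<Rightarrow> (nat \<times> nat) list \<Rightarrow> bool" where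
  "cvcl1_yes B k n c E = (0 < B \<and> 0 < k \<and> length c = n \<and> valid_graph n E \<and>
     (\<forall>v < n. card {e \<in> edges E. v \<in> e} \<le> B) \<and>
     (\<exists>C. is_cap_vc n E c C \<and>
        real (card C) \<le> real (card (edges E)) / real B + real k))"

definition CVCL1_lang :: "nat list set" where
  "CVCL1_lang = {str ([B, k, n] @ c @ pairs E) | B k n c E. cvcl1_yes B k n c E}"

text \<open>Since Dominating Set (parameterized by solution size) is W[2]-complete under fpt
  reductions, a parameterized problem is W[2]-hard iff Dominating Set fpt-reduces to it.\<close>
definition W2_hard :: "nat list set \<Rightarrow> (nat list \<Rightarrow> nat) \<Rightarrow> bool" where
  "W2_hard L \<kappa> = fpt_reducible DS_lang kappa L \<kappa>"

end

theory Submission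
  imports Defs
begin

text \<open>The capacity of a constraint vertex is one less than its degree and each of them has a
  neighbour of capacity 0, so all constraint vertices lie in every cover and each of them hands at
  least one edge to a selector; hence the selectors in a cover form a dominating set. The constraint
  vertices have degree \<open>n + 1\<close>, all edges are incident to them, and the degree bound is taken to
  be \<open>n + 2\<close>, so that \<open>m / B + (k + 1)\<close> leaves room for all of them and at most \<open>k\<close> selectors.

  Binary numbers in the input may be exponentially large. An instance with
  \<open>n \<ge> k + length w\<close> is a no-instance, since only the ends of listed edges are not isolated;
  otherwise all numbers can be handled in unary within time polynomial in \<open>k + length w\<close>.
  The reduction is written in a language of stacks, which is compiled to a one-tape machine whose
  tape has one track per stack.\<close>

section \<open>Turing machines on function tapes\<close>

text \<open>Two obstacles shape the proof. On the graph side, CVCL1 demands a positive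
  \<open>k\<close> while Dominating Set may be asked with \<open>k = 0\<close>. With
  \<open>B = n + 1\<close> the quotient \<open>m / B\<close> would equal \<open>n\<close> and the
  parameter would have to stay \<open>k\<close>. For \<open>B = n + 2\<close> the quotient is
  \<open>n (n + 1) / (n + 2) = n - 1 + 2 / (n + 2)\<close>, which for positive \<open>n\<close> lies
  strictly between \<open>n - 1\<close> and \<open>n\<close>; so with parameter \<open>k + 1\<close>
  the bound rounds down to \<open>n + k\<close>. On the machine side, the time may be any computable
  function of \<open>k\<close> times a polynomial in the length of the word. Hence \<open>k\<close>
  may be expanded to unary in full, but \<open>n\<close> and the vertex names may not; these are
  read with a cut-off that also decides whether they are too large. Moreover every word over
  \<open>{1, 2, 3}\<close> has to be treated, so the machine must recognise malformed words, leading
  zeros included. Malformed and rejected words are sent to the empty word, which encodes no CVCL1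
  instance.\<close>

definition nth0 :: "nat list \<Rightarrow> nat \<Rightarrow> nat" where
  "nth0 xs j = (if j < length xs then xs ! j else 0)"

lemma nth0_Nil [simp]: "nth0 [] j = 0"
  by (simp add: nth0_def)

lemma nth0_Cons_0 [simp]: "nth0 (x # xs) 0 = x"
  by (simp add: nth0_def)

lemma nth0_Cons_Suc [simp]: "nth0 (x # xs) (Suc j) = nth0 xs j"
  by (simp add: nth0_def)

lemma nth0_tl: "nth0 (tl xs) j = nth0 xs (Suc j)"
  by (cases xs) auto

text \<open>The left list has length exactly \<open>p\<close>, so it fixes the head position. The
  right list is fixed only up to trailing blanks, because \<open>tm_step\<close> does not
  distinguish a missing cell from a blank one.\<close>

definition conf :: "nat \<Rightarrow> nat \<Rightarrow> (nat \<Rightarrow> nat) \<Rightarrow> nat \<times> nat list \<times> nat list \<Rightarrow> bool" where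
  "conf q p T cfg \<longleftrightarrow> (\<exists>rs. cfg = (q, rev (map T [0..<p]), rs) \<and> (\<forall>j. nth0 rs j = T (p + j)))"

text \<open>Left moves at position 0 are excluded: with an empty left list \<open>tm_step\<close>
  puts a fresh cell in front, which would shift all positions.\<close>

lemma conf_step:
  assumes c: "conf q p T cfg" and q: "q \<noteq> 1" and d: "\<delta> q (T p) = (q', b, d)"
    and l: "d = Lft \<Longrightarrow> 0 < p"
  shows "conf q' (case d of Lft \<Rightarrow> p - 1 | Rgt \<Rightarrow> Suc p | Stay \<Rightarrow> p) (T(p := b)) (tm_step \<delta> cfg)"
proof -
  obtain rs where cfg: "cfg = (q, rev (map T [0..<p]), rs)" and rs: "\<And>j. nth0 rs j = T (p + j)"
    using c unfolding conf_def by blast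
  have hd: "(case rs of [] \<Rightarrow> 0 | x # _ \<Rightarrow> x) = T p"
    using rs[of 0] by (cases rs) auto
  have tlrs: "nth0 (tl rs) j = T (Suc (p + j))" for j
    using rs[of "Suc j"] by (simp add: nth0_tl)
  have mp: "map (T(p := b)) [0..<p] = map T [0..<p]"
    by simp
  have cons: "nth0 (b # tl rs) j = (T(p := b)) (p + j)" for j
    by (cases j) (auto simp: tlrs)
  show ?thesis
  proof (cases d)
    case Stay
    then show ?thesis using q d cons
      by (auto simp: conf_def tm_step_def cfg hd)
  next
    case Rgt
    then show ?thesis using q d
      by (auto simp: conf_def tm_step_def cfg hd tlrs)
  next
    case Lft
    then obtain p' where p': "p = Suc p'" using l by (cases p) auto
    have "nth0 (T p' # b # tl rs) j = (T(p := b)) (p' + j)" for j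
      using cons[of "j - 1"] by (cases j) (auto simp: p')
    then show ?thesis using Lft q d p'
      by (auto simp: conf_def tm_step_def cfg hd)
  qed
qed

definition goes :: "(nat \<Rightarrow> nat \<Rightarrow> nat \<times> nat \<times> dir) \<Rightarrow> nat \<Rightarrow> nat \<Rightarrow> (nat \<Rightarrow> nat) \<Rightarrow>
    nat \<Rightarrow> nat \<Rightarrow> (nat \<Rightarrow> nat) \<Rightarrow> nat \<Rightarrow> bool" where
  "goes \<delta> q p T q' p' T' t \<longleftrightarrow>
     (\<forall>cfg. conf q p T cfg \<longrightarrow> conf q' p' T' ((tm_step \<delta> ^^ t) cfg))"

lemma goes_refl: "goes \<delta> q p T q p T 0"
  by (simp add: goes_def)

lemma goes_trans:
  assumes "goes \<delta> q p T q' p' T' t" and "goes \<delta> q' p' T' q'' p'' T'' t'"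
  shows "goes \<delta> q p T q'' p'' T'' (t + t')"
  using assms unfolding goes_def add.commute[of t] funpow_add comp_apply by blast

lemma goes_Rgt: "q \<noteq> 1 \<Longrightarrow> \<delta> q (T p) = (q', b, Rgt) \<Longrightarrow> goes \<delta> q p T q' (Suc p) (T(p := b)) 1"
  unfolding goes_def using conf_step[where d = Rgt] by fastforce

lemma goes_Lft: "q \<noteq> 1 \<Longrightarrow> \<delta> q (T (Suc p)) = (q', b, Lft) \<Longrightarrow>
    goes \<delta> q (Suc p) T q' p (T(Suc p := b)) 1"
  unfolding goes_def using conf_step[where d = Lft and p = "Suc p"] by fastforce

lemma goes_walk_right:
  assumes "q \<noteq> 1" and "\<And>p'. p \<le> p' \<Longrightarrow> p' < p + n \<Longrightarrow> \<delta> q (T p') = (q, T p', Rgt)"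
  shows "goes \<delta> q p T q (p + n) T n"
  using assms(2)
proof (induction n)
  case 0
  then show ?case by (simp add: goes_refl)
next
  case (Suc n)
  have "goes \<delta> q (p + n) T q (Suc (p + n)) T 1"
    using goes_Rgt[OF assms(1), where \<delta> = \<delta> and T = T and p = "p + n" and q' = q and b = "T (p + n)"]
      Suc.prems by simp
  moreover have "goes \<delta> q p T q (p + n) T n" using Suc by simp
  ultimately show ?case using goes_trans by fastforce
qed

lemma goes_walk_left:
  assumes "q \<noteq> 1" and "\<And>p'. 0 < p' \<Longrightarrow> p' \<le> p \<Longrightarrow> \<delta> q (T p') = (q, T p', Lft)"
  shows "goes \<delta> q p T q 0 T p"
  using assms(2)
proof (induction p)
  case 0
  then show ?case by (simp add: goes_refl)
next
  case (Suc p)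
  have "goes \<delta> q (Suc p) T q p T 1"
    using goes_Lft[OF assms(1), where \<delta> = \<delta> and T = T and p = p and q' = q and b = "T (Suc p)"]
      Suc.prems by simp
  moreover have "goes \<delta> q p T q 0 T p" using Suc by simp
  ultimately show ?case using goes_trans by fastforce
qed

section \<open>Tracks\<close>

text \<open>A tape cell carries one base-4 digit per register.\<close>

fun dig :: "nat \<Rightarrow> nat \<Rightarrow> nat" where
  "dig 0 x = x mod 4"
| "dig (Suc i) x = dig i (x div 4)"

fun upd :: "nat \<Rightarrow> nat \<Rightarrow> nat \<Rightarrow> nat" where
  "upd 0 a x = 4 * (x div 4) + a"
| "upd (Suc i) a x = 4 * upd i a (x div 4) + x mod 4"

lemma dig_upd: "a < 4 \<Longrightarrow> dig j (upd i a x) = (if i = j then a else dig j x)"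
proof (induction i arbitrary: j x)
  case 0
  then show ?case by (cases j) auto
next
  case (Suc i)
  then show ?case by (cases j) auto
qed

lemma upd_less: "i < r \<Longrightarrow> a < 4 \<Longrightarrow> x < 4 ^ r \<Longrightarrow> upd i a x < 4 ^ r"
proof (induction i arbitrary: r x)
  case 0
  then obtain r' where r: "r = Suc r'" by (cases r) auto
  have "x div 4 < 4 ^ r'" using 0 r by auto
  then have "x div 4 + 1 \<le> 4 ^ r'" by simp
  then show ?case using 0 r by simp
next
  case (Suc i)
  then obtain r' where r: "r = Suc r'" by (cases r) auto
  have "x div 4 < 4 ^ r'" using Suc.prems r by auto
  then have "upd i a (x div 4) < 4 ^ r'" using Suc r by auto
  moreover have "x mod 4 < 4" by simp
  ultimately show ?case using r by simp
qed

lemma dig_less: "dig i x < 4"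
  by (induction i arbitrary: x) auto

lemma dig_0 [simp]: "dig i 0 = 0"
  by (induction i) auto

lemma dig_small: "x < 4 \<Longrightarrow> dig i x = (if i = 0 then x else 0)"
  by (cases i) auto

text \<open>This lets the machine recognise the end of the used tape from a single cell, the symbol
  0 standing for blanks on all tracks.\<close>

lemma all_dig_0: "x < 4 ^ r \<Longrightarrow> (\<And>i. i < r \<Longrightarrow> dig i x = 0) \<Longrightarrow> x = 0"
proof (induction r arbitrary: x)
  case 0
  then show ?case by simp
next
  case (Suc r)
  have "dig i (x div 4) = 0" if "i < r" for i
    using Suc.prems(2)[of "Suc i"] that by simp
  moreover have "x div 4 < 4 ^ r" using Suc.prems(1) by auto
  ultimately have "x div 4 = 0" using Suc.IH by blast
  moreover have "x mod 4 = 0" using Suc.prems(2)[of 0] by simp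
  ultimately show ?case by presburger
qed

declare dig.simps [simp del] upd.simps [simp del]

section \<open>A stack language\<close>

type_synonym store = "nat \<Rightarrow> nat list"

definition top0 :: "nat list \<Rightarrow> nat" where
  "top0 xs = (case xs of [] \<Rightarrow> 0 | x # _ \<Rightarrow> x)"

lemma top0_simps [simp]: "top0 [] = 0" "top0 (x # xs) = x"
  by (simp_all add: top0_def)

datatype cmd = Skip | Push nat nat | Pop nat | Seq cmd cmd (infixr ";;" 60)
  | If nat "nat \<Rightarrow> bool" cmd cmd | While nat "nat \<Rightarrow> bool" cmd

text \<open>Time is charged per instruction of the code compiled below: the first branch of
  \<open>If\<close> also pays for the test and for the jump over the second branch, a round of
  \<open>While\<close> for its test and the jump back.\<close>

inductive exec :: "cmd \<Rightarrow> store \<Rightarrow> nat \<Rightarrow> store \<Rightarrow> bool" where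
  Skip: "exec Skip s 0 s"
| Push: "exec (Push i a) s 1 (s(i := a # s i))"
| Pop: "exec (Pop i) s 1 (s(i := tl (s i)))"
| Seq: "exec c s t s' \<Longrightarrow> exec d s' t' s'' \<Longrightarrow> exec (c ;; d) s (t + t') s''"
| IfT: "A (top0 (s i)) \<Longrightarrow> exec c s t s' \<Longrightarrow> exec (If i A c d) s (t + 2) s'"
| IfF: "\<not> A (top0 (s i)) \<Longrightarrow> exec d s t s' \<Longrightarrow> exec (If i A c d) s (t + 1) s'"
| WhileF: "\<not> A (top0 (s i)) \<Longrightarrow> exec (While i A c) s 1 s"
| WhileT: "A (top0 (s i)) \<Longrightarrow> exec c s t s' \<Longrightarrow> exec (While i A c) s' t' s'' \<Longrightarrow>
    exec (While i A c) s (t + 2 + t') s''"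

text \<open>Pushing 0 is excluded because 0 on a track marks the blank beyond the top of the
  stack.\<close>

fun wf_cmd :: "nat \<Rightarrow> cmd \<Rightarrow> bool" where
  "wf_cmd r Skip = True"
| "wf_cmd r (Push i a) = (i < r \<and> 0 < a \<and> a < 4)"
| "wf_cmd r (Pop i) = (i < r)"
| "wf_cmd r (c ;; d) = (wf_cmd r c \<and> wf_cmd r d)"
| "wf_cmd r (If i A c d) = (i < r \<and> wf_cmd r c \<and> wf_cmd r d)"
| "wf_cmd r (While i A c) = (i < r \<and> wf_cmd r c)"

text \<open>The test instruction falls through if the predicate holds and jumps otherwise; with the
  constantly false predicate it is an unconditional jump.\<close>

datatype instr = IPush nat nat | IPop nat | ITest nat "nat \<Rightarrow> bool" nat

text \<open>The number argument is the address at which the code will stand, needed because jump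
  targets are absolute.\<close>

fun compile :: "nat \<Rightarrow> cmd \<Rightarrow> instr list" where
  "compile n Skip = []"
| "compile n (Push i a) = [IPush i a]"
| "compile n (Pop i) = [IPop i]"
| "compile n (c ;; d) = compile n c @ compile (n + length (compile n c)) d"
| "compile n (If i A c d) = (let P = compile (n + 1) c; m = n + 2 + length P; Q = compile m d in
     [ITest i A m] @ P @ [ITest i (\<lambda>_. False) (m + length Q)] @ Q)"
| "compile n (While i A c) = (let P = compile (n + 1) c in
     [ITest i A (n + 2 + length P)] @ P @ [ITest i (\<lambda>_. False) n])"

fun isem :: "instr \<Rightarrow> nat \<times> store \<Rightarrow> nat \<times> store" where
  "isem (IPush i a) (pc, s) = (Suc pc, s(i := a # s i))"
| "isem (IPop i) (pc, s) = (Suc pc, s(i := tl (s i)))"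
| "isem (ITest i A l) (pc, s) = (if A (top0 (s i)) then Suc pc else l, s)"

definition istep :: "instr list \<Rightarrow> nat \<times> store \<Rightarrow> nat \<times> store" where
  "istep P cf = (if fst cf < length P then isem (P ! fst cf) cf else cf)"

definition code_at :: "instr list \<Rightarrow> nat \<Rightarrow> instr list \<Rightarrow> bool" where
  "code_at P n Q \<longleftrightarrow> (\<exists>xs ys. P = xs @ Q @ ys \<and> length xs = n)"

lemma code_at_append:
  assumes "code_at P n (Q @ Q')"
  shows "code_at P n Q" and "code_at P (n + length Q) Q'"
proof -
  obtain xs ys where "P = xs @ (Q @ Q') @ ys" and "length xs = n"
    using assms unfolding code_at_def by blast
  then have "P = xs @ Q @ (Q' @ ys)" "length xs = n" "P = (xs @ Q) @ Q' @ ys"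
      "length (xs @ Q) = n + length Q" by simp_all
  then show "code_at P n Q" and "code_at P (n + length Q) Q'"
    unfolding code_at_def by blast+
qed

lemma istep_code_at: "code_at P n [c] \<Longrightarrow> istep P (n, s) = isem c (n, s)"
  unfolding code_at_def istep_def by auto

lemma funpow_add_apply: "(f ^^ t) x = y \<Longrightarrow> (f ^^ t') y = z \<Longrightarrow> (f ^^ (t + t')) x = z"
  by (simp add: add.commute[of t] funpow_add)

text \<open>The code may sit anywhere in \<open>P\<close>, as it must for the induction hypotheses
  to apply to sub-blocks. The step count agrees exactly with the charges made in
  \<open>exec\<close>.\<close>

lemma comp_correct:
  "exec c s t s' \<Longrightarrow> code_at P n (compile n c) \<Longrightarrow>
    (istep P ^^ t) (n, s) = (n + length (compile n c), s')"
proof (induction arbitrary: n rule: exec.induct)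
  case (Skip s)
  then show ?case by simp
next
  case (Push i a s)
  then show ?case by (simp add: istep_code_at fun_upd_def)
next
  case (Pop i s)
  then show ?case by (simp add: istep_code_at fun_upd_def)
next
  case (Seq c s t s' d t' s'')
  have "code_at P n (compile n c)" and "code_at P (n + length (compile n c)) (compile (n + length (compile n c)) d)"
    using code_at_append Seq.prems by auto
  then show ?case using funpow_add_apply[OF Seq.IH(1) Seq.IH(2)] by (simp add: add.assoc)
next
  case (IfT A s i c t s' d)
  let ?P = "compile (n + 1) c" let ?m = "n + 2 + length ?P" let ?Q = "compile ?m d"
  have at: "code_at P n ([ITest i A ?m] @ ?P @ [ITest i (\<lambda>_. False) (?m + length ?Q)] @ ?Q)"
    using IfT.prems by (simp add: Let_def)
  note a1 = code_at_append[OF at]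
  note a2 = code_at_append[OF a1(2)]
  note a3 = code_at_append[OF a2(2)]
  have "(istep P ^^ 1) (n, s) = (n + 1, s)"
    using istep_code_at[OF a1(1)] IfT.hyps by simp
  moreover have "(istep P ^^ t) (n + 1, s) = (n + 1 + length ?P, s')"
    using IfT.IH a2(1) by simp
  moreover have "(istep P ^^ 1) (n + 1 + length ?P, s') = (?m + length ?Q, s')"
    using istep_code_at[OF a3(1), of s'] by simp
  ultimately have "(istep P ^^ (1 + t + 1)) (n, s) = (?m + length ?Q, s')"
    using funpow_add_apply by metis
  then show ?case by (simp add: Let_def)
next
  case (IfF A s i d t s' c)
  let ?P = "compile (n + 1) c" let ?m = "n + 2 + length ?P" let ?Q = "compile ?m d"
  have at: "code_at P n ([ITest i A ?m] @ ?P @ [ITest i (\<lambda>_. False) (?m + length ?Q)] @ ?Q)"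
    using IfF.prems by (simp add: Let_def)
  note a1 = code_at_append[OF at]
  note a2 = code_at_append[OF a1(2)]
  note a3 = code_at_append[OF a2(2)]
  have "(istep P ^^ 1) (n, s) = (?m, s)"
    using istep_code_at[OF a1(1)] IfF.hyps by simp
  moreover have "(istep P ^^ t) (?m, s) = (?m + length ?Q, s')"
    using IfF.IH a3(2) by simp
  ultimately have "(istep P ^^ (1 + t)) (n, s) = (?m + length ?Q, s')"
    using funpow_add_apply by metis
  then show ?case by (simp add: Let_def)
next
  case (WhileF A s i c)
  let ?P = "compile (n + 1) c"
  have at: "code_at P n ([ITest i A (n + 2 + length ?P)] @ ?P @ [ITest i (\<lambda>_. False) n])"
    using WhileF.prems by (simp add: Let_def)
  show ?case using istep_code_at[OF code_at_append(1)[OF at]] WhileF.hyps by (simp add: Let_def)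
next
  case (WhileT A s i c t s' t' s'')
  let ?P = "compile (n + 1) c"
  have at: "code_at P n ([ITest i A (n + 2 + length ?P)] @ ?P @ [ITest i (\<lambda>_. False) n])"
    using WhileT.prems by (simp add: Let_def)
  note a1 = code_at_append[OF at]
  note a2 = code_at_append[OF a1(2)]
  have "(istep P ^^ 1) (n, s) = (n + 1, s)"
    using istep_code_at[OF a1(1)] WhileT.hyps by simp
  moreover have "(istep P ^^ t) (n + 1, s) = (n + 1 + length ?P, s')"
    using WhileT.IH(1) a2(1) by simp
  moreover have "(istep P ^^ 1) (n + 1 + length ?P, s') = (n, s')"
    using istep_code_at[OF a2(2), of s'] by simp
  moreover have "(istep P ^^ t') (n, s') = (n + length (compile n (While i A c)), s'')"
    using WhileT.IH(2) WhileT.prems by blast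
  ultimately have "(istep P ^^ (1 + t + 1 + t')) (n, s) = (n + length (compile n (While i A c)), s'')"
    using funpow_add_apply by metis
  then show ?case by simp
qed

text \<open>A target equal to \<open>m\<close> is allowed: the address just past the code is where
  the output phase begins.\<close>

fun wf_instr :: "nat \<Rightarrow> nat \<Rightarrow> instr \<Rightarrow> bool" where
  "wf_instr r m (IPush i a) = (i < r \<and> 0 < a \<and> a < 4)"
| "wf_instr r m (IPop i) = (i < r)"
| "wf_instr r m (ITest i A l) = (i < r \<and> l \<le> m)"

lemma wf_instr_mono: "wf_instr r m c \<Longrightarrow> m \<le> m' \<Longrightarrow> wf_instr r m' c"
  by (cases c) auto

lemma wf_comp: "wf_cmd r c \<Longrightarrow> x \<in> set (compile n c) \<Longrightarrow> wf_instr r (n + length (compile n c)) x"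
proof (induction c arbitrary: n)
  case (Seq c d)
  then show ?case
    by (auto intro: wf_instr_mono[OF Seq.IH(1)] wf_instr_mono[OF Seq.IH(2)])
next
  case (If i A c d)
  then show ?case
    by (auto simp: Let_def intro: wf_instr_mono[OF If.IH(1)] wf_instr_mono[OF If.IH(2)])
next
  case (While i A c)
  then show ?case
    by (auto simp: Let_def intro: wf_instr_mono[OF While.IH])
qed auto

section \<open>Compilation to Turing machines\<close>

text \<open>States 0 to 3 are set apart from the program; every address then owns four consecutive
  states, one per phase.\<close>

definition st :: "nat \<Rightarrow> nat \<Rightarrow> nat" where
  "st pc ph = 4 * pc + ph + 4"

lemma st_neq_1 [simp]: "st pc ph \<noteq> 1" "st pc ph \<noteq> Suc 0"
  by (simp_all add: st_def)

text \<open>Phase 0 runs right to the first blank of the track concerned, phase 1 looks at the cell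
  before it, phases 2 and 3 return to the marker \<open>4 ^ r\<close> left of the origin and remember
  which instruction is next. After the last instruction the tape is projected to track 1.\<close>

definition code_delta :: "nat \<Rightarrow> instr list \<Rightarrow> nat \<Rightarrow> nat \<Rightarrow> nat \<Rightarrow> nat \<times> nat \<times> dir" where
  "code_delta r P pc ph a =
    (if pc < length P then
       (if ph = 0 then
          (case P ! pc of
             IPush i x \<Rightarrow> if dig i a \<noteq> 0 then (st pc 0, a, Rgt) else (st pc 2, upd i x a, Lft)
           | IPop i \<Rightarrow> if dig i a \<noteq> 0 then (st pc 0, a, Rgt) else (st pc 1, a, Lft)
           | ITest i A l \<Rightarrow> if dig i a \<noteq> 0 then (st pc 0, a, Rgt) else (st pc 1, a, Lft))
        else if ph = 1 then
          (case P ! pc of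
             IPush i x \<Rightarrow> (1, a, Stay)
           | IPop i \<Rightarrow> if a = 4 ^ r then (st (Suc pc) 0, a, Rgt) else (st pc 2, upd i 0 a, Lft)
           | ITest i A l \<Rightarrow> if a = 4 ^ r then (st (if A 0 then Suc pc else l) 0, a, Rgt)
                           else (st pc (if A (dig i a) then 2 else 3), a, Lft))
        else if a = 4 ^ r then
          (st (if ph = 2 then Suc pc else case P ! pc of ITest i A l \<Rightarrow> l | _ \<Rightarrow> pc) 0, a, Rgt)
        else (st pc ph, a, Lft))
     else if pc = length P then
       (if ph = 0 then (if a = 0 then (st pc 2, a, Lft) else (st pc 0, dig 1 a, Rgt))
        else if a = 4 ^ r then (1, a, Rgt) else (st pc ph, a, Lft))
     else (1, a, Stay))"

definition tm_delta :: "nat \<Rightarrow> instr list \<Rightarrow> nat \<Rightarrow> nat \<Rightarrow> nat \<times> nat \<times> dir" where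
  "tm_delta r P q a =
    (if q = 0 then (2, a, Lft) else if q = 2 then (4, 4 ^ r, Rgt) else if q < 4 then (1, a, Stay)
     else code_delta r P ((q - 4) div 4) ((q - 4) mod 4) a)"

lemma tm_delta_st: "ph < 4 \<Longrightarrow> tm_delta r P (st pc ph) a = code_delta r P pc ph a"
  by (simp add: tm_delta_def st_def)

text \<open>The state count is four reserved states plus four for each address, the one past the
  code included. Track cells stay below \<open>4 ^ r\<close>, so the marker \<open>4 ^ r\<close> is
  a symbol of its own; the alphabet \<open>4 ^ Suc r\<close> contains it and is closed under
  \<open>upd\<close>, as \<open>wf_tm\<close> also asks about symbols never met in a phase.\<close>

definition tm_of :: "nat \<Rightarrow> cmd \<Rightarrow> tm" where
  "tm_of r c = (8 + 4 * length (compile 0 c), 4 ^ Suc r, tm_delta r (compile 0 c))"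

lemma wf_tm_of:
  assumes r: "1 \<le> r" and wf: "wf_cmd r c"
  shows "wf_tm (tm_of r c)"
proof -
  define P where "P = compile 0 c"
  have wfi: "wf_instr r (length P) (P ! pc)" if "pc < length P" for pc
    using wf_comp[OF wf, of "P ! pc" 0] that by (simp add: P_def)
  have upd: "upd i x a < 4 * 4 ^ r" if "i < r" "x < 4" "a < 4 * 4 ^ r" for i x a
    using upd_less[of i "Suc r" x a] that by simp
  have dig: "dig i a < 4 * 4 ^ r" for i a
    using dig_less[of i a] one_le_power[of "4::nat" r] by linarith
  have code: "fst (code_delta r P pc ph a) < 8 + 4 * length P \<and>
      fst (snd (code_delta r P pc ph a)) < 4 * 4 ^ r"
    if "a < 4 * 4 ^ r" "ph < 4" for pc ph a
  proof (cases "pc < length P")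
    case True
    then show ?thesis using that wfi[of pc]
      by (cases "P ! pc") (simp_all add: code_delta_def st_def upd)
  next
    case False
    then show ?thesis using that by (simp add: code_delta_def st_def dig)
  qed
  have "fst (tm_delta r P q a) < 8 + 4 * length P \<and> fst (snd (tm_delta r P q a)) < 4 * 4 ^ r"
    if "a < 4 * 4 ^ r" for q a
    using code that by (auto simp: tm_delta_def)
  moreover have "(4::nat) \<le> 4 ^ Suc r"
    by simp
  ultimately show ?thesis
    by (simp add: wf_tm_def tm_of_def P_def)
qed

section \<open>Stacks represented on tape tracks\<close>

definition store_ok :: "nat \<Rightarrow> store \<Rightarrow> bool" where
  "store_ok r s \<longleftrightarrow> (\<forall>i<r. \<forall>x\<in>set (s i). 0 < x \<and> x < 4)"

text \<open>The bottom of each stack is at position 1, next to the marker, so pushing and popping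
  touch only the right end of the nonblank part of a track; hence the \<open>rev\<close>.\<close>

definition good :: "nat \<Rightarrow> (nat \<Rightarrow> nat) \<Rightarrow> store \<Rightarrow> bool" where
  "good r T s \<longleftrightarrow> T 0 = 4 ^ r \<and> (\<forall>p>0. T p < 4 ^ r) \<and> store_ok r s \<and>
     (\<forall>i<r. \<forall>j. dig i (T (Suc j)) = nth0 (rev (s i)) j)"

lemma nth0_rev_Cons:
  "nth0 (rev (x # xs)) j = (if j = length xs then x else nth0 (rev xs) j)"
  by (auto simp: nth0_def nth_append)

lemma good_push:
  assumes g: "good r T s" and i: "i < r" and a: "0 < a" "a < 4"
  shows "good r (T(Suc (length (s i)) := upd i a (T (Suc (length (s i)))))) (s(i := a # s i))"
  using g i a
  by (auto simp: good_def store_ok_def dig_upd upd_less nth0_rev_Cons simp del: rev.simps)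

lemma good_pop:
  assumes g: "good r T s" and i: "i < r" and s: "s i = x # xs"
  shows "good r (T(length (s i) := upd i 0 (T (length (s i))))) (s(i := xs))"
proof -
  have "nth0 (rev xs) j = (if j = length xs then 0 else nth0 (rev (s i)) j)" for j
    by (simp add: s nth0_rev_Cons del: rev.simps) (simp add: nth0_def)
  then show ?thesis using g i
    by (auto simp: good_def store_ok_def dig_upd upd_less s simp del: rev.simps)
qed

lemma good_dig_nonblank:
  assumes g: "good r T s" and i: "i < r" and p: "0 < p" "p \<le> length (s i)"
  shows "dig i (T p) \<noteq> 0"
proof -
  obtain j where j: "p = Suc j" using p by (cases p) auto
  have "dig i (T p) = rev (s i) ! j" using g i p j by (auto simp: good_def nth0_def)
  moreover have "rev (s i) ! j \<in> set (s i)" using p j nth_mem[of j "rev (s i)"] by simp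
  ultimately show ?thesis using g i by (auto simp: good_def store_ok_def)
qed

lemma good_dig_blank: "good r T s \<Longrightarrow> i < r \<Longrightarrow> dig i (T (Suc (length (s i)))) = 0"
  by (simp add: good_def nth0_def)

lemma good_dig_top: "good r T s \<Longrightarrow> i < r \<Longrightarrow> s i = x # xs \<Longrightarrow> dig i (T (length (s i))) = x"
  by (simp add: good_def nth0_rev_Cons del: rev.simps)

lemma goes_return:
  assumes T: "T 0 = 4 ^ r" "\<And>p. 0 < p \<Longrightarrow> T p \<noteq> 4 ^ r"
    and pc: "pc < length P" and ph: "ph = 2 \<or> ph = 3"
  shows "goes (tm_delta r P) (st pc ph) h T
    (st (if ph = 2 then Suc pc else case P ! pc of ITest i A l \<Rightarrow> l | _ \<Rightarrow> pc) 0) 1 T (h + 1)"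
proof (rule goes_trans)
  have d: "tm_delta r P (st pc ph) a = code_delta r P pc ph a" for a
    using ph by (intro tm_delta_st) auto
  show "goes (tm_delta r P) (st pc ph) h T (st pc ph) 0 T h"
    using T pc ph by (intro goes_walk_left) (auto simp: d code_delta_def simp del: One_nat_def)
  show "goes (tm_delta r P) (st pc ph) 0 T
    (st (if ph = 2 then Suc pc else case P ! pc of ITest i A l \<Rightarrow> l | _ \<Rightarrow> pc) 0) 1 T 1"
    using goes_Rgt[where q = "st pc ph" and p = 0 and b = "T 0" and T = T and \<delta> = "tm_delta r P"] T pc ph
    by (auto simp: d code_delta_def fun_upd_idem)
qed

text \<open>The head runs along the track to its first blank and back to the marker, so an
  instruction costs linear time in the greatest height \<open>H\<close>. On an empty stack the step
  back from the first blank lands on the marker itself, which is how emptiness is noticed.\<close>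

lemma istep_simulation:
  assumes g: "good r T s" and pc: "pc < length P" and wf: "wf_instr r m (P ! pc)"
    and H: "\<And>i. i < r \<Longrightarrow> length (s i) \<le> H"
    and sem: "isem (P ! pc) (pc, s) = (pc', s')"
  shows "\<exists>T' t. t \<le> 2 * H + 4 \<and> goes (tm_delta r P) (st pc 0) 1 T (st pc' 0) 1 T' t \<and> good r T' s'"
proof -
  let ?\<delta> = "tm_delta r P"
  have d: "?\<delta> (st pc ph) a = code_delta r P pc ph a" if "ph < 4" for ph a
    using that by (rule tm_delta_st)
  have M: "T 0 = 4 ^ r" "\<And>p. 0 < p \<Longrightarrow> T p \<noteq> 4 ^ r"
    using g by (auto simp: good_def less_imp_neq)
  have right: "goes ?\<delta> (st pc 0) 1 T (st pc 0) (Suc (length (s i))) T (length (s i))"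
    if "i < r" "P ! pc = IPop i \<or> (\<exists>x. P ! pc = IPush i x) \<or> (\<exists>A l. P ! pc = ITest i A l)" for i
  proof -
    have "goes ?\<delta> (st pc 0) 1 T (st pc 0) (1 + length (s i)) T (length (s i))"
      using good_dig_nonblank[OF g that(1)] that(2) pc
      by (intro goes_walk_right) (auto simp: d code_delta_def)
    then show ?thesis by simp
  qed
  have step_back: "goes ?\<delta> (st pc 0) (Suc (length (s i))) T (st pc 1) (length (s i)) T 1"
    if "i < r" "P ! pc = IPop i \<or> (\<exists>A l. P ! pc = ITest i A l)" for i
    using goes_Lft[where q = "st pc 0" and p = "length (s i)" and T = T and
        b = "T (Suc (length (s i)))" and \<delta> = ?\<delta> and q' = "st pc 1"]
      good_dig_blank[OF g that(1)] that(2) pc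
    by (auto simp: d code_delta_def)
  show ?thesis
  proof (cases "P ! pc")
    case (IPush i a)
    then have i: "i < r" and a: "0 < a" "a < 4" using wf by auto
    let ?h = "length (s i)"
    let ?T = "T(Suc ?h := upd i a (T (Suc ?h)))"
    have g': "good r ?T s'" and pc': "pc' = Suc pc" using good_push[OF g i a] sem IPush by auto
    have M': "?T 0 = 4 ^ r" "\<And>p. 0 < p \<Longrightarrow> ?T p \<noteq> 4 ^ r"
      using g' unfolding good_def by (blast, metis less_irrefl)
    have "goes ?\<delta> (st pc 0) (Suc ?h) T (st pc 2) ?h ?T 1"
      using good_dig_blank[OF g i] IPush pc
      by (intro goes_Lft) (auto simp: d code_delta_def)
    from goes_trans[OF goes_trans[OF right this] goes_return[where T = ?T, OF M' pc, where ph = 2]] i IPush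
    have "goes ?\<delta> (st pc 0) 1 T (st pc' 0) 1 ?T (?h + 1 + (?h + 1))"
      by (auto simp: pc' simp del: fun_upd_apply)
    then show ?thesis using g' H[OF i] by (intro exI conjI) auto
  next
    case (IPop i)
    then have i: "i < r" using wf by auto
    let ?h = "length (s i)"
    have rb: "goes ?\<delta> (st pc 0) 1 T (st pc 1) ?h T (?h + 1)"
      using goes_trans[OF right[OF i] step_back[OF i]] IPop by simp
    have pc': "pc' = Suc pc" and s': "s' = s(i := tl (s i))" using sem IPop by auto
    show ?thesis
    proof (cases "s i")
      case Nil
      have "goes ?\<delta> (st pc 1) 0 T (st pc' 0) 1 T 1"
        using goes_Rgt[where q = "st pc 1" and p = 0 and b = "T 0" and T = T and \<delta> = ?\<delta>]
          M IPop pc by (auto simp: d code_delta_def pc' fun_upd_idem)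
      moreover have "s' = s" using s' Nil by auto
      ultimately show ?thesis using goes_trans[OF rb] Nil g
        by (intro exI[of _ T] exI[of _ "?h + 1 + 1"]) auto
    next
      case (Cons x xs)
      let ?T = "T(?h := upd i 0 (T ?h))"
      have g': "good r ?T s'" using good_pop[OF g i Cons] s' Cons by simp
      have M': "?T 0 = 4 ^ r" "\<And>p. 0 < p \<Longrightarrow> ?T p \<noteq> 4 ^ r"
        using g' unfolding good_def by (blast, metis less_irrefl)
      have h: "?h = Suc (length xs)" using Cons by simp
      have "goes ?\<delta> (st pc 1) (Suc (length xs)) T (st pc 2) (length xs) ?T 1"
        unfolding h using M IPop pc
        by (intro goes_Lft) (auto simp: d code_delta_def)
      from goes_trans[OF goes_trans[OF rb[unfolded h] this] goes_return[where T = ?T, OF M' pc, where ph = 2]]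
      have "goes ?\<delta> (st pc 0) 1 T (st pc' 0) 1 ?T (Suc (length xs) + 1 + 1 + (length xs + 1))"
        by (auto simp: pc' simp del: fun_upd_apply)
      then show ?thesis using g' H[OF i] h by (intro exI conjI) auto
    qed
  next
    case (ITest i A l)
    then have i: "i < r" using wf by auto
    let ?h = "length (s i)"
    have rb: "goes ?\<delta> (st pc 0) 1 T (st pc 1) ?h T (?h + 1)"
      using goes_trans[OF right[OF i] step_back[OF i]] ITest by simp
    have pc': "pc' = (if A (top0 (s i)) then Suc pc else l)" and s': "s' = s"
      using sem ITest by auto
    show ?thesis
    proof (cases "s i")
      case Nil
      have "goes ?\<delta> (st pc 1) 0 T (st pc' 0) 1 T 1"
        using goes_Rgt[where q = "st pc 1" and p = 0 and b = "T 0" and T = T and \<delta> = ?\<delta>]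
          M ITest pc Nil by (auto simp: d code_delta_def pc' fun_upd_idem)
      then show ?thesis using goes_trans[OF rb] Nil g s'
        by (intro exI[of _ T] exI[of _ "?h + 1 + 1"]) auto
    next
      case (Cons x xs)
      have h: "?h = Suc (length xs)" using Cons by simp
      let ?ph = "if A x then 2 else 3"
      have "goes ?\<delta> (st pc 1) (Suc (length xs)) T (st pc ?ph) (length xs) T 1"
        using goes_Lft[where q = "st pc 1" and p = "length xs" and b = "T (Suc (length xs))"
            and T = T and \<delta> = ?\<delta> and q' = "st pc ?ph"] M ITest pc good_dig_top[OF g i Cons] h
        by (simp add: d code_delta_def)
      from goes_trans[OF goes_trans[OF rb[unfolded h] this] goes_return[where T = T, OF M pc, where ph = ?ph]]
      have "goes ?\<delta> (st pc 0) 1 T (st pc' 0) 1 T (Suc (length xs) + 1 + 1 + (length xs + 1))"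
        using ITest Cons by (auto simp: pc' split: if_splits)
      then show ?thesis using g s' H[OF i] h by (intro exI conjI) auto
    qed
  qed
qed

lemma istep_height:
  assumes "istep P (pc, s) = (pc', s')"
  shows "length (s' i) \<le> Suc (length (s i))"
  using assms by (cases "P ! pc") (auto simp: istep_def split: if_splits)

text \<open>An instruction raises a stack by at most one, so heights plus remaining steps never
  exceed \<open>H\<close>; this is the invariant, and every step is then charged the same
  \<open>2 * H + 4\<close>.\<close>

lemma isteps_simulation:
  assumes wf: "\<And>x. x \<in> set P \<Longrightarrow> wf_instr r (length P) x"
  shows "good r T s \<Longrightarrow> (\<And>i. i < r \<Longrightarrow> length (s i) + t \<le> H) \<Longrightarrow>
    (istep P ^^ t) (pc, s) = (pc', s') \<Longrightarrow>
    \<exists>T' t'. t' \<le> t * (2 * H + 4) \<and> goes (tm_delta r P) (st pc 0) 1 T (st pc' 0) 1 T' t' \<and>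
      good r T' s' \<and> (\<forall>i<r. length (s' i) \<le> H)"
proof (induction t arbitrary: T s pc)
  case 0
  then show ?case using goes_refl by fastforce
next
  case (Suc t)
  obtain pc1 s1 where s1: "istep P (pc, s) = (pc1, s1)" by fastforce
  have rest: "(istep P ^^ t) (pc1, s1) = (pc', s')"
    using Suc.prems(3) s1 by (simp add: funpow_swap1)
  have "\<exists>T1 t1. t1 \<le> 2 * H + 4 \<and> goes (tm_delta r P) (st pc 0) 1 T (st pc1 0) 1 T1 t1 \<and> good r T1 s1"
  proof (cases "pc < length P")
    case True
    then show ?thesis
      using Suc.prems(2) s1
      by (intro istep_simulation[OF Suc.prems(1) True wf]) (auto simp: istep_def dest: add_leD1 Suc_leD)
  next
    case False
    then show ?thesis using s1 Suc.prems(1) goes_refl by (fastforce simp: istep_def)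
  qed
  then obtain T1 t1 where T1: "t1 \<le> 2 * H + 4" "goes (tm_delta r P) (st pc 0) 1 T (st pc1 0) 1 T1 t1"
    "good r T1 s1" by blast
  have "length (s1 i) + t \<le> H" if "i < r" for i
    using istep_height[OF s1, of i] Suc.prems(2)[OF that] by simp
  from Suc.IH[OF T1(3) this rest] obtain T' t' where T': "t' \<le> t * (2 * H + 4)"
    "goes (tm_delta r P) (st pc1 0) 1 T1 (st pc' 0) 1 T' t'" "good r T' s'"
    "\<forall>i<r. length (s' i) \<le> H" by blast
  have "t1 + t' \<le> Suc t * (2 * H + 4)" using T1(1) T'(1) by simp
  then show ?case using goes_trans[OF T1(2) T'(2)] T'(3,4) by blast
qed

section \<open>From stacks back to output words\<close>

lemma tm_output_eq:
  assumes "\<And>j. nth0 rs j = nth0 out j" and "0 \<notin> set out"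
  shows "tm_output rs = out"
proof -
  have le: "length out \<le> length rs"
  proof (rule ccontr)
    assume "\<not> length out \<le> length rs"
    then have "nth0 out (length rs) = 0" and l: "length rs < length out"
      using assms(1)[of "length rs"] by (auto simp: nth0_def)
    then have "out ! length rs = 0" by (simp add: nth0_def)
    then show False using assms(2) l nth_mem by metis
  qed
  have "take (length out) rs = out"
  proof (intro nth_equalityI)
    fix i assume "i < length (take (length out) rs)"
    then show "take (length out) rs ! i = out ! i"
      using assms(1)[of i] le by (simp add: nth0_def)
  qed (use le in simp)
  moreover have z: "x = 0" if x: "x \<in> set (drop (length out) rs)" for x
  proof -
    obtain j where j: "j < length (drop (length out) rs)" "drop (length out) rs ! j = x"
      using x unfolding in_set_conv_nth by blast
    have "nth0 rs (length out + j) = x" using j le by (auto simp: nth0_def)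
    then show ?thesis using assms(1)[of "length out + j"] by (simp add: nth0_def)
  qed
  ultimately obtain zs where rs: "rs = out @ zs" and zs: "\<And>x. x \<in> set zs \<Longrightarrow> x = 0"
    by (metis append_take_drop_id)
  have "dropWhile (\<lambda>a. a = 0) (rev zs @ rev out) = dropWhile (\<lambda>a. a = 0) (rev out)"
    using zs by (intro dropWhile_append2) auto
  also have "\<dots> = rev out"
    using assms(2) by (cases out rule: rev_cases) auto
  finally show ?thesis by (simp add: tm_output_def rs)
qed

text \<open>The raw input tape already represents this store: an input symbol is below 4, so as a
  cell it has digit 0 equal to itself and all other tracks blank. The top of the stack is the last
  letter.\<close>

definition init_store :: "nat list \<Rightarrow> store" where
  "init_store w = (\<lambda>i. if i = 0 then rev w else [])"

text \<open>Heights are at most \<open>n + t\<close>. The summands pay for \<open>t\<close>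
  simulated instructions, for the projection of the tape to the output track, and for the
  startup.\<close>

definition tm_time :: "nat \<Rightarrow> nat \<Rightarrow> nat" where
  "tm_time n t = t * (2 * (n + t) + 4) + 2 * (n + t) + 5"

text \<open>Here \<open>h\<close> is the greatest stack height, so the first symbol 0 ends the sweep
  even if the output track is shorter than others. Digits are below \<open>4\<close> and hence
  differ from the marker, which guides the head back to position 1, where reading the output
  starts.\<close>

lemma goes_project:
  assumes T: "T 0 = 4 ^ r" "\<And>p. 0 < p \<Longrightarrow> T p < 4 ^ r"
    and nz: "\<And>p. 0 < p \<Longrightarrow> p \<le> h \<Longrightarrow> T p \<noteq> 0" and z: "\<And>p. h < p \<Longrightarrow> T p = 0"
    and r: "1 \<le> r"
  shows "goes (tm_delta r P) (st (length P) 0) 1 T 1 1 (\<lambda>p. if p = 0 then T p else dig 1 (T p))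
    (2 * h + 2)"
proof -
  let ?\<delta> = "tm_delta r P" and ?n = "length P"
  let ?U = "\<lambda>k p. if p = 0 \<or> k < p then T p else dig 1 (T p)"
  have d: "?\<delta> (st ?n ph) a = code_delta r P ?n ph a" if "ph < 4" for ph a
    using that by (rule tm_delta_st)
  have right: "k \<le> h \<Longrightarrow> goes ?\<delta> (st ?n 0) 1 T (st ?n 0) (Suc k) (?U k) k" for k
  proof (induction k)
    case 0
    have "?U 0 = T" by auto
    then show ?case using goes_refl[of ?\<delta> "st ?n 0" 1 T] by simp
  next
    case (Suc k)
    have "goes ?\<delta> (st ?n 0) (Suc k) (?U k) (st ?n 0) (Suc (Suc k))
        ((?U k)(Suc k := dig 1 (T (Suc k)))) 1"
      using nz[of "Suc k"] Suc.prems by (intro goes_Rgt) (auto simp: d code_delta_def)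
    moreover have "(?U k)(Suc k := dig 1 (T (Suc k))) = ?U (Suc k)" by auto
    moreover have "goes ?\<delta> (st ?n 0) 1 T (st ?n 0) (Suc k) (?U k) k" using Suc by simp
    ultimately have "goes ?\<delta> (st ?n 0) 1 T (st ?n 0) (Suc (Suc k)) (?U (Suc k)) (k + 1)"
      by (simp only:) (rule goes_trans)
    then show ?case by simp
  qed
  let ?V = "\<lambda>p. if p = 0 then T p else dig 1 (T p)"
  have UV: "?U h = ?V" using z by auto
  have V: "?V 0 = 4 ^ r" using T by simp
  have Vn: "?V p \<noteq> 4 ^ r" if "0 < p" for p
  proof -
    have "dig 1 (T p) < 4" by (rule dig_less)
    moreover have "(4::nat) ^ 1 \<le> 4 ^ r" using r by (intro power_increasing) auto
    ultimately show ?thesis using that by auto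
  qed
  have a: "goes ?\<delta> (st ?n 0) (Suc h) ?V (st ?n 2) h ?V 1"
    using goes_Lft[where q = "st ?n 0" and p = h and b = "?V (Suc h)" and T = ?V and \<delta> = ?\<delta>
        and q' = "st ?n 2"] z[of "Suc h"] by (simp add: d code_delta_def fun_upd_idem)
  have b: "goes ?\<delta> (st ?n 2) h ?V (st ?n 2) 0 ?V h"
    using Vn by (intro goes_walk_left) (auto simp: d code_delta_def)
  have c: "goes ?\<delta> (st ?n 2) 0 ?V 1 1 ?V 1"
    using goes_Rgt[where q = "st ?n 2" and p = 0 and b = "?V 0" and T = ?V and \<delta> = ?\<delta>
        and q' = 1] V by (simp add: d code_delta_def fun_upd_idem)
  have "goes ?\<delta> (st ?n 0) 1 T 1 1 ?V (h + 1 + h + 1)"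
    using goes_trans[OF goes_trans[OF goes_trans[OF right[OF le_refl, unfolded UV] a] b] c] .
  then show ?thesis by (simp add: mult_2)
qed

theorem tm_of_correct:
  assumes r: "2 \<le> r" and wf: "wf_cmd r c" and w: "w \<in> lists {1, 2, 3}"
    and ex: "exec c (init_store w) t s'"
  shows "\<exists>t' \<le> tm_time (length w) t. halts_with (tm_of r c) w t' (rev (s' 1))"
proof -
  define P where "P = compile 0 c"
  let ?\<delta> = "tm_delta r P" and ?H = "length w + t"
  have wfi: "wf_instr r (length P) x" if "x \<in> set P" for x
    using wf_comp[OF wf, of x 0] that by (simp add: P_def)
  define T0 where "T0 = (\<lambda>p. if p = 0 then 0 else nth0 w (p - 1))"
  define T where "T = T0(0 := 4 ^ r)"
  have w4: "nth0 w j < 4" for j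
    using w by (auto simp: nth0_def dest!: nth_mem)
  \<comment> \<open>The first move goes left from the first input cell and thereby creates the blank
    cell that becomes position 0 and soon holds the marker. \<open>conf_step\<close> does not cover
    such a move.\<close>
  have first: "conf 2 0 T0 (tm_step ?\<delta> (0, [], w))"
    by (cases w) (auto simp: conf_def tm_step_def tm_delta_def T0_def nth0_def nth_Cons
        split: nat.splits)
  have "goes ?\<delta> 2 0 T0 (st 0 0) 1 T 1"
    using goes_Rgt[where q = 2 and p = 0 and T = T0 and \<delta> = ?\<delta> and b = "4 ^ r" and q' = 4]
    by (simp add: T_def tm_delta_def st_def)
  then have start: "conf (st 0 0) 1 T ((tm_step ?\<delta> ^^ 2) (0, [], w))"
    using first unfolding goes_def by (simp only: numeral_2_eq_2 One_nat_def funpow.simps comp_apply id_apply)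
  have "(4::nat) ^ 1 \<le> 4 ^ r" using r by (intro power_increasing) auto
  then have "nth0 w j < 4 ^ r" for j using w4[of j] by simp
  moreover have "store_ok r (init_store w)"
    using w by (auto simp: store_ok_def init_store_def)
  ultimately have good: "good r T (init_store w)"
    by (auto simp: good_def T_def T0_def init_store_def dig_small w4)
  have run: "(istep P ^^ t) (0, init_store w) = (length P, s')"
    using comp_correct[OF ex, of P 0] by (simp add: P_def code_at_def)
  have "length (init_store w i) + t \<le> ?H" for i by (simp add: init_store_def)
  from isteps_simulation[OF wfi good this run] obtain T' t' where
    T': "t' \<le> t * (2 * ?H + 4)" "goes ?\<delta> (st 0 0) 1 T (st (length P) 0) 1 T' t'" "good r T' s'"
    "\<forall>i<r. length (s' i) \<le> ?H" by blast
  \<comment> \<open>The tallest stack alone keeps all cells up to \<open>h\<close> nonzero, while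
    beyond \<open>h\<close> every track is blank.\<close>
  define h where "h = Max ((\<lambda>i. length (s' i)) ` {..<r})"
  have len: "length (s' i) \<le> h" if "i < r" for i
    using that by (auto simp: h_def)
  have "h \<in> (\<lambda>i. length (s' i)) ` {..<r}"
    unfolding h_def using r by (intro Max_in) (auto simp: lessThan_empty_iff)
  then obtain i0 where i0: "i0 < r" "h = length (s' i0)" by auto
  have nz: "T' p \<noteq> 0" if "0 < p" "p \<le> h" for p
    using good_dig_nonblank[OF T'(3) i0(1), of p] that i0 by (metis dig_0)
  have z: "T' p = 0" if "h < p" for p
  proof (rule all_dig_0)
    show "T' p < 4 ^ r" using T'(3) that by (simp add: good_def)
    show "dig i (T' p) = 0" if "i < r" for i
      using T'(3) len[OF that] \<open>h < p\<close> that by (cases p) (auto simp: good_def nth0_def)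
  qed
  let ?V = "\<lambda>p. if p = 0 then T' p else dig 1 (T' p)"
  have "goes ?\<delta> (st (length P) 0) 1 T' 1 1 ?V (2 * h + 2)"
    using T'(3) nz z r by (intro goes_project) (auto simp: good_def)
  from goes_trans[OF T'(2) this] start
  have fin: "conf 1 1 ?V ((tm_step ?\<delta> ^^ (t' + (2 * h + 2))) ((tm_step ?\<delta> ^^ 2) (0, [], w)))"
    unfolding goes_def by blast
  define t'' where "t'' = t' + (2 * h + 2) + 2"
  have "conf 1 1 ?V ((tm_step ?\<delta> ^^ t'') (0, [], w))"
    using fin unfolding t''_def funpow_add by simp
  then obtain ls rs where rs: "(tm_step ?\<delta> ^^ t'') (0, [], w) = (1, ls, rs)"
    "\<And>j. nth0 rs j = ?V (1 + j)" unfolding conf_def by blast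
  have "nth0 rs j = nth0 (rev (s' 1)) j" for j
    using rs(2)[of j] T'(3) r by (simp add: good_def)
  moreover have "0 \<notin> set (rev (s' 1))"
  proof
    assume "0 \<in> set (rev (s' 1))"
    moreover have "1 < r" using r by simp
    ultimately show False using T'(3) unfolding good_def store_ok_def set_rev by blast
  qed
  ultimately have "tm_output rs = rev (s' 1)" by (rule tm_output_eq)
  then have "halts_with (tm_of r c) w t'' (rev (s' 1))"
    using rs(1) by (simp add: halts_with_def tm_of_def P_def)
  moreover have "h \<le> ?H" using i0 T'(4) by auto
  then have "t' + (2 * h + 2) + 2 \<le> t * (2 * ?H + 4) + 2 * ?H + 5"
    using add_mono[OF T'(1) mult_le_mono2[of h ?H 2]] by simp
  then have "t'' \<le> tm_time (length w) t" unfolding t''_def tm_time_def .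
  ultimately show ?thesis by blast
qed

section \<open>The graph construction\<close>

definition adj :: "(nat \<times> nat) list \<Rightarrow> nat \<Rightarrow> nat \<Rightarrow> bool" where
  "adj E v u \<longleftrightarrow> (v, u) \<in> set E \<or> (u, v) \<in> set E"

lemma mem_edges: "{u, v} \<in> edges E \<longleftrightarrow> adj E u v"
  by (auto simp: edges_def adj_def doubleton_eq_iff)

text \<open>For each index \<open>u\<close> the constraint vertex \<open>v\<close> gets exactly one
  edge: to the selector of \<open>u\<close> if \<open>u\<close> can dominate \<open>v\<close>,
  otherwise to a vertex of capacity 0. This padding makes the degree independent of the degree of
  \<open>v\<close> in \<open>E\<close>.\<close>

definition target :: "nat \<Rightarrow> (nat \<times> nat) list \<Rightarrow> nat \<Rightarrow> nat \<Rightarrow> nat" where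
  "target n E v u = (if adj E v u then n + u else 2 * n + u)"

text \<open>Vertex \<open>v\<close> of the given graph becomes a constraint vertex \<open>v\<close>, a selector
  \<open>n + v\<close> and a vertex \<open>2 * n + v\<close> of capacity 0.\<close>

definition out_edges :: "nat \<Rightarrow> (nat \<times> nat) list \<Rightarrow> (nat \<times> nat) list" where
  "out_edges n E = concat (map (\<lambda>v. (v, n + v) # map (\<lambda>u. (v, target n E v u)) [0..<n]) [0..<n])"

text \<open>The common value \<open>n\<close> plays two roles: it is one below the degree of a
  constraint vertex, but for a selector it is no restriction, its degree being at most
  \<open>n\<close>.\<close>

definition out_caps :: "nat \<Rightarrow> nat list" where
  "out_caps n = replicate (2 * n) n @ replicate n 0"

definition nbs :: "nat \<Rightarrow> (nat \<times> nat) list \<Rightarrow> nat \<Rightarrow> nat set" where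
  "nbs n E v = insert (n + v) (target n E v ` {0..<n})"

lemma set_out_edges: "set (out_edges n E) = Sigma {0..<n} (nbs n E)"
proof -
  have "set (out_edges n E) = (\<Union>v\<in>{0..<n}. Pair v ` nbs n E v)"
    by (simp add: out_edges_def nbs_def image_image)
  then show ?thesis by auto
qed

lemma nbs_range: "x \<in> nbs n E v \<Longrightarrow> v < n \<Longrightarrow> n \<le> x \<and> x < 3 * n"
  by (auto simp: nbs_def target_def split: if_splits)

lemma edges_out: "edges (out_edges n E) = (\<lambda>(v, x). {v, x}) ` Sigma {0..<n} (nbs n E)"
  by (auto simp: edges_def set_out_edges) blast

text \<open>The graph is bipartite with the constraint vertices below \<open>n\<close> and all
  others from \<open>n\<close> on, so an edge, though a set, determines its orientation. This makes
  the edge count exact.\<close>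

lemma inj_edge: "inj_on (\<lambda>(v, x). {v, x}) (Sigma {0..<n} (nbs n E))"
proof (rule inj_onI, clarify)
  fix v x v' x' assume "v \<in> {0..<n}" "v' \<in> {0..<n}" "x \<in> nbs n E v" "x' \<in> nbs n E v'"
    and e: "{v, x} = {v', x'}"
  then have "v < n" "v' < n" "n \<le> x" "n \<le> x'" using nbs_range by auto
  then show "v = v' \<and> x = x'" using e by (auto simp: doubleton_eq_iff)
qed

section \<open>Dominating sets correspond to capacitated covers\<close>

context
  fixes n :: nat and E :: "(nat \<times> nat) list"
  assumes valid: "valid_graph n E"
begin

lemma not_adj_self: "\<not> adj E v v"
  using valid by (auto simp: valid_graph_def adj_def)

lemma adj_less: "adj E v u \<Longrightarrow> u < n"
  using valid by (auto simp: valid_graph_def adj_def)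

lemma inj_target: "inj_on (target n E v) {0..<n}"
  by (auto simp: inj_on_def target_def split: if_splits)

lemma card_nbs: "v < n \<Longrightarrow> card (nbs n E v) = Suc n"
proof -
  assume v: "v < n"
  have "n + v \<notin> target n E v ` {0..<n}"
    using not_adj_self v by (auto simp: target_def split: if_splits)
  then show ?thesis by (simp add: nbs_def card_image inj_target)
qed

lemma finite_nbs: "finite (nbs n E v)"
  by (simp add: nbs_def)

lemma card_out_edges: "card (edges (out_edges n E)) = n * Suc n"
  by (simp add: edges_out card_image inj_edge finite_nbs card_nbs)

lemma finite_out_edges: "finite (edges (out_edges n E))"
  by (simp add: edges_out finite_nbs)

lemma incident_constraint:
  "v < n \<Longrightarrow> {e \<in> edges (out_edges n E). v \<in> e} = (\<lambda>x. {v, x}) ` nbs n E v"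
  using nbs_range by (fastforce simp: edges_out image_iff)

lemma card_incident_constraint:
  assumes "v < n" shows "card {e \<in> edges (out_edges n E). v \<in> e} = Suc n"
proof -
  have "inj_on (\<lambda>x. {v, x}) (nbs n E v)"
    by (auto simp: inj_on_def doubleton_eq_iff)
  then show ?thesis by (simp add: incident_constraint assms card_image card_nbs)
qed

lemma card_incident_other:
  assumes "n \<le> x" shows "card {e \<in> edges (out_edges n E). x \<in> e} \<le> n"
proof -
  have "{e \<in> edges (out_edges n E). x \<in> e} \<subseteq> (\<lambda>v. {v, x}) ` {0..<n}"
    using assms by (auto simp: edges_out)
  then have "card {e \<in> edges (out_edges n E). x \<in> e} \<le> card ((\<lambda>v. {v, x}) ` {0..<n})"
    by (intro card_mono) auto
  also have "\<dots> \<le> n" using card_image_le[of "{0..<n}"] by simp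
  finally show ?thesis .
qed

lemma card_incident: "card {e \<in> edges (out_edges n E). x \<in> e} \<le> n + 2"
  using card_incident_constraint[of x] card_incident_other[of x] by (cases "x < n") auto

lemma valid_out: "valid_graph (3 * n) (out_edges n E)"
  unfolding valid_graph_def set_out_edges using nbs_range by fastforce

lemma out_caps_nth:
  "x < 2 * n \<Longrightarrow> out_caps n ! x = n" "2 * n \<le> x \<Longrightarrow> x < 3 * n \<Longrightarrow> out_caps n ! x = 0"
  by (auto simp: out_caps_def nth_append)

text \<open>Every edge that meets a chosen selector is assigned to one, all others to their
  constraint vertex. A constraint vertex thus gives up at least the edge to the selector dominating
  it and keeps at most \<open>n\<close> of its \<open>n + 1\<close> edges.\<close>

lemma dominating_imp_cover:
  assumes D: "D \<subseteq> {0..<n}" and dom: "\<And>v. v < n \<Longrightarrow> v \<in> D \<or> (\<exists>u\<in>D. adj E u v)"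
  shows "is_cap_vc (3 * n) (out_edges n E) (out_caps n) ({0..<n} \<union> (\<lambda>u. n + u) ` D)"
proof -
  let ?A = "(\<lambda>u. n + u) ` D" let ?E = "edges (out_edges n E)"
  define \<alpha> where "\<alpha> e = (if \<exists>x\<in>?A. x \<in> e then (SOME x. x \<in> ?A \<and> x \<in> e) else (SOME v. v < n \<and> v \<in> e))"
    for e
  have edge: "\<exists>v x. e = {v, x} \<and> v < n \<and> n \<le> x \<and> x \<in> nbs n E v" if "e \<in> ?E" for e
    using that nbs_range by (fastforce simp: edges_out)
  have A: "\<alpha> e \<in> ?A \<and> \<alpha> e \<in> e" if "\<exists>x\<in>?A. x \<in> e" for e
  proof -
    have "\<exists>x. x \<in> ?A \<and> x \<in> e" using that by blast
    from someI_ex[OF this] show ?thesis using that by (simp add: \<alpha>_def)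
  qed
  have B: "\<alpha> e < n \<and> \<alpha> e \<in> e" if "\<not> (\<exists>x\<in>?A. x \<in> e)" "e \<in> ?E" for e
  proof -
    have "\<exists>v. v < n \<and> v \<in> e" using edge[OF that(2)] by blast
    from someI_ex[OF this] that(1) show ?thesis by (simp add: \<alpha>_def)
  qed
  have cov: "\<forall>e\<in>?E. \<alpha> e \<in> e \<and> \<alpha> e \<in> {0..<n} \<union> ?A"
    using A B by (metis UnI1 UnI2 atLeastLessThan_iff le0)
  have cap: "card {e \<in> ?E. \<alpha> e = w} \<le> out_caps n ! w" if w: "w \<in> {0..<n} \<union> ?A" for w
  proof -
    have w2: "w < 2 * n" using w D by auto
    have sub: "{e \<in> ?E. \<alpha> e = w} \<subseteq> {e \<in> ?E. w \<in> e}" using cov by blast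
    have fin: "finite {e \<in> ?E. w \<in> e}" using finite_out_edges by simp
    have "card {e \<in> ?E. \<alpha> e = w} \<le> n"
    proof (cases "w < n")
      case False
      then show ?thesis
        using card_mono[OF fin sub] card_incident_other[of w] by simp
    next
      case True
      obtain u where u: "u \<in> D" "n + u \<in> nbs n E w"
        using dom[OF True] True adj_less D
        by (force simp: nbs_def target_def adj_def image_iff)
      have "{w, n + u} \<in> {e \<in> ?E. w \<in> e}"
        using True u(2) by (auto simp: edges_out)
      moreover have "\<alpha> {w, n + u} \<noteq> w"
        using A[of "{w, n + u}"] u(1) True by auto
      ultimately have "{e \<in> ?E. \<alpha> e = w} \<subset> {e \<in> ?E. w \<in> e}" using sub by blast
      from psubset_card_mono[OF fin this] show ?thesis
        unfolding card_incident_constraint[OF True] by simp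
    qed
    then show ?thesis using w2 by (simp add: out_caps_nth)
  qed
  show ?thesis unfolding is_cap_vc_def
    using cov cap D by (intro conjI exI[of _ \<alpha>]) auto
qed

text \<open>The first conclusion is only an inequality because \<open>C\<close> may also contain
  vertices of capacity 0. These are assigned no edge, which both forces the constraint vertices into
  \<open>C\<close> and makes the edge that a constraint vertex hands over go to a selector.\<close>

lemma cover_imp_dominating:
  assumes C: "is_cap_vc (3 * n) (out_edges n E) (out_caps n) C"
  defines "D \<equiv> {u. u < n \<and> n + u \<in> C}"
  shows "n + card D \<le> card C" and "v < n \<Longrightarrow> v \<in> D \<or> (\<exists>u\<in>D. adj E u v)"
proof -
  let ?E = "edges (out_edges n E)"
  obtain \<alpha> where sub: "C \<subseteq> {0..<3 * n}" and cov: "\<And>e. e \<in> ?E \<Longrightarrow> \<alpha> e \<in> e \<and> \<alpha> e \<in> C"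
    and cap: "\<And>w. w \<in> C \<Longrightarrow> card {e \<in> ?E. \<alpha> e = w} \<le> out_caps n ! w"
    using C unfolding is_cap_vc_def by blast
  have low: "\<alpha> e < 2 * n" if e: "e \<in> ?E" for e
  proof (rule ccontr)
    assume "\<not> \<alpha> e < 2 * n"
    then have "out_caps n ! \<alpha> e = 0" using cov[OF e] sub by (intro out_caps_nth) auto
    then have "card {e' \<in> ?E. \<alpha> e' = \<alpha> e} = 0" using cap cov[OF e] by fastforce
    then show False using e finite_out_edges by auto
  qed
  have forced: "v \<in> C" if v: "v < n" for v
  proof -
    \<comment> \<open>Without loops \<open>v\<close> is not adjacent to itself, so for
      \<open>u = v\<close> the target is the vertex of capacity 0.\<close>
    have "{v, 2 * n + v} \<in> ?E"
      using v not_adj_self by (force simp: edges_out nbs_def target_def)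
    then show ?thesis using low cov by fastforce
  qed
  have "{0..<n} \<union> (\<lambda>u. n + u) ` D \<subseteq> C" using forced by (auto simp: D_def)
  moreover have "card ({0..<n} \<union> (\<lambda>u. n + u) ` D) = n + card D"
    by (subst card_Un_disjoint) (auto simp: D_def card_image)
  moreover have "finite C" using sub finite_subset by blast
  ultimately show "n + card D \<le> card C" using card_mono by metis
  show "v \<in> D \<or> (\<exists>u\<in>D. adj E u v)" if v: "v < n"
  proof -
    have "\<exists>e \<in> {e \<in> ?E. v \<in> e}. \<alpha> e \<noteq> v"
    proof (rule ccontr)
      assume "\<not> ?thesis"
      then have "{e \<in> ?E. v \<in> e} \<subseteq> {e \<in> ?E. \<alpha> e = v}" by blast
      moreover have "finite {e \<in> ?E. \<alpha> e = v}" using finite_out_edges by simp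
      ultimately have "card {e \<in> ?E. v \<in> e} \<le> card {e \<in> ?E. \<alpha> e = v}" by (intro card_mono)
      then have "Suc n \<le> card {e \<in> ?E. \<alpha> e = v}"
        unfolding card_incident_constraint[OF v] .
      then show False using cap[OF forced[OF v]] v by (simp add: out_caps_nth)
    qed
    then obtain x where x: "x \<in> nbs n E v" "\<alpha> {v, x} \<noteq> v" "{v, x} \<in> ?E"
      using incident_constraint[OF v] by auto
    then have "x \<in> C" "x < 2 * n" using cov low by fastforce+
    then show ?thesis using x(1) v by (auto simp: nbs_def target_def D_def adj_def split: if_splits)
  qed
qed

text \<open>For \<open>n = 0\<close> the quotient is 0 and the budget is \<open>k + 1\<close>, one
  more than \<open>n + k\<close>; this is harmless because the dominating set read off is then
  empty.\<close>

theorem reduction_correct: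
  "ds_yes n k E \<longleftrightarrow> cvcl1_yes (n + 2) (k + 1) (3 * n) (out_caps n) (out_edges n E)"
proof -
  have bound: "real c \<le> real (card (edges (out_edges n E))) / real (n + 2) + real (k + 1) \<longleftrightarrow>
      n = 0 \<and> c \<le> k + 1 \<or> c \<le> n + k" for c :: nat
  proof (cases "n = 0")
    case False
    have "real c \<le> real (card (edges (out_edges n E))) / real (n + 2) + real (k + 1) \<longleftrightarrow>
        real c * (n + 2) \<le> n * Suc n + (k + 1) * (n + 2)"
      unfolding card_out_edges by (simp add: field_simps)
    also have "\<dots> \<longleftrightarrow> c * (n + 2) \<le> n * Suc n + (k + 1) * (n + 2)"
      by (simp only: of_nat_mult[symmetric] of_nat_add[symmetric] of_nat_le_iff)
    \<comment> \<open>The remainder 2 is smaller than \<open>n + 2\<close> since \<open>n\<close> is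
      not 0, so it never pays for another vertex.\<close>
    also have "n * Suc n + (k + 1) * (n + 2) = (n + k) * (n + 2) + 2"
      by (simp add: algebra_simps)
    also have "c * (n + 2) \<le> (n + k) * (n + 2) + 2 \<longleftrightarrow> c \<le> n + k"
    proof
      assume c: "c * (n + 2) \<le> (n + k) * (n + 2) + 2"
      show "c \<le> n + k"
      proof (rule ccontr)
        assume "\<not> c \<le> n + k"
        then have "(n + k + 1) * (n + 2) \<le> c * (n + 2)" by (intro mult_le_mono1) simp
        then show False using c False by (simp add: algebra_simps)
      qed
    next
      assume "c \<le> n + k"
      then have "c * (n + 2) \<le> (n + k) * (n + 2)" by (rule mult_le_mono1)
      then show "c * (n + 2) \<le> (n + k) * (n + 2) + 2" by simp
    qed
    finally show ?thesis using False by simp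
  next
    case True
    then have "card (edges (out_edges n E)) = 0" using card_out_edges by simp
    then show ?thesis using True by auto
  qed
  have cv: "cvcl1_yes (n + 2) (k + 1) (3 * n) (out_caps n) (out_edges n E) \<longleftrightarrow>
     (\<exists>C. is_cap_vc (3 * n) (out_edges n E) (out_caps n) C \<and> (n = 0 \<and> card C \<le> k + 1 \<or> card C \<le> n + k))"
    unfolding cvcl1_yes_def bound using card_incident valid_out by (simp add: out_caps_def)
  show ?thesis
  proof
    assume "ds_yes n k E"
    then obtain D where D: "D \<subseteq> {0..<n}" "card D \<le> k" "\<And>v. v < n \<Longrightarrow> v \<in> D \<or> (\<exists>u\<in>D. adj E u v)"
      unfolding ds_yes_def mem_edges by blast
    have "card ({0..<n} \<union> (\<lambda>u. n + u) ` D) \<le> n + card D"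
      using card_Un_le[of "{0..<n}" "(\<lambda>u. n + u) ` D"] by (simp add: card_image)
    then show "cvcl1_yes (n + 2) (k + 1) (3 * n) (out_caps n) (out_edges n E)"
      unfolding cv using dominating_imp_cover[OF D(1,3)] D(2) by (meson add_left_mono order_trans)
  next
    assume "cvcl1_yes (n + 2) (k + 1) (3 * n) (out_caps n) (out_edges n E)"
    then obtain C where C: "is_cap_vc (3 * n) (out_edges n E) (out_caps n) C"
      "n = 0 \<and> card C \<le> k + 1 \<or> card C \<le> n + k" unfolding cv by blast
    define D where "D = {u. u < n \<and> n + u \<in> C}"
    have D: "n + card D \<le> card C" "\<And>v. v < n \<Longrightarrow> v \<in> D \<or> (\<exists>u\<in>D. adj E u v)"
      using cover_imp_dominating[OF C(1)] unfolding D_def by blast+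
    have "card D \<le> k" using C(2) D(1) by (auto simp: D_def)
    moreover have "D \<subseteq> {0..<n}" by (auto simp: D_def)
    ultimately show "ds_yes n k E" unfolding ds_yes_def mem_edges using valid D(2) by blast
  qed
qed

text \<open>All but \<open>2 * length E\<close> vertices are isolated and hence lie in every dominating set.\<close>

lemma ds_yes_imp_few_vertices:
  assumes "ds_yes n k E" shows "n \<le> k + 2 * length E"
proof -
  obtain D where D: "D \<subseteq> {0..<n}" "card D \<le> k" "\<And>v. v < n \<Longrightarrow> v \<in> D \<or> (\<exists>u\<in>D. adj E u v)"
    using assms unfolding ds_yes_def mem_edges by blast
  let ?S = "fst ` set E" and ?T = "snd ` set E"
  have "{0..<n} \<subseteq> D \<union> (?S \<union> ?T)" using D(3) by (force simp: adj_def)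
  moreover have fin: "finite (D \<union> (?S \<union> ?T))" using D(1) finite_subset by auto
  ultimately have "card {0..<n} \<le> card (D \<union> (?S \<union> ?T))" by (intro card_mono)
  also have "\<dots> \<le> card D + (card ?S + card ?T)"
    using card_Un_le[of D "?S \<union> ?T"] card_Un_le[of ?S ?T] by linarith
  also have "\<dots> \<le> k + (length E + length E)"
    using D(2) card_image_le[of "set E" fst] card_image_le[of "set E" snd] card_length[of E]
    by (intro add_mono) auto
  finally show ?thesis by simp
qed

end

section \<open>Verified stack programs\<close>

text \<open>An upper bound in place of the exact time lets branches of different length share one
  bound.\<close>

definition runs :: "cmd \<Rightarrow> store \<Rightarrow> store \<Rightarrow> nat \<Rightarrow> bool" where
  "runs c s s' T \<longleftrightarrow> (\<exists>t\<le>T. exec c s t s')"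

lemma runs_mono: "runs c s s' T \<Longrightarrow> T \<le> T' \<Longrightarrow> runs c s s' T'"
  unfolding runs_def using le_trans by blast

lemma runs_Seq: "runs c s s' T \<Longrightarrow> runs d s' s'' T' \<Longrightarrow> runs (c ;; d) s s'' (T + T')"
  unfolding runs_def by (meson Seq add_mono)

lemma runs_If:
  assumes "A (top0 (s i)) \<Longrightarrow> runs c s s' T" and "\<not> A (top0 (s i)) \<Longrightarrow> runs d s s' T"
  shows "runs (If i A c d) s s' (T + 2)"
proof (cases "A (top0 (s i))")
  case True
  then obtain t where "t \<le> T" "exec c s t s'" using assms(1) by (auto simp: runs_def)
  then show ?thesis using IfT[of A s i c t s' d] True unfolding runs_def by (intro exI[of _ "t + 2"]) simp
next
  case False
  then obtain t where "t \<le> T" "exec d s t s'" using assms(2) by (auto simp: runs_def)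
  then show ?thesis using IfF[of A s i d t s' c] False unfolding runs_def by (intro exI[of _ "t + 1"]) simp
qed

lemma runs_WhileF: "\<not> A (top0 (s i)) \<Longrightarrow> runs (While i A c) s s 1"
  unfolding runs_def using WhileF by blast

lemma runs_WhileT:
  assumes "A (top0 (s i))" "runs c s s' T" "runs (While i A c) s' s'' T'"
  shows "runs (While i A c) s s'' (T + 2 + T')"
proof -
  obtain t t' where "t \<le> T" "exec c s t s'" "t' \<le> T'" "exec (While i A c) s' t' s''"
    using assms(2,3) unfolding runs_def by blast
  then show ?thesis using WhileT[of A s i, OF assms(1)] unfolding runs_def by (meson add_mono le_refl)
qed

text \<open>In place of an invariant, \<open>\<sigma> m\<close> gives the whole store after
  \<open>m\<close> rounds. The bound uses \<open>X\<close> rather than the number of rounds, so that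
  it depends only on the global size bound.\<close>

lemma runs_While:
  assumes "\<And>m. m < n \<Longrightarrow> A (top0 (\<sigma> m i)) \<and> runs c (\<sigma> m) (\<sigma> (Suc m)) T"
    and "\<not> A (top0 (\<sigma> n i))" and "n \<le> X" and "\<sigma> 0 = s" and "\<sigma> n = s'"
  shows "runs (While i A c) s s' (X * (T + 2) + 1)"
proof -
  \<comment> \<open>Induction on the rounds still to be done, because \<open>exec\<close> unfolds a
    loop from its front.\<close>
  have "m \<le> n \<Longrightarrow> runs (While i A c) (\<sigma> (n - m)) (\<sigma> n) (m * (T + 2) + 1)" for m
  proof (induction m)
    case 0
    show ?case using runs_WhileF[of A "\<sigma> n" i, OF assms(2)] by simp
  next
    case (Suc m)
    then have m: "n - Suc m < n" "Suc (n - Suc m) = n - m" by auto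
    have "runs (While i A c) (\<sigma> (n - Suc m)) (\<sigma> n) (T + 2 + (m * (T + 2) + 1))"
      using assms(1)[OF m(1)] Suc m(2) by (intro runs_WhileT) auto
    then show ?case by (simp add: add.assoc add.commute add.left_commute)
  qed
  from this[of n] have "runs (While i A c) s s' (n * (T + 2) + 1)" using assms(4,5) by simp
  moreover have "n * (T + 2) + 1 \<le> X * (T + 2) + 1" using assms(3) by (intro add_le_mono1 mult_le_mono1)
  ultimately show ?thesis by (rule runs_mono)
qed

text \<open>Loop-free commands can be evaluated by the simplifier.\<close>

fun loopfree :: "cmd \<Rightarrow> bool" where
  "loopfree (c ;; d) = (loopfree c \<and> loopfree d)"
| "loopfree (If i A c d) = (loopfree c \<and> loopfree d)"
| "loopfree (While i A c) = False"
| "loopfree c = True"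

fun result :: "cmd \<Rightarrow> store \<Rightarrow> store" where
  "result Skip s = s"
| "result (Push i a) s = s(i := a # s i)"
| "result (Pop i) s = s(i := tl (s i))"
| "result (c ;; d) s = result d (result c s)"
| "result (If i A c d) s = (if A (top0 (s i)) then result c s else result d s)"
| "result (While i A c) s = s"

fun cost :: "cmd \<Rightarrow> nat" where
  "cost (c ;; d) = cost c + cost d"
| "cost (If i A c d) = cost c + cost d + 2"
| "cost c = 1"

lemma runs_loopfree:
  assumes "loopfree c" "result c s = s'" "cost c \<le> T"
  shows "runs c s s' T"
proof -
  have "loopfree c \<Longrightarrow> runs c s (result c s) (cost c)"
  proof (induction c arbitrary: s)
    case (Seq c d)
    then show ?case by (auto intro: runs_Seq)
  next
    case (If i A c d)
    then show ?case using runs_mono[OF _ le_add1] runs_mono[OF _ le_add2]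
      by (auto intro!: runs_If simp del: One_nat_def add_2_eq_Suc' add_2_eq_Suc)
  next
    case (Push i a)
    then show ?case using exec.Push[of i a s] by (auto simp: runs_def fun_upd_def)
  next
    case (Pop i)
    then show ?case using exec.Pop[of i s] by (auto simp: runs_def fun_upd_def)
  qed (auto simp: runs_def intro: exec.Skip)
  then show ?thesis using assms runs_mono by blast
qed

subsection \<open>Unary arithmetic\<close>

text \<open>Registers of the reduction: 0 input, 1 output, 2 reversed input, 3 bound on \<open>n\<close>,
  4 rejection flag, 5 and 6 binary \<open>n\<close> and \<open>k\<close>, 7 and 8 unary \<open>k\<close> and \<open>n\<close>,
  9 scratch, 10 bound on vertices, 11 parity, 12 and 13 edge list, 14 and 15 loop counters with
  their remaining iterations in 16 and 17, 18 number to be written, 19 remainder, 20 number of edges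
  found, 21 nonempty after an unsuccessful comparison.\<close>

definition tk :: "nat \<Rightarrow> nat list" where
  "tk n = replicate n 1"

lemma tk_simps [simp]:
  "tk 0 = []" "tk (Suc n) = Suc 0 # tk n" "length (tk n) = n" "tk m @ tk n = tk (m + n)"
  "rev (tk n) = tk n" "tk n = [] \<longleftrightarrow> n = 0"
  by (simp_all add: tk_def replicate_add)

lemma tl_tk [simp]: "tl (tk n) = tk (n - 1)"
  by (cases n) simp_all

lemma top0_tk [simp]: "top0 (tk n) = (if n = 0 then 0 else 1)"
  by (cases n) simp_all

lemma tl_tk_append [simp]: "0 < n \<Longrightarrow> tl (tk n @ xs) = tk (n - 1) @ xs"
  by (cases n) simp_all

lemma top0_tk_append [simp]: "0 < n \<Longrightarrow> top0 (tk n @ xs) = 1"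
  by (cases n) simp_all

lemma tk_append_append [simp]: "tk m @ tk n @ xs = tk (m + n) @ xs"
  by (simp add: tk_def replicate_add)

lemma tk_Suc_append: "tk n @ Suc 0 # xs = Suc 0 # tk n @ xs"
  by (induction n) auto

abbreviation nz :: "nat \<Rightarrow> bool" where
  "nz \<equiv> \<lambda>x. x \<noteq> 0"

definition mv :: "nat \<Rightarrow> nat \<Rightarrow> cmd" where
  "mv i j = While i nz (Pop i ;; Push j 1)"

text \<open>Here and below, \<open>X\<close> bounds the numbers, lengths or repetitions involved.
  The time bounds are left in the shape in which \<open>runs_Seq\<close> and
  \<open>runs_While\<close> produce them, so the rules apply verbatim; only the final polynomial
  bound unfolds them.\<close>

definition C_mv :: "nat \<Rightarrow> nat" where
  "C_mv X = X * (2 + 2) + 1"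

lemma runs_mv:
  assumes "i \<noteq> j" "s i = tk n" "n \<le> X" "s' = s(i := [], j := tk n @ s j)"
  shows "runs (mv i j) s s' (C_mv X)"
  unfolding mv_def C_mv_def
proof (rule runs_While[where \<sigma> = "\<lambda>m. s(i := tk (n - m), j := tk m @ s j)" and n = n])
  fix m assume "m < n"
  then show "nz (top0 ((s(i := tk (n - m), j := tk m @ s j)) i)) \<and>
      runs (Pop i ;; Push j 1) (s(i := tk (n - m), j := tk m @ s j))
        (s(i := tk (n - Suc m), j := tk (Suc m) @ s j)) 2"
    using assms(1) by (auto intro!: runs_loopfree simp: fun_eq_iff)
qed (use assms in auto)

definition clr :: "nat \<Rightarrow> cmd" where
  "clr i = While i nz (Pop i)"

lemma runs_clr:
  assumes "s i = tk n" "n \<le> X" "s' = s(i := [])"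
  shows "runs (clr i) s s' (C_mv X)"
proof -
  have "runs (clr i) s s' (X * (1 + 2) + 1)"
    unfolding clr_def
  proof (rule runs_While[where \<sigma> = "\<lambda>m. s(i := tk (n - m))" and n = n])
    fix m assume "m < n"
    then show "nz (top0 ((s(i := tk (n - m))) i)) \<and>
        runs (Pop i) (s(i := tk (n - m))) (s(i := tk (n - Suc m))) 1"
      by (auto intro!: runs_loopfree simp: fun_eq_iff)
  qed (use assms in auto)
  then show ?thesis by (rule runs_mono) (simp add: C_mv_def)
qed

text \<open>Counting empties a stack, so the ticks go to \<open>t\<close> as well and are moved back
  from there. The copy is added to \<open>l\<close>, so repeated copying forms sums such as
  \<open>n + v\<close> or \<open>3 * n\<close>.\<close>

definition cp :: "nat \<Rightarrow> nat \<Rightarrow> nat \<Rightarrow> cmd" where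
  "cp i t l = While i nz (Pop i ;; Push t 1 ;; Push l 1) ;; mv t i"

definition C_cp :: "nat \<Rightarrow> nat" where
  "C_cp X = (X * (3 + 2) + 1) + C_mv X"

lemma runs_cp:
  assumes "i \<noteq> t" "i \<noteq> l" "t \<noteq> l" "s i = tk n" "s t = []" "n \<le> X" "s' = s(l := tk n @ s l)"
  shows "runs (cp i t l) s s' (C_cp X)"
proof -
  have "runs (While i nz (Pop i ;; Push t 1 ;; Push l 1)) s (s(i := [], t := tk n, l := tk n @ s l))
      (X * (3 + 2) + 1)"
  proof (rule runs_While[where \<sigma> = "\<lambda>m. s(i := tk (n - m), t := tk m, l := tk m @ s l)" and n = n])
    fix m assume "m < n"
    then show "nz (top0 ((s(i := tk (n - m), t := tk m, l := tk m @ s l)) i)) \<and>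
        runs (Pop i ;; Push t 1 ;; Push l 1) (s(i := tk (n - m), t := tk m, l := tk m @ s l))
          (s(i := tk (n - Suc m), t := tk (Suc m), l := tk (Suc m) @ s l)) 3"
      using assms(1-3) by (auto intro!: runs_loopfree simp: fun_eq_iff)
  qed (use assms in auto)
  moreover have "runs (mv t i) (s(i := [], t := tk n, l := tk n @ s l)) s' (C_mv X)"
    using assms by (intro runs_mv[where n = n]) (auto simp: fun_eq_iff)
  ultimately show ?thesis unfolding cp_def C_cp_def by (rule runs_Seq)
qed

subsection \<open>Binary output of unary numbers\<close>

text \<open>Register 19 toggles with every tick taken from 18 and each second tick goes to 9. What
  is left in 19 is the parity, the next binary digit; least significant first is the order in which
  words are written.\<close>

definition halve :: cmd where
  "halve = While 18 nz (Pop 18 ;; If 19 nz (Pop 19 ;; Push 9 1) (Push 19 1)) ;;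
     If 19 nz (Pop 19 ;; Push 1 2) (Push 1 1) ;; mv 9 18"

definition emit :: cmd where
  "emit = While 18 nz halve ;; Push 1 3"

definition C_halve :: "nat \<Rightarrow> nat" where
  "C_halve X = (X * (6 + 2) + 1) + (5 + C_mv X)"

definition C_emit :: "nat \<Rightarrow> nat" where
  "C_emit X = (X * (C_halve X + 2) + 1) + 1"

lemma runs_halve:
  assumes s: "s 18 = tk x" "s 19 = []" "s 9 = []" and x: "x \<le> X"
    and s': "s' = s(18 := tk (x div 2), 1 := (if even x then 1 else 2) # s 1)"
  shows "runs halve s s' (C_halve X)"
proof -
  let ?s1 = "s(18 := [], 19 := tk (x mod 2), 9 := tk (x div 2))"
  let ?s2 = "s(18 := [], 9 := tk (x div 2), 1 := (if even x then 1 else 2) # s 1)"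
  let ?\<sigma> = "\<lambda>m. s(18 := tk (x - m), 19 := tk (m mod 2), 9 := tk (m div 2))"
  have "runs (While 18 nz (Pop 18 ;; If 19 nz (Pop 19 ;; Push 9 1) (Push 19 1))) s ?s1
      (X * (6 + 2) + 1)"
  proof (rule runs_While[where \<sigma> = ?\<sigma> and n = x])
    fix m assume m: "m < x"
    have md: "Suc m mod 2 = (if m mod 2 = 0 then 1 else 0)"
      "Suc m div 2 = (if m mod 2 = 0 then m div 2 else Suc (m div 2))" by presburger+
    show "nz (top0 (?\<sigma> m 18)) \<and>
        runs (Pop 18 ;; If 19 nz (Pop 19 ;; Push 9 1) (Push 19 1)) (?\<sigma> m) (?\<sigma> (Suc m)) 6"
      unfolding md using m by (cases "m mod 2 = 0") (auto intro!: runs_loopfree simp: fun_eq_iff)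
  qed (use s x in \<open>auto simp: fun_eq_iff\<close>)
  moreover have "runs (If 19 nz (Pop 19 ;; Push 1 2) (Push 1 1)) ?s1 ?s2 5"
    using s by (intro runs_loopfree) (auto simp: fun_eq_iff even_iff_mod_2_eq_zero)
  moreover have "runs (mv 9 18) ?s2 s' (C_mv X)"
    using s x s' by (intro runs_mv[where n = "x div 2"]) (auto simp: fun_eq_iff)
  ultimately show ?thesis unfolding halve_def C_halve_def by (intro runs_Seq)
qed

declare bin.simps [simp del]

lemma bin_0 [simp]: "bin 0 = []"
  by (simp add: bin.simps)

lemma runs_halve_loop:
  assumes "s 18 = tk x" "s 19 = []" "s 9 = []" "x \<le> X" "s' = s(18 := [], 1 := rev (bin x) @ s 1)"
  shows "runs (While 18 nz halve) s s' (x * (C_halve X + 2) + 1)"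
  using assms
proof (induction x arbitrary: s rule: less_induct)
  case (less x)
  show ?case
  proof (cases "x = 0")
    case True
    then have "s' = s" using less.prems by (auto simp: fun_eq_iff)
    then show ?thesis using runs_WhileF[of nz s 18 halve] less.prems True by simp
  next
    case False
    let ?s1 = "s(18 := tk (x div 2), 1 := (if even x then 1 else 2) # s 1)"
    have a: "runs halve s ?s1 (C_halve X)"
      using less.prems by (intro runs_halve) auto
    have b: "runs (While 18 nz halve) ?s1 s' (x div 2 * (C_halve X + 2) + 1)"
      using less.prems False
      by (intro less.IH) (auto simp: fun_eq_iff bin.simps[of x])
    have c: "runs (While 18 nz halve) s s' (C_halve X + 2 + (x div 2 * (C_halve X + 2) + 1))"
      using runs_WhileT[OF _ a b] less.prems False by simp
    \<comment> \<open>As \<open>x\<close> is positive, \<open>1 + x div 2\<close> is at most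
      \<open>x\<close>; counting \<open>x\<close> rounds instead of the digits is good
      enough.\<close>
    have "Suc (x div 2) * (C_halve X + 2) \<le> x * (C_halve X + 2)"
      using False by (intro mult_le_mono1) presburger
    then show ?thesis by (intro runs_mono[OF c]) simp
  qed
qed

lemma runs_emit:
  assumes "s 18 = tk x" "s 19 = []" "s 9 = []" "x \<le> X" "s' = s(18 := [], 1 := rev (enc_nat x) @ s 1)"
  shows "runs emit s s' (C_emit X)"
  unfolding emit_def C_emit_def
proof (rule runs_Seq)
  have "runs (While 18 nz halve) s (s(18 := [], 1 := rev (bin x) @ s 1)) (x * (C_halve X + 2) + 1)"
    using assms by (intro runs_halve_loop) auto
  moreover have "x * (C_halve X + 2) + 1 \<le> X * (C_halve X + 2) + 1"
    using assms(4) by (intro add_le_mono1 mult_le_mono1)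
  ultimately show "runs (While 18 nz halve) s (s(18 := [], 1 := rev (bin x) @ s 1))
      (X * (C_halve X + 2) + 1)"
    by (rule runs_mono)
  show "runs (Push 1 3) (s(18 := [], 1 := rev (bin x) @ s 1)) s' 1"
    using assms by (intro runs_loopfree) (auto simp: fun_eq_iff enc_nat_def)
qed

subsection \<open>Searching the edge list\<close>

definition blk :: "nat list \<Rightarrow> nat list" where
  "blk xs = concat (map (\<lambda>x. tk x @ [3]) xs)"

lemma blk_simps [simp]: "blk [] = []" "blk (x # xs) = tk x @ 3 # blk xs" "blk (xs @ ys) = blk xs @ blk ys"
  by (simp_all add: blk_def)

text \<open>The number of ticks that a comparison leaves in register 21: the excess of
  \<open>p\<close> over \<open>a\<close>, or one tick if \<open>p\<close> is too small. Only its
  vanishing matters.\<close>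

definition neq :: "nat \<Rightarrow> nat \<Rightarrow> nat" where
  "neq p a = (p - a) + (if p < a then 1 else 0)"

lemma neq_0 [simp]: "neq p a = 0 \<longleftrightarrow> p = a"
  by (auto simp: neq_def)

text \<open>The separator is pushed to \<open>f\<close> before the ticks, so a transferred block
  again consists of ticks with the separator below them, and \<open>f\<close> becomes the same block
  list in reverse order. Register 9 keeps the ticks of \<open>v\<close> for restoring it.\<close>

definition cmp :: "nat \<Rightarrow> nat \<Rightarrow> nat \<Rightarrow> cmd" where
  "cmp e f v = Push f 3 ;;
     While e (\<lambda>x. x = 1) (Pop e ;; Push f 1 ;; If v nz (Pop v ;; Push 9 1) (Push 21 1)) ;;
     If v nz (Push 21 1) Skip ;; mv 9 v ;; Pop e"

definition C_cmp :: "nat \<Rightarrow> nat" where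
  "C_cmp X = 1 + ((X * (7 + 2) + 1) + (4 + (C_mv X + 1)))"

lemma runs_cmp:
  assumes d: "distinct [e, f, v, 9, 21]" and s: "s e = tk p @ 3 # es" "s v = tk a" "s 9 = []"
    and X: "p \<le> X" "a \<le> X"
    and s': "s' = s(e := es, f := tk p @ 3 # s f, 21 := tk (neq p a) @ s 21)"
  shows "runs (cmp e f v) s s' (C_cmp X)"
proof -
  let ?\<sigma> = "\<lambda>m. s(e := tk (p - m) @ 3 # es, f := tk m @ 3 # s f, v := tk (a - m),
    9 := tk (min m a), 21 := tk (m - a) @ s 21)"
  let ?s1 = "s(f := 3 # s f)"
  let ?s3 = "s(e := 3 # es, f := tk p @ 3 # s f, v := tk (a - p), 9 := tk (min p a),
    21 := tk (neq p a) @ s 21)"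
  let ?s4 = "s(e := 3 # es, f := tk p @ 3 # s f, 21 := tk (neq p a) @ s 21)"
  have "runs (Push f 3) s ?s1 1" by (rule runs_loopfree) auto
  moreover have "runs (While e (\<lambda>x. x = 1) (Pop e ;; Push f 1 ;; If v nz (Pop v ;; Push 9 1) (Push 21 1)))
      ?s1 (?\<sigma> p) (X * (7 + 2) + 1)"
  proof (rule runs_While[where \<sigma> = ?\<sigma> and n = p])
    fix m assume m: "m < p"
    show "top0 (?\<sigma> m e) = 1 \<and>
       runs (Pop e ;; Push f 1 ;; If v nz (Pop v ;; Push 9 1) (Push 21 1)) (?\<sigma> m) (?\<sigma> (Suc m)) 7"
    proof
      show "top0 (?\<sigma> m e) = 1" using m d by auto
      show "runs (Pop e ;; Push f 1 ;; If v nz (Pop v ;; Push 9 1) (Push 21 1)) (?\<sigma> m) (?\<sigma> (Suc m)) 7"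
      proof (cases "m < a")
        case True
        then have eq: "Suc m - a = 0" "m - a = 0" "min (Suc m) a = Suc m" "min m a = m" by auto
        show ?thesis unfolding eq using m d True by (intro runs_loopfree) (auto simp: fun_eq_iff)
      next
        case False
        then have eq: "Suc m - a = Suc (m - a)" "min (Suc m) a = a" "min m a = a"
          "a - Suc m = 0" "a - m = 0" by auto
        show ?thesis unfolding eq using m d by (intro runs_loopfree) (auto simp: fun_eq_iff)
      qed
    qed
  qed (use d s X in \<open>auto simp: fun_eq_iff\<close>)
  moreover have "runs (If v nz (Push 21 1) Skip) (?\<sigma> p) ?s3 4"
    using d by (intro runs_loopfree) (auto simp: fun_eq_iff neq_def)
  moreover have "min p a + (a - p) = a" by simp
  then have "runs (mv 9 v) ?s3 ?s4 (C_mv X)"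
    using d s X by (intro runs_mv[where n = "min p a"]) (auto simp: fun_eq_iff)
  moreover have "runs (Pop e) ?s4 s' 1"
    using d s' by (intro runs_loopfree) (auto simp: fun_eq_iff)
  ultimately show ?thesis unfolding cmp_def C_cmp_def by (intro runs_Seq)
qed

text \<open>Both comparisons leave their ticks in register 21, which is therefore empty exactly if
  both coordinates agree.\<close>

definition compare_edge :: "nat \<Rightarrow> nat \<Rightarrow> nat \<Rightarrow> nat \<Rightarrow> cmd" where
  "compare_edge e f v u = cmp e f v ;; cmp e f u ;; If 21 nz (clr 21) (Push 20 1)"

definition C_edge :: "nat \<Rightarrow> nat" where
  "C_edge X = C_cmp X + (C_cmp X + (C_mv (X + X + 2) + 2))"

lemma runs_compare_edge:
  assumes d: "distinct [e, f, v, 9, 20, 21]" "distinct [e, f, u, 9, 20, 21]"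
    and s: "s e = tk p @ 3 # tk q @ 3 # es" "s v = tk a" "s u = tk b" "s 9 = []" "s 21 = []"
    and X: "p \<le> X" "q \<le> X" "a \<le> X" "b \<le> X"
    and s': "s' = s(e := es, f := tk q @ 3 # tk p @ 3 # s f,
      20 := (if (p, q) = (a, b) then 1 # s 20 else s 20))"
  shows "runs (compare_edge e f v u) s s' (C_edge X)"
proof -
  let ?s1 = "s(e := tk q @ 3 # es, f := tk p @ 3 # s f, 21 := tk (neq p a))"
  let ?s2 = "s(e := es, f := tk q @ 3 # tk p @ 3 # s f, 21 := tk (neq q b + neq p a))"
  have "runs (cmp e f v) s ?s1 (C_cmp X)"
    using d s X by (intro runs_cmp[where p = p and a = a]) auto
  moreover have "runs (cmp e f u) ?s1 ?s2 (C_cmp X)"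
    using d s X by (intro runs_cmp[where p = q and a = b]) (auto simp: fun_eq_iff)
  moreover have "runs (If 21 nz (clr 21) (Push 20 1)) ?s2 s' (C_mv (X + X + 2) + 2)"
  proof (rule runs_If)
    assume "nz (top0 (?s2 21))"
    then have "(p, q) \<noteq> (a, b)" by auto
    moreover have "neq q b \<le> X + 1" "neq p a \<le> X + 1" using X by (auto simp: neq_def)
    then have "neq q b + neq p a \<le> X + X + 2" by linarith
    ultimately show "runs (clr 21) ?s2 s' (C_mv (X + X + 2))"
      using d s s' X by (intro runs_clr[where n = "neq q b + neq p a"]) (auto simp: fun_eq_iff)
  next
    assume "\<not> nz (top0 (?s2 21))"
    then have "(p, q) = (a, b)" by (auto split: if_splits)
    then show "runs (Push 20 1) ?s2 s' (C_mv (X + X + 2))"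
      using d s s' by (intro runs_loopfree) (auto simp: fun_eq_iff C_mv_def)
  qed
  ultimately show ?thesis unfolding compare_edge_def C_edge_def by (intro runs_Seq)
qed

lemma pairs_simps [simp]:
  "pairs [] = []" "pairs ((u, v) # E) = u # v # pairs E" "pairs (E @ E') = pairs E @ pairs E'"
  by (simp_all add: pairs_def)

definition scan :: "nat \<Rightarrow> nat \<Rightarrow> nat \<Rightarrow> nat \<Rightarrow> cmd" where
  "scan e f v u = While e nz (compare_edge e f v u)"

definition C_scan :: "nat \<Rightarrow> nat" where
  "C_scan X = X * (C_edge X + 2) + 1"

lemma runs_scan:
  assumes d: "distinct [e, f, v, 9, 20, 21]" "distinct [e, f, u, 9, 20, 21]"
    and s: "s e = blk (pairs L)" "s v = tk a" "s u = tk b" "s 9 = []" "s 21 = []"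
    and X: "length L \<le> X" "\<forall>x\<in>set (pairs L). x \<le> X" "a \<le> X" "b \<le> X"
    and s': "s' = s(e := [], f := blk (rev (pairs L)) @ s f,
      20 := tk (length (filter (\<lambda>x. x = (a, b)) L)) @ s 20)"
  shows "runs (scan e f v u) s s' (C_scan X)"
proof -
  have "runs (While e nz (compare_edge e f v u)) s s' (length L * (C_edge X + 2) + 1)"
    using s X(2) s'
  proof (induction L arbitrary: s)
    case Nil
    then have "s' = s" by (auto simp: fun_eq_iff)
    then show ?case using runs_WhileF[of nz s e] Nil by simp
  next
    case (Cons pq L)
    obtain p q where pq: "pq = (p, q)" by fastforce
    let ?s1 = "s(e := blk (pairs L), f := tk q @ 3 # tk p @ 3 # s f,
      20 := (if (p, q) = (a, b) then 1 # s 20 else s 20))"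
    have a: "runs (compare_edge e f v u) s ?s1 (C_edge X)"
      using Cons.prems X(3,4) d pq
      by (intro runs_compare_edge[where p = p and q = q and a = a and b = b]) auto
    have b: "runs (While e nz (compare_edge e f v u)) ?s1 s' (length L * (C_edge X + 2) + 1)"
      using Cons.prems d pq by (intro Cons.IH) (auto simp: fun_eq_iff tk_Suc_append)
    have "nz (top0 (s e))" using Cons.prems pq by (cases p) auto
    from runs_WhileT[of nz, OF this a b] show ?case
      by (simp add: add.assoc add.commute add.left_commute)
  qed
  then show ?thesis unfolding scan_def C_scan_def
    by (rule runs_mono) (use X(1) in \<open>intro add_le_mono1 mult_le_mono1\<close>)
qed

definition hits :: "(nat \<times> nat) list \<Rightarrow> nat \<Rightarrow> nat \<Rightarrow> nat" where
  "hits L a b = length (filter (\<lambda>x. x = (a, b)) L) + length (filter (\<lambda>x. x = (b, a)) L)"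

lemma hits_0: "hits L a b = 0 \<longleftrightarrow> \<not> adj L a b"
  by (auto simp: hits_def adj_def filter_empty_conv)

lemma hits_le: "hits L a b \<le> 2 * length L"
  unfolding hits_def using length_filter_le[of "\<lambda>x. x = (a, b)" L] length_filter_le[of "\<lambda>x. x = (b, a)" L]
  by linarith

lemma rev_pairs: "rev (pairs L) = pairs (rev (map prod.swap L))"
  by (induction L) auto

text \<open>Scanning back and forth restores the list; on the way back each pair is read in the
  opposite order, so both orientations of an edge are found.\<close>

definition scan_both :: "nat \<Rightarrow> nat \<Rightarrow> cmd" where
  "scan_both v u = scan 12 13 v u ;; scan 13 12 v u"

lemma runs_scan_both:
  assumes d: "v \<in> {14, 15}" "u \<in> {14, 15}"
    and s: "s 12 = blk (pairs L)" "s 13 = []" "s v = tk a" "s u = tk b" "s 9 = []" "s 21 = []"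
    and X: "length L \<le> X" "\<forall>x\<in>set (pairs L). x \<le> X" "a \<le> X" "b \<le> X"
    and s': "s' = s(20 := tk (hits L a b) @ s 20)"
  shows "runs (scan_both v u) s s' (C_scan X + C_scan X)"
proof -
  let ?L = "rev (map prod.swap L)"
  let ?s1 = "s(12 := [], 13 := blk (pairs ?L), 20 := tk (length (filter (\<lambda>x. x = (a, b)) L)) @ s 20)"
  have sw: "length (filter (\<lambda>x. x = (a, b)) ?L) = length (filter (\<lambda>x. x = (b, a)) L)"
    by (induction L) auto
  have "set (pairs ?L) = set (pairs L)" using rev_pairs[of L] by (metis set_rev)
  have rr: "rev (pairs ?L) = pairs L" using rev_pairs[of L] by (metis rev_rev_ident)
  have "runs (scan 12 13 v u) s ?s1 (C_scan X)"
    using d s X by (intro runs_scan[where L = L and a = a and b = b]) (auto simp: rev_pairs)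
  moreover have "runs (scan 13 12 v u) ?s1 s' (C_scan X)"
    using d s X s' \<open>set (pairs ?L) = set (pairs L)\<close>
    by (intro runs_scan[where L = ?L and a = a and b = b])
      (auto simp: fun_eq_iff rr sw hits_def add.commute simp del: rev_map)
  ultimately show ?thesis unfolding scan_both_def by (rule runs_Seq)
qed

subsection \<open>Writing the target instance\<close>

lemma str_simps [simp]:
  "str [] = []" "str (x # xs) = enc_nat x @ str xs" "str (xs @ ys) = str xs @ str ys"
  by (simp_all add: str_def)

text \<open>Register 18 assembles the second endpoint: \<open>n\<close>, a further \<open>n\<close>
  unless the adjacency was found, and then \<open>u\<close>.\<close>

definition edge_cmd :: cmd where
  "edge_cmd = cp 14 9 18 ;; emit ;; cp 8 9 18 ;; scan_both 14 15 ;;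
     If 20 nz (clr 20) (cp 8 9 18) ;; cp 15 9 18 ;; emit ;; Pop 17 ;; Push 15 1"

definition C_edge_cmd :: "nat \<Rightarrow> nat" where
  "C_edge_cmd X = C_cp X + (C_emit X + (C_cp X + ((C_scan X + C_scan X) +
     ((C_mv (2 * X) + C_cp X + 2) + (C_cp X + (C_emit X + (1 + 1)))))))"

definition scratch :: "store \<Rightarrow> bool" where
  "scratch s \<longleftrightarrow> s 9 = [] \<and> s 13 = [] \<and> s 18 = [] \<and> s 19 = [] \<and> s 20 = [] \<and> s 21 = []"

lemma runs_edge_cmd:
  assumes s: "scratch s" "s 8 = tk n" "s 12 = blk (pairs L)" "s 14 = tk v" "s 15 = tk u"
    and n: "3 * n \<le> X" "v < n" "u < n" and L: "length L \<le> X" "\<forall>x\<in>set (pairs L). x \<le> X"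
    and s': "s' = s(1 := rev (str [v, target n L v u]) @ s 1, 17 := tl (s 17), 15 := tk (Suc u))"
  shows "runs edge_cmd s s' (C_edge_cmd X)"
proof -
  let ?o = "rev (enc_nat v) @ s 1"
  let ?x = "if adj L v u then n else 2 * n"
  let ?p = "rev (enc_nat (target n L v u)) @ ?o"
  note sc = s(1)[unfolded scratch_def]
  have "runs (cp 14 9 18) s (s(18 := tk v)) (C_cp X)"
    using s sc n by (intro runs_cp[where n = v]) auto
  moreover have "runs emit (s(18 := tk v)) (s(1 := ?o)) (C_emit X)"
    using s sc n by (intro runs_emit[where x = v]) (auto simp: fun_eq_iff)
  moreover have "runs (cp 8 9 18) (s(1 := ?o)) (s(1 := ?o, 18 := tk n)) (C_cp X)"
    using s sc n by (intro runs_cp[where n = n]) auto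
  moreover have "runs (scan_both 14 15) (s(1 := ?o, 18 := tk n))
      (s(1 := ?o, 18 := tk n, 20 := tk (hits L v u))) (C_scan X + C_scan X)"
    using s sc n L by (intro runs_scan_both[where a = v and b = u and L = L]) auto
  moreover have "runs (If 20 nz (clr 20) (cp 8 9 18)) (s(1 := ?o, 18 := tk n, 20 := tk (hits L v u)))
      (s(1 := ?o, 18 := tk ?x)) (C_mv (2 * X) + C_cp X + 2)"
  proof (rule runs_If)
    assume "nz (top0 ((s(1 := ?o, 18 := tk n, 20 := tk (hits L v u))) 20))"
    then have a: "adj L v u" using hits_0[of L v u] by (auto split: if_splits)
    have "runs (clr 20) (s(1 := ?o, 18 := tk n, 20 := tk (hits L v u))) (s(1 := ?o, 18 := tk ?x)) (C_mv (2 * X))"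
      using a sc hits_le[of L v u] L by (intro runs_clr[where n = "hits L v u"]) (auto simp: fun_eq_iff)
    then show "runs (clr 20) (s(1 := ?o, 18 := tk n, 20 := tk (hits L v u))) (s(1 := ?o, 18 := tk ?x))
      (C_mv (2 * X) + C_cp X)" by (rule runs_mono) simp
  next
    assume "\<not> nz (top0 ((s(1 := ?o, 18 := tk n, 20 := tk (hits L v u))) 20))"
    then have h: "hits L v u = 0" by (auto split: if_splits)
    then have a: "\<not> adj L v u" using hits_0 by simp
    have "runs (cp 8 9 18) (s(1 := ?o, 18 := tk n, 20 := tk (hits L v u))) (s(1 := ?o, 18 := tk ?x)) (C_cp X)"
      using a h sc s n by (intro runs_cp[where n = n]) (auto simp: fun_eq_iff mult_2)
    then show "runs (cp 8 9 18) (s(1 := ?o, 18 := tk n, 20 := tk (hits L v u))) (s(1 := ?o, 18 := tk ?x))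
      (C_mv (2 * X) + C_cp X)" by (rule runs_mono) simp
  qed
  moreover have "runs (cp 15 9 18) (s(1 := ?o, 18 := tk ?x)) (s(1 := ?o, 18 := tk (target n L v u))) (C_cp X)"
    using s sc n by (intro runs_cp[where n = u]) (auto simp: fun_eq_iff target_def add.commute)
  moreover have "runs emit (s(1 := ?o, 18 := tk (target n L v u))) (s(1 := ?p)) (C_emit X)"
    using s sc n by (intro runs_emit[where x = "target n L v u"]) (auto simp: fun_eq_iff target_def)
  moreover have "runs (Pop 17) (s(1 := ?p)) (s(1 := ?p, 17 := tl (s 17))) 1"
    by (intro runs_loopfree) (auto simp: fun_eq_iff)
  moreover have "runs (Push 15 1) (s(1 := ?p, 17 := tl (s 17))) s' 1"
    using s s' by (intro runs_loopfree) (auto simp: fun_eq_iff)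
  ultimately show ?thesis unfolding edge_cmd_def C_edge_cmd_def by (intro runs_Seq)
qed

definition row_cmd :: cmd where
  "row_cmd = cp 14 9 18 ;; emit ;; cp 8 9 18 ;; cp 14 9 18 ;; emit ;; cp 8 9 17 ;;
     While 17 nz edge_cmd ;; clr 15 ;; Pop 16 ;; Push 14 1"

definition C_row :: "nat \<Rightarrow> nat" where
  "C_row X = C_cp X + (C_emit X + (C_cp X + (C_cp X + (C_emit X + (C_cp X +
     ((X * (C_edge_cmd X + 2) + 1) + (C_mv X + (1 + 1))))))))"

lemma runs_row_cmd:
  assumes s: "scratch s" "s 8 = tk n" "s 12 = blk (pairs L)" "s 14 = tk v" "s 15 = []" "s 17 = []"
    and n: "3 * n \<le> X" "v < n" and L: "length L \<le> X" "\<forall>x\<in>set (pairs L). x \<le> X"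
    and s': "s' = s(1 := rev (str (pairs ((v, n + v) # map (\<lambda>u. (v, target n L v u)) [0..<n]))) @ s 1,
      16 := tl (s 16), 14 := tk (Suc v))"
  shows "runs row_cmd s s' (C_row X)"
proof -
  let ?o = "rev (enc_nat v) @ s 1"
  let ?p = "rev (enc_nat (n + v)) @ ?o"
  let ?q = "\<lambda>m. rev (str (pairs (map (\<lambda>u. (v, target n L v u)) [0..<m]))) @ ?p"
  let ?\<sigma> = "\<lambda>m. s(1 := ?q m, 17 := tk (n - m), 15 := tk m)"
  note sc = s(1)[unfolded scratch_def]
  have "runs (cp 14 9 18) s (s(18 := tk v)) (C_cp X)"
    using s sc n by (intro runs_cp[where n = v]) auto
  moreover have "runs emit (s(18 := tk v)) (s(1 := ?o)) (C_emit X)"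
    using s sc n by (intro runs_emit[where x = v]) (auto simp: fun_eq_iff)
  moreover have "runs (cp 8 9 18) (s(1 := ?o)) (s(1 := ?o, 18 := tk n)) (C_cp X)"
    using s sc n by (intro runs_cp[where n = n]) auto
  moreover have "runs (cp 14 9 18) (s(1 := ?o, 18 := tk n)) (s(1 := ?o, 18 := tk (n + v))) (C_cp X)"
    using s sc n by (intro runs_cp[where n = v]) (auto simp: fun_eq_iff add.commute)
  moreover have "runs emit (s(1 := ?o, 18 := tk (n + v))) (s(1 := ?p)) (C_emit X)"
    using s sc n by (intro runs_emit[where x = "n + v"]) (auto simp: fun_eq_iff)
  moreover have "runs (cp 8 9 17) (s(1 := ?p)) (s(1 := ?p, 17 := tk n)) (C_cp X)"
    using s sc n by (intro runs_cp[where n = n]) auto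
  moreover have "runs (While 17 nz edge_cmd) (s(1 := ?p, 17 := tk n)) (?\<sigma> n) (X * (C_edge_cmd X + 2) + 1)"
  proof (rule runs_While[where \<sigma> = ?\<sigma> and n = n])
    fix m assume m: "m < n"
    have "runs edge_cmd (?\<sigma> m) (?\<sigma> (Suc m)) (C_edge_cmd X)"
      using s sc n m L
      by (intro runs_edge_cmd[where v = v and u = m and n = n and L = L]) (auto simp: fun_eq_iff scratch_def)
    then show "nz (top0 (?\<sigma> m 17)) \<and> runs edge_cmd (?\<sigma> m) (?\<sigma> (Suc m)) (C_edge_cmd X)"
      using m by simp
  qed (use s n in \<open>auto simp: fun_eq_iff\<close>)
  moreover have "runs (clr 15) (?\<sigma> n) (s(1 := ?q n)) (C_mv X)"
    using s n by (intro runs_clr[where n = n]) (auto simp: fun_eq_iff)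
  moreover have "runs (Pop 16) (s(1 := ?q n)) (s(1 := ?q n, 16 := tl (s 16))) 1"
    by (intro runs_loopfree) (auto simp: fun_eq_iff)
  moreover have "runs (Push 14 1) (s(1 := ?q n, 16 := tl (s 16))) s' 1"
    using s s' by (intro runs_loopfree) (auto simp: fun_eq_iff)
  ultimately show ?thesis unfolding row_cmd_def C_row_def by (intro runs_Seq)
qed

definition edges_cmd :: cmd where
  "edges_cmd = cp 8 9 16 ;; While 16 nz row_cmd"

definition C_edges :: "nat \<Rightarrow> nat" where
  "C_edges X = C_cp X + (X * (C_row X + 2) + 1)"

lemma runs_edges_cmd:
  assumes s: "scratch s" "s 8 = tk n" "s 12 = blk (pairs L)" "s 14 = []" "s 15 = []" "s 16 = []" "s 17 = []"
    and n: "3 * n \<le> X" and L: "length L \<le> X" "\<forall>x\<in>set (pairs L). x \<le> X"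
    and s': "s' = s(1 := rev (str (pairs (out_edges n L))) @ s 1, 14 := tk n)"
  shows "runs edges_cmd s s' (C_edges X)"
  unfolding edges_cmd_def C_edges_def
proof (rule runs_Seq)
  note sc = s(1)[unfolded scratch_def]
  let ?q = "\<lambda>m. rev (str (pairs (concat (map (\<lambda>v. (v, n + v) # map (\<lambda>u. (v, target n L v u)) [0..<n]) [0..<m])))) @ s 1"
  let ?\<sigma> = "\<lambda>m. s(1 := ?q m, 16 := tk (n - m), 14 := tk m)"
  show "runs (cp 8 9 16) s (s(16 := tk n)) (C_cp X)"
    using s sc n by (intro runs_cp[where n = n]) auto
  show "runs (While 16 nz row_cmd) (s(16 := tk n)) s' (X * (C_row X + 2) + 1)"
  proof (rule runs_While[where \<sigma> = ?\<sigma> and n = n])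
    fix m assume m: "m < n"
    have "runs row_cmd (?\<sigma> m) (?\<sigma> (Suc m)) (C_row X)"
      using s sc n m L
      by (intro runs_row_cmd[where v = m and n = n and L = L]) (auto simp: fun_eq_iff scratch_def)
    then show "nz (top0 (?\<sigma> m 16)) \<and> runs row_cmd (?\<sigma> m) (?\<sigma> (Suc m)) (C_row X)"
      using m by simp
  qed (use s n s' in \<open>auto simp: fun_eq_iff out_edges_def\<close>)
qed

text \<open>The binary form of 0 is empty, so a capacity 0 is written as a bare separator.\<close>

definition caps_cmd :: cmd where
  "caps_cmd = cp 8 9 16 ;; cp 8 9 16 ;; While 16 nz (Pop 16 ;; cp 8 9 18 ;; emit) ;;
     cp 8 9 16 ;; While 16 nz (Pop 16 ;; Push 1 3)"

definition C_caps :: "nat \<Rightarrow> nat" where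
  "C_caps X = C_cp X + (C_cp X + ((X * ((1 + (C_cp X + C_emit X)) + 2) + 1) +
     (C_cp X + (X * (2 + 2) + 1))))"

lemma str_replicate_Suc: "str (replicate (Suc m) x) = str (replicate m x) @ enc_nat x"
  by (induction m) auto

lemma enc_nat_0 [simp]: "enc_nat 0 = [3]"
  by (simp add: enc_nat_def)

lemma runs_caps_cmd:
  assumes s: "scratch s" "s 8 = tk n" "s 16 = []" and n: "3 * n \<le> X"
    and s': "s' = s(1 := rev (str (out_caps n)) @ s 1)"
  shows "runs caps_cmd s s' (C_caps X)"
proof -
  note sc = s(1)[unfolded scratch_def]
  let ?q = "\<lambda>m. rev (str (replicate m n)) @ s 1"
  let ?r = "\<lambda>m. rev (str (replicate m 0)) @ ?q (2 * n)"
  let ?\<sigma> = "\<lambda>m. s(1 := ?q m, 16 := tk (2 * n - m))"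
  let ?\<tau> = "\<lambda>m. s(1 := ?r m, 16 := tk (n - m))"
  have "runs (cp 8 9 16) s (s(16 := tk n)) (C_cp X)"
    using s sc n by (intro runs_cp[where n = n]) auto
  moreover have "runs (cp 8 9 16) (s(16 := tk n)) (s(16 := tk (2 * n))) (C_cp X)"
    using s sc n by (intro runs_cp[where n = n]) (auto simp: fun_eq_iff mult_2)
  moreover have "runs (While 16 nz (Pop 16 ;; cp 8 9 18 ;; emit)) (s(16 := tk (2 * n))) (s(1 := ?q (2 * n)))
      (X * ((1 + (C_cp X + C_emit X)) + 2) + 1)"
  proof (rule runs_While[where \<sigma> = ?\<sigma> and n = "2 * n"])
    fix m assume m: "m < 2 * n"
    let ?s1 = "s(1 := ?q m, 16 := tk (2 * n - Suc m))"
    have "runs (Pop 16) (?\<sigma> m) ?s1 1"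
      by (intro runs_loopfree) (auto simp: fun_eq_iff)
    moreover have "runs (cp 8 9 18) ?s1 (?s1(18 := tk n)) (C_cp X)"
      using s sc n by (intro runs_cp[where n = n]) auto
    moreover have "runs emit (?s1(18 := tk n)) (?\<sigma> (Suc m)) (C_emit X)"
      using s sc n by (intro runs_emit[where x = n])
        (auto simp: fun_eq_iff str_replicate_Suc simp del: replicate_Suc)
    ultimately have "runs (Pop 16 ;; cp 8 9 18 ;; emit) (?\<sigma> m) (?\<sigma> (Suc m)) (1 + (C_cp X + C_emit X))"
      by (intro runs_Seq)
    then show "nz (top0 (?\<sigma> m 16)) \<and> runs (Pop 16 ;; cp 8 9 18 ;; emit) (?\<sigma> m) (?\<sigma> (Suc m))
        (1 + (C_cp X + C_emit X))" using m by simp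
  qed (use s n in \<open>auto simp: fun_eq_iff\<close>)
  moreover have "runs (cp 8 9 16) (s(1 := ?q (2 * n))) (s(1 := ?q (2 * n), 16 := tk n)) (C_cp X)"
    using s sc n by (intro runs_cp[where n = n]) auto
  moreover have "runs (While 16 nz (Pop 16 ;; Push 1 3)) (s(1 := ?q (2 * n), 16 := tk n)) s' (X * (2 + 2) + 1)"
  proof (rule runs_While[where \<sigma> = ?\<tau> and n = n])
    fix m assume m: "m < n"
    have "runs (Pop 16 ;; Push 1 3) (?\<tau> m) (?\<tau> (Suc m)) 2"
      by (intro runs_loopfree) (auto simp: fun_eq_iff str_replicate_Suc simp del: replicate_Suc)
    then show "nz (top0 (?\<tau> m 16)) \<and> runs (Pop 16 ;; Push 1 3) (?\<tau> m) (?\<tau> (Suc m)) 2"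
      using m by simp
  qed (use s n s' in \<open>auto simp: fun_eq_iff out_caps_def\<close>)
  ultimately show ?thesis unfolding caps_cmd_def C_caps_def by (intro runs_Seq)
qed

definition header_cmd :: cmd where
  "header_cmd = cp 8 9 18 ;; (Push 18 1 ;; Push 18 1) ;; emit ;; mv 7 18 ;; Push 18 1 ;; emit ;;
     cp 8 9 18 ;; cp 8 9 18 ;; cp 8 9 18 ;; emit"

definition C_header :: "nat \<Rightarrow> nat" where
  "C_header X = C_cp X + (2 + (C_emit X + (C_mv X + (1 + (C_emit X + (C_cp X + (C_cp X + (C_cp X + C_emit X))))))))"

lemma runs_header_cmd:
  assumes s: "scratch s" "s 8 = tk n" "s 7 = tk k" and n: "3 * n \<le> X" "n + 2 \<le> X" "k + 1 \<le> X"
    and s': "s' = s(1 := rev (str [n + 2, k + 1, 3 * n]) @ s 1, 7 := [])"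
  shows "runs header_cmd s s' (C_header X)"
proof -
  note sc = s(1)[unfolded scratch_def]
  let ?o = "rev (enc_nat (n + 2)) @ s 1"
  let ?p = "rev (enc_nat (k + 1)) @ ?o"
  let ?s = "s(1 := ?p, 7 := [])"
  have "runs (cp 8 9 18) s (s(18 := tk n)) (C_cp X)"
    using s sc n by (intro runs_cp[where n = n]) auto
  moreover have "runs (Push 18 1 ;; Push 18 1) (s(18 := tk n)) (s(18 := tk (n + 2))) 2"
    by (intro runs_loopfree) (auto simp: fun_eq_iff)
  moreover have "runs emit (s(18 := tk (n + 2))) (s(1 := ?o)) (C_emit X)"
    using s sc n by (intro runs_emit[where x = "n + 2"]) (auto simp: fun_eq_iff)
  moreover have "runs (mv 7 18) (s(1 := ?o)) (s(1 := ?o, 7 := [], 18 := tk k)) (C_mv X)"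
    using s sc n by (intro runs_mv[where n = k]) (auto simp: fun_eq_iff)
  moreover have "runs (Push 18 1) (s(1 := ?o, 7 := [], 18 := tk k)) (s(1 := ?o, 7 := [], 18 := tk (k + 1))) 1"
    by (intro runs_loopfree) (auto simp: fun_eq_iff)
  moreover have "runs emit (s(1 := ?o, 7 := [], 18 := tk (k + 1))) ?s (C_emit X)"
    using s sc n by (intro runs_emit[where x = "k + 1"]) (auto simp: fun_eq_iff)
  moreover have "runs (cp 8 9 18) ?s (?s(18 := tk n)) (C_cp X)"
    using s sc n by (intro runs_cp[where n = n]) auto
  moreover have "runs (cp 8 9 18) (?s(18 := tk n)) (?s(18 := tk (n + n))) (C_cp X)"
    using s sc n by (intro runs_cp[where n = n]) (auto simp: fun_eq_iff)
  moreover have "runs (cp 8 9 18) (?s(18 := tk (n + n))) (?s(18 := tk (n + (n + n)))) (C_cp X)"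
    using s sc n by (intro runs_cp[where n = n]) (auto simp: fun_eq_iff)
  moreover have tk3: "tk (n + (n + n)) = tk (3 * n)" by (rule arg_cong[of _ _ tk]) simp
  have "runs emit (?s(18 := tk (n + (n + n)))) s' (C_emit X)"
    unfolding tk3 using s sc n s' by (intro runs_emit[where x = "3 * n"]) (auto simp: fun_eq_iff)
  ultimately show ?thesis unfolding header_cmd_def C_header_def by (intro runs_Seq)
qed

text \<open>A loop makes the input graph invalid, and the construction relies on no vertex being
  adjacent to itself; loops are therefore looked for before anything is written.\<close>

definition self_cmd :: cmd where
  "self_cmd = cp 8 9 16 ;; While 16 nz (scan_both 14 14 ;; Pop 16 ;; Push 14 1) ;; clr 14"

definition C_self :: "nat \<Rightarrow> nat" where
  "C_self X = C_cp X + ((X * (((C_scan X + C_scan X) + (1 + 1)) + 2) + 1) + C_mv X)"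

lemma runs_self_cmd:
  assumes s: "scratch s" "s 8 = tk n" "s 12 = blk (pairs L)" "s 14 = []" "s 16 = []"
    and n: "3 * n \<le> X" and L: "length L \<le> X" "\<forall>x\<in>set (pairs L). x \<le> X"
    and s': "s' = s(20 := tk (\<Sum>v<n. hits L v v))"
  shows "runs self_cmd s s' (C_self X)"
proof -
  note sc = s(1)[unfolded scratch_def]
  let ?\<sigma> = "\<lambda>m. s(20 := tk (\<Sum>v<m. hits L v v), 16 := tk (n - m), 14 := tk m)"
  have "runs (cp 8 9 16) s (s(16 := tk n)) (C_cp X)"
    using s sc n by (intro runs_cp[where n = n]) auto
  moreover have "runs (While 16 nz (scan_both 14 14 ;; Pop 16 ;; Push 14 1)) (s(16 := tk n)) (?\<sigma> n)
      (X * (((C_scan X + C_scan X) + (1 + 1)) + 2) + 1)"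
  proof (rule runs_While[where \<sigma> = ?\<sigma> and n = n])
    fix m assume m: "m < n"
    let ?s1 = "(?\<sigma> m)(20 := tk (\<Sum>v<Suc m. hits L v v))"
    have "runs (scan_both 14 14) (?\<sigma> m) ?s1 (C_scan X + C_scan X)"
      using s sc n m L
      by (intro runs_scan_both[where a = m and b = m and L = L]) (auto simp: fun_eq_iff add.commute)
    moreover have "runs (Pop 16) ?s1 (?s1(16 := tk (n - Suc m))) 1"
      by (intro runs_loopfree) (auto simp: fun_eq_iff)
    moreover have "runs (Push 14 1) (?s1(16 := tk (n - Suc m))) (?\<sigma> (Suc m)) 1"
      by (intro runs_loopfree) (auto simp: fun_eq_iff)
    ultimately have "runs (scan_both 14 14 ;; Pop 16 ;; Push 14 1) (?\<sigma> m) (?\<sigma> (Suc m))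
        ((C_scan X + C_scan X) + (1 + 1))" by (intro runs_Seq)
    then show "nz (top0 (?\<sigma> m 16)) \<and> runs (scan_both 14 14 ;; Pop 16 ;; Push 14 1) (?\<sigma> m) (?\<sigma> (Suc m))
        ((C_scan X + C_scan X) + (1 + 1))" using m by simp
  qed (use s sc n in \<open>auto simp: fun_eq_iff\<close>)
  moreover have "runs (clr 14) (?\<sigma> n) s' (C_mv X)"
    using s n s' by (intro runs_clr[where n = n]) (auto simp: fun_eq_iff)
  ultimately show ?thesis unfolding self_cmd_def C_self_def by (intro runs_Seq)
qed

subsection \<open>Reading numbers\<close>

definition horner :: "nat \<Rightarrow> nat \<Rightarrow> nat" where
  "horner a b = 2 * a + (if b = 2 then 1 else 0)"

text \<open>Intermediate values never exceed the final one, so a bound on the number read bounds the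
  time of every round.\<close>

lemma horner_mono: "a \<le> foldl horner a xs"
proof (induction xs arbitrary: a)
  case (Cons b xs)
  have "a \<le> horner a b" by (simp add: horner_def)
  also have "\<dots> \<le> foldl horner (horner a b) xs" by (rule Cons.IH)
  finally show ?case by simp
qed simp

lemma bin_rec: "0 < n \<Longrightarrow> bin n = (if even n then 1 else 2) # bin (n div 2)"
  by (simp add: bin.simps[of n])

lemma horner_bin [simp]: "foldl horner 0 (rev (bin n)) = n"
proof (induction n rule: less_induct)
  case (less n)
  show ?case
  proof (cases "n = 0")
    case False
    then have "foldl horner 0 (rev (bin n)) = horner (n div 2) (if even n then 1 else 2)"
      using less by (simp add: bin_rec)
    also have "\<dots> = n" by (auto simp: horner_def)
    finally show ?thesis .
  qed simp
qed

lemma set_bin: "set (bin n) \<subseteq> {1, 2}"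
proof (induction n rule: less_induct)
  case (less n)
  then show ?case by (cases "n = 0") (auto simp: bin_rec)
qed

definition read_k_step :: cmd where
  "read_k_step = mv 7 9 ;; While 9 nz (Pop 9 ;; Push 7 1 ;; Push 7 1) ;;
     (If 6 (\<lambda>x. x = 2) (Push 7 1) Skip ;; Pop 6)"

definition C_read_k :: "nat \<Rightarrow> nat" where
  "C_read_k X = C_mv X + ((X * (3 + 2) + 1) + 5)"

lemma runs_read_k_step:
  assumes s: "s 6 = b # xs" "s 7 = tk a" "s 9 = []" and X: "horner a b \<le> X"
    and s': "s' = s(6 := xs, 7 := tk (horner a b))"
  shows "runs read_k_step s s' (C_read_k X)"
proof -
  have a: "a \<le> X" using X by (simp add: horner_def)
  let ?\<sigma> = "\<lambda>m. s(9 := tk (a - m), 7 := tk (2 * m))"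
  have "runs (mv 7 9) s (s(7 := [], 9 := tk a)) (C_mv X)"
    using s a by (intro runs_mv[where n = a]) auto
  moreover have "runs (While 9 nz (Pop 9 ;; Push 7 1 ;; Push 7 1)) (s(7 := [], 9 := tk a)) (s(7 := tk (2 * a)))
      (X * (3 + 2) + 1)"
  proof (rule runs_While[where \<sigma> = ?\<sigma> and n = a])
    fix m assume "m < a"
    then show "nz (top0 (?\<sigma> m 9)) \<and> runs (Pop 9 ;; Push 7 1 ;; Push 7 1) (?\<sigma> m) (?\<sigma> (Suc m)) 3"
      by (auto intro!: runs_loopfree simp: fun_eq_iff)
  qed (use s a in \<open>auto simp: fun_eq_iff\<close>)
  moreover have "runs (If 6 (\<lambda>x. x = 2) (Push 7 1) Skip ;; Pop 6) (s(7 := tk (2 * a))) s' 5"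
    using s s' by (intro runs_loopfree) (auto simp: fun_eq_iff horner_def)
  ultimately show ?thesis unfolding read_k_step_def C_read_k_def by (intro runs_Seq)
qed

text \<open>Reading without cut-off is admissible here, because \<open>k\<close> is the parameter
  and time polynomial in its value is allowed.\<close>

definition read_k :: cmd where
  "read_k = While 6 nz read_k_step"

lemma runs_read_k:
  assumes "s 6 = xs" "s 7 = tk a" "s 9 = []" "set xs \<subseteq> {1, 2}" and "foldl horner a xs \<le> X"
    "length xs \<le> X" and "s' = s(6 := [], 7 := tk (foldl horner a xs))"
  shows "runs read_k s s' (X * (C_read_k X + 2) + 1)"
proof -
  have "runs (While 6 nz read_k_step) s s' (length xs * (C_read_k X + 2) + 1)"
    using assms(1-5,7)
  proof (induction xs arbitrary: s a)
    case Nil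
    then have "s' = s" by (auto simp: fun_eq_iff)
    then show ?case using runs_WhileF[of nz s 6] Nil by simp
  next
    case (Cons b xs)
    let ?s1 = "s(6 := xs, 7 := tk (horner a b))"
    have "horner a b \<le> X" using horner_mono[of "horner a b" xs] Cons.prems by simp
    then have a: "runs read_k_step s ?s1 (C_read_k X)"
      using Cons.prems by (intro runs_read_k_step) auto
    have b: "runs (While 6 nz read_k_step) ?s1 s' (length xs * (C_read_k X + 2) + 1)"
      using Cons.prems by (intro Cons.IH[where a = "horner a b"]) (auto simp: fun_eq_iff)
    have "nz (top0 (s 6))" using Cons.prems by auto
    from runs_WhileT[of nz, OF this a b] show ?case
      by (simp add: add.assoc add.commute add.left_commute)
  qed
  then show ?thesis unfolding read_k_def
    by (rule runs_mono) (use assms(6) in \<open>intro add_le_mono1 mult_le_mono1\<close>)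
qed

text \<open>Reading with saturation: the result is cut off at the number of ticks in the pool
  \<open>p\<close>, which bounds the running time independently of the value read.\<close>

definition tick :: "nat \<Rightarrow> nat \<Rightarrow> cmd" where
  "tick u p = If p nz (Pop p ;; Push u 1) Skip"

definition read_step :: "nat \<Rightarrow> nat \<Rightarrow> nat \<Rightarrow> cmd" where
  "read_step i u p = mv u 9 ;; While 9 nz (Pop 9 ;; Push u 1 ;; tick u p) ;;
     (If i (\<lambda>x. x = 2) (tick u p) Skip ;; Pop i)"

definition C_read :: "nat \<Rightarrow> nat" where
  "C_read X = C_mv X + ((X * (7 + 2) + 1) + 9)"

text \<open>Between rounds \<open>u\<close> and the pool together hold \<open>c\<close> ticks. While
  doubling, each old tick is returned to \<open>u\<close> and its duplicate is drawn from the pool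
  as long as it lasts. Cutting off before a Horner step does not change the result cut off after
  it.\<close>

lemma runs_read_step:
  assumes d: "distinct [i, u, p, 9]" and s: "s i = b # xs" "s u = tk (min a c)" "s p = tk (c - min a c)" "s 9 = []"
    and X: "c \<le> X" and s': "s' = s(i := xs, u := tk (min (horner a b) c), p := tk (c - min (horner a b) c))"
  shows "runs (read_step i u p) s s' (C_read X)"
proof -
  define m where "m = min a c"
  define e where "e = min (2 * a) c"
  have m: "m \<le> c" "m \<le> X" and e: "m + min m (c - m) = e" "c - m - min m (c - m) = c - e" "e \<le> c"
    using X by (auto simp: m_def e_def)
  have h: "min (horner a b) c = (if b = 2 then min (Suc e) c else e)"
    by (auto simp: horner_def e_def)
  let ?\<sigma> = "\<lambda>j. s(9 := tk (m - j), u := tk (j + min j (c - m)), p := tk (c - m - min j (c - m)))"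
  let ?s2 = "s(u := tk e, p := tk (c - e))"
  have "runs (mv u 9) s (s(u := [], 9 := tk m)) (C_mv X)"
    using d s m by (intro runs_mv[where n = m]) (auto simp: m_def)
  moreover have "runs (While 9 nz (Pop 9 ;; Push u 1 ;; tick u p)) (s(u := [], 9 := tk m)) ?s2 (X * (7 + 2) + 1)"
  proof (rule runs_While[where \<sigma> = ?\<sigma> and n = m])
    fix j assume j: "j < m"
    have "runs (Pop 9 ;; Push u 1 ;; tick u p) (?\<sigma> j) (?\<sigma> (Suc j)) 7"
    proof (cases "j < c - m")
      case True
      then have eq: "min (Suc j) (c - m) = Suc j" "min j (c - m) = j" "c - m - Suc j = c - m - j - 1"
        "Suc j + Suc j = Suc (Suc (j + j))" by auto
      show ?thesis unfolding eq tick_def using True d by (intro runs_loopfree) (auto simp: fun_eq_iff)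
    next
      case False
      then have eq: "min (Suc j) (c - m) = c - m" "min j (c - m) = c - m" by auto
      show ?thesis unfolding eq tick_def using d by (intro runs_loopfree) (auto simp: fun_eq_iff)
    qed
    then show "nz (top0 (?\<sigma> j 9)) \<and> runs (Pop 9 ;; Push u 1 ;; tick u p) (?\<sigma> j) (?\<sigma> (Suc j)) 7"
      using j d by auto
  next
    show "?\<sigma> m = ?s2" unfolding e using s d by (auto simp: fun_eq_iff)
    show "?\<sigma> 0 = s(u := [], 9 := tk m)" using s d by (auto simp: fun_eq_iff m_def)
  qed (use m d in auto)
  moreover have "runs (If i (\<lambda>x. x = 2) (tick u p) Skip ;; Pop i) ?s2 s' 9"
  proof (cases "b = 2 \<and> e < c")
    case True
    then have "min (horner a b) c = Suc e" unfolding h by simp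
    then show ?thesis unfolding s' tick_def using True d s
      by (intro runs_loopfree) (auto simp: fun_eq_iff)
  next
    case False
    then have "min (horner a b) c = e" unfolding h using e(3) by auto
    then show ?thesis unfolding s' tick_def using False d s e(3)
      by (intro runs_loopfree) (auto simp: fun_eq_iff)
  qed
  ultimately show ?thesis unfolding read_step_def C_read_def by (intro runs_Seq)
qed

abbreviation is_bit :: "nat \<Rightarrow> bool" where
  "is_bit \<equiv> \<lambda>x. x = 1 \<or> x = 2"

definition read_num :: "nat \<Rightarrow> nat \<Rightarrow> nat \<Rightarrow> cmd" where
  "read_num i u p = While i is_bit (read_step i u p)"

lemma runs_read_num:
  assumes d: "distinct [i, u, p, 9]"
    and "s i = rev (bin n) @ ys" "\<not> is_bit (top0 ys)" "s u = []" "s p = tk c" "s 9 = []"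
    and "c \<le> X" "length (bin n) \<le> X" and "s' = s(i := ys, u := tk (min n c), p := tk (c - min n c))"
  shows "runs (read_num i u p) s s' (X * (C_read X + 2) + 1)"
proof -
  have "runs (While i is_bit (read_step i u p)) s s' (length xs * (C_read X + 2) + 1)"
    if "s i = xs @ ys" "set xs \<subseteq> {1, 2}" "s u = tk (min a c)" "s p = tk (c - min a c)" "s 9 = []"
      "s' = s(i := ys, u := tk (min (foldl horner a xs) c), p := tk (c - min (foldl horner a xs) c))"
    for xs a
    using that
  proof (induction xs arbitrary: s a)
    case Nil
    then have "s' = s" using d by (auto simp: fun_eq_iff)
    moreover have "\<not> is_bit (top0 (s i))" using Nil assms(3) by simp
    from runs_WhileF[of is_bit s i, OF this] have "runs (While i is_bit (read_step i u p)) s s 1" .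
    ultimately show ?case by simp
  next
    case (Cons b xs)
    let ?s1 = "s(i := xs @ ys, u := tk (min (horner a b) c), p := tk (c - min (horner a b) c))"
    have a: "runs (read_step i u p) s ?s1 (C_read X)"
      using Cons.prems d assms(7) by (intro runs_read_step[where a = a and b = b]) auto
    have b: "runs (While i is_bit (read_step i u p)) ?s1 s' (length xs * (C_read X + 2) + 1)"
      using Cons.prems d by (intro Cons.IH[where a = "horner a b"]) (auto simp: fun_eq_iff)
    have "is_bit (top0 (s i))" using Cons.prems by auto
    from runs_WhileT[of is_bit, OF this a b] show ?case
      by (simp add: add.assoc add.commute add.left_commute)
  qed
  from this[of "rev (bin n)" 0] have "runs (While i is_bit (read_step i u p)) s s'
      (length (bin n) * (C_read X + 2) + 1)"
    using assms set_bin[of n] by auto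
  then show ?thesis unfolding read_num_def
    by (rule runs_mono) (use assms(8) in \<open>intro add_le_mono1 mult_le_mono1\<close>)
qed

subsection \<open>Well-formed inputs\<close>

text \<open>Applied to a reversed word: there a separator is followed by the most significant digit
  of its number, and symbol 1 in that place is a leading zero.\<close>

fun bad :: "nat list \<Rightarrow> nat" where
  "bad [] = 0"
| "bad (x # xs) = (if x = 3 \<and> top0 xs = 1 then 1 else 0) + bad xs"

lemma bad_append: "bad (xs @ ys) = 0 \<Longrightarrow> bad ys = 0"
  by (induction xs) auto

lemma bad_bits: "set xs \<subseteq> {1, 2} \<Longrightarrow> bad (xs @ ys) = bad ys"
  by (induction xs) auto

lemma last_bin: "0 < n \<Longrightarrow> bin n \<noteq> [] \<and> last (bin n) = 2"
proof (induction n rule: less_induct)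
  case (less n)
  have "0 < n div 2 \<or> n = 1" using less.prems by auto
  then show ?case using less.IH[of "n div 2"] less.prems by (auto simp: bin_rec)
qed

lemma bits_are_bin: "set ys \<subseteq> {1, 2} \<Longrightarrow> ys = [] \<or> last ys = 2 \<Longrightarrow> \<exists>n. ys = bin n"
proof (induction ys)
  case (Cons y ys)
  then obtain n where n: "ys = bin n" by (auto split: if_splits)
  have "ys = [] \<longrightarrow> y = 2" using Cons.prems by auto
  then have "0 < horner n y" using n by (cases "n = 0") (auto simp: horner_def)
  then have "bin (horner n y) = y # ys"
    unfolding bin_rec[OF \<open>0 < horner n y\<close>] using n Cons.prems(1) by (auto simp: horner_def)
  then show ?case by metis
qed (auto intro: exI[of _ 0])

lemma top0_rev_str: "top0 (rev (str l)) = (if l = [] then 0 else 3)"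
  by (cases l rule: rev_cases) (auto simp: enc_nat_def)

lemma bad_str: "bad (rev (str l)) = 0"
proof (induction l rule: rev_induct)
  case (snoc n l)
  have b: "set (rev (bin n)) \<subseteq> {1, 2}" using set_bin by simp
  have "top0 (rev (bin n) @ rev (str l)) \<noteq> 1"
  proof (cases "n = 0")
    case True
    then show ?thesis using top0_rev_str[of l] by simp
  next
    case False
    then obtain xs where "bin n = xs @ [2]" using last_bin[of n] by (metis append_butlast_last_id neq0_conv)
    then show ?thesis by simp
  qed
  then show ?case using snoc bad_bits[OF b] by (simp add: enc_nat_def)
qed simp

text \<open>The word is decoded from its end. The symbols between the first two separators of
  \<open>v\<close> are the digits of the last number, most significant first; without a leading zero
  they are a canonical binary form.\<close>

lemma not_bad_imp_str:
  "set v \<subseteq> {1, 2, 3} \<Longrightarrow> v = [] \<or> top0 v = 3 \<Longrightarrow> bad v = 0 \<Longrightarrow> \<exists>l. rev v = str l"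
proof (induction "length v" arbitrary: v rule: less_induct)
  case less
  show ?case
  proof (cases v)
    case Nil
    then show ?thesis by (intro exI[of _ "[]"]) simp
  next
    case (Cons x v')
    then have x: "x = 3" using less.prems by auto
    define xs ys where "xs = takeWhile (\<lambda>y. y \<noteq> 3) v'" and "ys = dropWhile (\<lambda>y. y \<noteq> 3) v'"
    have v': "v' = xs @ ys" by (simp add: xs_def ys_def)
    have xs: "set xs \<subseteq> {1, 2}"
      using less.prems(1) unfolding Cons xs_def by (auto dest: set_takeWhileD)
    have ys: "ys = [] \<or> top0 ys = 3"
      using hd_dropWhile[of "\<lambda>y. y \<noteq> 3" v'] unfolding ys_def[symmetric] by (cases ys) auto
    have "bad v' = 0" "top0 v' \<noteq> 1" using less.prems(3) x unfolding Cons by auto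
    then have "rev xs = [] \<or> last (rev xs) = 2" "bad ys = 0"
      using xs unfolding v' by (cases xs; auto intro: bad_append)+
    then obtain n where n: "rev xs = bin n" using bits_are_bin[of "rev xs"] xs by auto
    have "\<exists>l. rev ys = str l"
      using less.prems(1) Cons v' ys \<open>bad ys = 0\<close> by (intro less.hyps) auto
    then obtain l where "rev ys = str l" ..
    then have "rev v = str (l @ [n])" using n by (simp add: Cons v' x enc_nat_def)
    then show ?thesis ..
  qed
qed

text \<open>One pass brings the first number to the top of register 2, counts the length of the word
  in register 3 and records leading zeros in register 4.\<close>

definition check_step :: cmd where
  "check_step = If 0 (\<lambda>x. x = 3) (Pop 0 ;; Push 2 3 ;; Push 3 1 ;; If 0 (\<lambda>x. x = 1) (Push 4 1) Skip)
     (If 0 (\<lambda>x. x = 1) (Pop 0 ;; Push 2 1 ;; Push 3 1) (Pop 0 ;; Push 2 2 ;; Push 3 1))"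

lemma runs_check:
  assumes "s 0 = v" "set v \<subseteq> {1, 2, 3}" "length v \<le> X"
    and "s' = s(0 := [], 2 := rev v @ s 2, 3 := tk (length v) @ s 3, 4 := tk (bad v) @ s 4)"
  shows "runs (While 0 nz check_step) s s' (X * (17 + 2) + 1)"
proof -
  have "runs (While 0 nz check_step) s s' (length v * (17 + 2) + 1)"
    using assms(1,2,4)
  proof (induction v arbitrary: s)
    case Nil
    then have "s' = s" by (auto simp: fun_eq_iff)
    then show ?case using runs_WhileF[of nz s 0] Nil by simp
  next
    case (Cons x v)
    let ?s1 = "s(0 := v, 2 := x # s 2, 3 := 1 # s 3, 4 := (if x = 3 \<and> top0 v = 1 then 1 # s 4 else s 4))"
    have a: "runs check_step s ?s1 17"
      using Cons.prems unfolding check_step_def by (intro runs_loopfree) (auto simp: fun_eq_iff)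
    have b: "runs (While 0 nz check_step) ?s1 s' (length v * (17 + 2) + 1)"
      using Cons.prems by (intro Cons.IH) (auto simp: fun_eq_iff tk_Suc_append)
    have "nz (top0 (s 0))" using Cons.prems by auto
    from runs_WhileT[of nz, OF this a b] show ?case by simp
  qed
  then show ?thesis
    by (rule runs_mono) (use assms(3) in \<open>intro add_le_mono1 mult_le_mono1\<close>)
qed

text \<open>Moving a number to another stack reverses it, which brings its most significant digit to
  the top, as Horner reading needs.\<close>

definition split_num :: "nat \<Rightarrow> cmd" where
  "split_num j = While 2 is_bit (If 2 (\<lambda>x. x = 1) (Pop 2 ;; Push j 1) (Pop 2 ;; Push j 2)) ;; Pop 2"

definition C_split :: "nat \<Rightarrow> nat" where
  "C_split X = (X * (6 + 2) + 1) + 1"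

lemma runs_split_num:
  assumes "j \<noteq> 2" "s 2 = xs @ 3 # ys" "set xs \<subseteq> {1, 2}" "length xs \<le> X" "s' = s(2 := ys, j := rev xs @ s j)"
  shows "runs (split_num j) s s' (C_split X)"
  unfolding split_num_def C_split_def
proof (rule runs_Seq)
  let ?\<sigma> = "\<lambda>m. s(2 := drop m xs @ 3 # ys, j := rev (take m xs) @ s j)"
  let ?c = "If 2 (\<lambda>x. x = 1) (Pop 2 ;; Push j 1) (Pop 2 ;; Push j 2)"
  show "runs (While 2 is_bit ?c) s (s(2 := 3 # ys, j := rev xs @ s j)) (X * (6 + 2) + 1)"
  proof (rule runs_While[where \<sigma> = ?\<sigma> and n = "length xs"])
    fix m assume m: "m < length xs"
    then have eq: "drop m xs = xs ! m # drop (Suc m) xs" "take (Suc m) xs = take m xs @ [xs ! m]"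
      by (simp_all add: Cons_nth_drop_Suc take_Suc_conv_app_nth)
    have b: "xs ! m = 1 \<or> xs ! m = 2" using m assms(3) nth_mem by fastforce
    then have "runs ?c (?\<sigma> m) (?\<sigma> (Suc m)) 6"
      unfolding eq using assms(1) by (intro runs_loopfree) (auto simp: fun_eq_iff)
    then show "is_bit (top0 (?\<sigma> m 2)) \<and> runs ?c (?\<sigma> m) (?\<sigma> (Suc m)) 6"
      using b assms(1) by (simp add: eq(1))
  qed (use assms in \<open>auto simp: fun_eq_iff\<close>)
  show "runs (Pop 2) (s(2 := 3 # ys, j := rev xs @ s j)) s' 1"
    using assms by (intro runs_loopfree) (auto simp: fun_eq_iff)
qed

text \<open>The edge list is read from its end, so that each number shows its most significant digit
  first; pushing the results onto register 12 restores the order.\<close>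

definition rewind_cmd :: cmd where
  "rewind_cmd = While 2 nz (If 2 (\<lambda>x. x = 3) (Pop 2 ;; Push 0 3)
     (If 2 (\<lambda>x. x = 1) (Pop 2 ;; Push 0 1) (Pop 2 ;; Push 0 2)))"

lemma runs_rewind:
  assumes "s 2 = xs" "set xs \<subseteq> {1, 2, 3}" "length xs \<le> X" "s' = s(2 := [], 0 := rev xs @ s 0)"
  shows "runs rewind_cmd s s' (X * (10 + 2) + 1)"
  unfolding rewind_cmd_def
proof -
  let ?\<sigma> = "\<lambda>m. s(2 := drop m xs, 0 := rev (take m xs) @ s 0)"
  let ?c = "If 2 (\<lambda>x. x = 3) (Pop 2 ;; Push 0 3) (If 2 (\<lambda>x. x = 1) (Pop 2 ;; Push 0 1) (Pop 2 ;; Push 0 2))"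
  show "runs (While 2 nz ?c) s s' (X * (10 + 2) + 1)"
  proof (rule runs_While[where \<sigma> = ?\<sigma> and n = "length xs"])
    fix m assume m: "m < length xs"
    then have eq: "drop m xs = xs ! m # drop (Suc m) xs" "take (Suc m) xs = take m xs @ [xs ! m]"
      by (simp_all add: Cons_nth_drop_Suc take_Suc_conv_app_nth)
    have b: "xs ! m = 1 \<or> xs ! m = 2 \<or> xs ! m = 3" using m assms(2) nth_mem by fastforce
    then have "runs ?c (?\<sigma> m) (?\<sigma> (Suc m)) 10"
      unfolding eq by (intro runs_loopfree) (auto simp: fun_eq_iff)
    then show "nz (top0 (?\<sigma> m 2)) \<and> runs ?c (?\<sigma> m) (?\<sigma> (Suc m)) 10"
      using b by (auto simp: eq(1))
  qed (use assms in \<open>auto simp: fun_eq_iff\<close>)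
qed

text \<open>The pool in register 10 has \<open>n\<close> ticks, and some are left after reading
  exactly if the number is below \<open>n\<close>, so the cut-off doubles as the range check. Even
  an invalid vertex is stored with at most \<open>n\<close> ticks.\<close>

definition vertex_cmd :: cmd where
  "vertex_cmd = (Pop 0 ;; If 11 nz (Pop 11) (Push 11 1)) ;; read_num 0 15 10 ;;
     (If 10 nz Skip (Push 4 1) ;; Push 12 3) ;; While 15 nz (Pop 15 ;; Push 12 1 ;; Push 10 1)"

definition C_vertex :: "nat \<Rightarrow> nat" where
  "C_vertex X = 5 + ((X * (C_read X + 2) + 1) + (5 + (X * (3 + 2) + 1)))"

lemma runs_vertex_cmd:
  assumes s: "s 0 = 3 # rev (bin x) @ ys" "\<not> is_bit (top0 ys)" "s 11 = tk p" "p < 2" "s 10 = tk n"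
      "s 15 = []" "s 9 = []"
    and X: "n \<le> X" "length (bin x) \<le> X"
    and s': "s' = s(0 := ys, 11 := tk (1 - p), 4 := (if x < n then s 4 else 1 # s 4),
      12 := tk (min x n) @ 3 # s 12)"
  shows "runs vertex_cmd s s' (C_vertex X)"
proof -
  let ?s1 = "s(0 := rev (bin x) @ ys, 11 := tk (1 - p))"
  let ?s2 = "s(0 := ys, 11 := tk (1 - p), 15 := tk (min x n), 10 := tk (n - min x n))"
  let ?s3 = "?s2(4 := (if x < n then s 4 else 1 # s 4), 12 := 3 # s 12)"
  let ?\<sigma> = "\<lambda>m. s'(15 := tk (min x n - m), 10 := tk (n - min x n + m), 12 := tk m @ 3 # s 12)"
  have "runs (Pop 0 ;; If 11 nz (Pop 11) (Push 11 1)) s ?s1 5"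
    using s by (intro runs_loopfree) (auto simp: fun_eq_iff)
  moreover have "runs (read_num 0 15 10) ?s1 ?s2 (X * (C_read X + 2) + 1)"
    using s X by (intro runs_read_num[where n = x and c = n]) (auto simp: fun_eq_iff)
  moreover have "runs (If 10 nz Skip (Push 4 1) ;; Push 12 3) ?s2 ?s3 5"
    by (intro runs_loopfree) (auto simp: fun_eq_iff)
  moreover have "runs (While 15 nz (Pop 15 ;; Push 12 1 ;; Push 10 1)) ?s3 s' (X * (3 + 2) + 1)"
  proof (rule runs_While[where \<sigma> = ?\<sigma> and n = "min x n"])
    fix m assume "m < min x n"
    then show "nz (top0 (?\<sigma> m 15)) \<and> runs (Pop 15 ;; Push 12 1 ;; Push 10 1) (?\<sigma> m) (?\<sigma> (Suc m)) 3"
      by (auto intro!: runs_loopfree simp: fun_eq_iff)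
  next
    have "n - min x n + min x n = n" by simp
    then show "?\<sigma> (min x n) = s'" using s s' by (auto simp: fun_eq_iff)
    show "?\<sigma> 0 = ?s3" using s' by (auto simp: fun_eq_iff)
  qed (use X in auto)
  ultimately show ?thesis unfolding vertex_cmd_def C_vertex_def by (intro runs_Seq)
qed

lemma length_str_ge: "length xs \<le> length (str xs)"
  by (induction xs) (auto simp: enc_nat_def)

lemma runs_vertices:
  assumes "s 0 = rev (str xs)" "s 11 = tk p" "p < 2" "s 10 = tk n" "s 15 = []" "s 9 = []"
    and X: "n \<le> X" "length (str xs) \<le> X"
    and "s' = s(0 := [], 11 := tk ((p + length xs) mod 2),
      4 := tk (length (filter (\<lambda>x. \<not> x < n) xs)) @ s 4, 12 := blk (map (\<lambda>x. min x n) xs) @ s 12)"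
  shows "runs (While 0 nz vertex_cmd) s s' (X * (C_vertex X + 2) + 1)"
proof -
  have "runs (While 0 nz vertex_cmd) s s' (length xs * (C_vertex X + 2) + 1)"
    using assms(1-6,8,9)
  proof (induction xs arbitrary: s p rule: rev_induct)
    case Nil
    then have "s' = s" by (auto simp: fun_eq_iff)
    then show ?case using runs_WhileF[of nz s 0] Nil by simp
  next
    case (snoc x xs)
    let ?s1 = "s(0 := rev (str xs), 11 := tk (1 - p), 4 := (if x < n then s 4 else 1 # s 4),
      12 := tk (min x n) @ 3 # s 12)"
    have nb: "\<not> is_bit (top0 (rev (str xs)))" by (simp add: top0_rev_str)
    have a: "runs vertex_cmd s ?s1 (C_vertex X)"
      using snoc.prems X(1) nb
      by (intro runs_vertex_cmd[where x = x and p = p and n = n]) (auto simp: enc_nat_def)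
    have pp: "(1 - p + length xs) mod 2 = (p + Suc (length xs)) mod 2"
      using snoc.prems(3) by (cases p) (auto simp: mod_simps)
    have b: "runs (While 0 nz vertex_cmd) ?s1 s' (length xs * (C_vertex X + 2) + 1)"
      using snoc.prems pp
      by (intro snoc.IH[where p = "1 - p"]) (auto simp: fun_eq_iff tk_Suc_append)
    have "nz (top0 (s 0))" using snoc.prems(1) by (simp add: enc_nat_def)
    from runs_WhileT[of nz, OF this a b] show ?case
      by (simp add: add.assoc add.commute add.left_commute)
  qed
  then show ?thesis
    by (rule runs_mono) (use X(2) length_str_ge[of xs] in \<open>intro add_le_mono1 mult_le_mono1, simp\<close>)
qed

subsection \<open>The reduction as a program\<close>

text \<open>The final store is specified only on register 1, so branches that leave different
  contents elsewhere can be joined.\<close>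

definition outputs :: "cmd \<Rightarrow> store \<Rightarrow> nat list \<Rightarrow> nat \<Rightarrow> bool" where
  "outputs c s out T \<longleftrightarrow> (\<exists>s'. runs c s s' T \<and> s' 1 = rev out)"

lemma outputs_Seq: "runs c s s' T \<Longrightarrow> outputs d s' out T' \<Longrightarrow> outputs (c ;; d) s out (T + T')"
  unfolding outputs_def using runs_Seq by blast

lemma outputs_If:
  assumes "A (top0 (s i)) \<Longrightarrow> outputs c s out T" and "\<not> A (top0 (s i)) \<Longrightarrow> outputs d s out T"
  shows "outputs (If i A c d) s out (T + 2)"
  using assms runs_If[of A s i c _ T d] unfolding outputs_def by metis

lemma outputs_Skip: "s 1 = [] \<Longrightarrow> out = [] \<Longrightarrow> outputs Skip s out T"
  unfolding outputs_def runs_def using exec.Skip[of s] by fastforce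

definition target_inst :: "nat \<Rightarrow> nat \<Rightarrow> (nat \<times> nat) list \<Rightarrow> nat list" where
  "target_inst n k L = str ([n + 2, k + 1, 3 * n] @ out_caps n @ pairs (out_edges n L))"

lemma set_pairs: "set (pairs L) = fst ` set L \<union> snd ` set L"
proof (induction L)
  case (Cons e L)
  then show ?case by (cases e) (simp add: insert_commute)
qed simp

definition write_cmd :: cmd where
  "write_cmd = self_cmd ;; If 20 nz Skip (header_cmd ;; caps_cmd ;; edges_cmd)"

definition C_write :: "nat \<Rightarrow> nat" where
  "C_write X = C_self X + ((C_header X + (C_caps X + C_edges X)) + 2)"

lemma outputs_write:
  assumes s: "scratch s" "s 1 = []" "s 7 = tk k" "s 8 = tk n" "s 12 = blk (pairs L)"
      "s 14 = []" "s 15 = []" "s 16 = []" "s 17 = []"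
    and X: "3 * n \<le> X" "n + 2 \<le> X" "k + 1 \<le> X" "length L \<le> X" "\<forall>x\<in>set (pairs L). x < n"
  shows "outputs write_cmd s (if \<forall>(u, v)\<in>set L. u \<noteq> v then target_inst n k L else []) (C_write X)"
proof -
  have L: "\<forall>x\<in>set (pairs L). x \<le> X" using X by force
  let ?h = "\<Sum>v<n. hits L v v"
  \<comment> \<open>All entries of the list are below \<open>n\<close>, so testing the vertices
    below \<open>n\<close> misses no loop.\<close>
  have loop: "?h = 0 \<longleftrightarrow> (\<forall>(u, v)\<in>set L. u \<noteq> v)"
    using X(5) by (force simp: hits_0 adj_def set_pairs)
  let ?s1 = "s(20 := tk ?h)"
  have "runs self_cmd s ?s1 (C_self X)"
    using s X L by (intro runs_self_cmd[where n = n and L = L]) auto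
  moreover have "outputs (If 20 nz Skip (header_cmd ;; caps_cmd ;; edges_cmd)) ?s1
      (if \<forall>(u, v)\<in>set L. u \<noteq> v then target_inst n k L else [])
      ((C_header X + (C_caps X + C_edges X)) + 2)"
  proof (rule outputs_If)
    assume "nz (top0 (?s1 20))"
    then have "?h \<noteq> 0" by (auto split: if_splits)
    then show "outputs Skip ?s1 (if \<forall>(u, v)\<in>set L. u \<noteq> v then target_inst n k L else [])
      (C_header X + (C_caps X + C_edges X))"
      using loop s(2) by (intro outputs_Skip) auto
  next
    assume "\<not> nz (top0 (?s1 20))"
    then have h: "?h = 0" by (auto split: if_splits)
    then have s1: "?s1 = s" using s(1) by (auto simp: scratch_def)
    have out: "(if \<forall>(u, v)\<in>set L. u \<noteq> v then target_inst n k L else []) = target_inst n k L"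
      using loop h by simp
    let ?o = "rev (str [n + 2, k + 1, 3 * n])"
    let ?p = "rev (str (out_caps n)) @ ?o"
    let ?q = "rev (str (pairs (out_edges n L))) @ ?p"
    have "runs header_cmd s (s(1 := ?o, 7 := [])) (C_header X)"
      using s X by (intro runs_header_cmd) auto
    moreover have "runs caps_cmd (s(1 := ?o, 7 := [])) (s(1 := ?p, 7 := [])) (C_caps X)"
      using s X by (intro runs_caps_cmd) (auto simp: scratch_def fun_eq_iff)
    moreover have "runs edges_cmd (s(1 := ?p, 7 := [])) (s(1 := ?q, 7 := [], 14 := tk n)) (C_edges X)"
      using s X L by (intro runs_edges_cmd) (auto simp: scratch_def fun_eq_iff)
    ultimately have "runs (header_cmd ;; caps_cmd ;; edges_cmd) s (s(1 := ?q, 7 := [], 14 := tk n))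
        (C_header X + (C_caps X + C_edges X))" by (intro runs_Seq)
    moreover have "(s(1 := ?q, 7 := [], 14 := tk n)) 1 = rev (target_inst n k L)"
      by (simp add: target_inst_def)
    ultimately show "outputs (header_cmd ;; caps_cmd ;; edges_cmd) ?s1
        (if \<forall>(u, v)\<in>set L. u \<noteq> v then target_inst n k L else []) (C_header X + (C_caps X + C_edges X))"
      unfolding s1 out outputs_def by blast
  qed
  ultimately show ?thesis unfolding write_cmd_def C_write_def by (rule outputs_Seq)
qed

fun unpairs :: "nat list \<Rightarrow> (nat \<times> nat) list" where
  "unpairs (u # v # xs) = (u, v) # unpairs xs"
| "unpairs _ = []"

lemma pairs_unpairs: "even (length xs) \<Longrightarrow> pairs (unpairs xs) = xs"
  by (induction xs rule: unpairs.induct) auto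

lemma unpairs_pairs [simp]: "unpairs (pairs L) = L"
  by (induction L) auto

lemma length_unpairs: "length (unpairs xs) \<le> length xs"
  by (induction xs rule: unpairs.induct) auto

definition graph_cmd :: cmd where
  "graph_cmd = rewind_cmd ;; cp 8 9 10 ;; While 0 nz vertex_cmd ;;
     If 11 nz Skip (If 4 nz Skip write_cmd)"

definition C_graph :: "nat \<Rightarrow> nat" where
  "C_graph X = (X * (10 + 2) + 1) + (C_cp X + ((X * (C_vertex X + 2) + 1) + (C_write X + 2 + 2)))"

definition graph_ok :: "nat \<Rightarrow> nat list \<Rightarrow> bool" where
  "graph_ok n xs \<longleftrightarrow> even (length xs) \<and> (\<forall>x\<in>set xs. x < n) \<and> (\<forall>(u, v)\<in>set (unpairs xs). u \<noteq> v)"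

abbreviation empty_store :: store where
  "empty_store \<equiv> \<lambda>_. []"

lemma set_str: "set (str xs) \<subseteq> {1, 2, 3}"
  using set_bin by (induction xs) (auto simp: enc_nat_def)

lemma outputs_graph:
  assumes X: "3 * n \<le> X" "n + 2 \<le> X" "k + 1 \<le> X" "length (str xs) \<le> X"
  shows "outputs graph_cmd (empty_store(2 := str xs, 3 := p, 7 := tk k, 8 := tk n))
    (if graph_ok n xs then target_inst n k (unpairs xs) else []) (C_graph X)"
proof -
  let ?o = "if graph_ok n xs then target_inst n k (unpairs xs) else []"
  let ?z = "empty_store(3 := p, 7 := tk k, 8 := tk n)"
  let ?s0 = "empty_store(2 := str xs, 3 := p, 7 := tk k, 8 := tk n)"
  let ?s1 = "?z(0 := rev (str xs))"
  let ?s2 = "?z(0 := rev (str xs), 10 := tk n)"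
  let ?h = "length (filter (\<lambda>x. \<not> x < n) xs)"
  let ?s3 = "?z(10 := tk n, 11 := tk (length xs mod 2), 4 := tk ?h, 12 := blk (map (\<lambda>x. min x n) xs))"
  have "runs rewind_cmd ?s0 ?s1 (X * (10 + 2) + 1)"
    using X set_str by (intro runs_rewind[where xs = "str xs"]) (auto simp: fun_eq_iff)
  moreover have "runs (cp 8 9 10) ?s1 ?s2 (C_cp X)"
    using X by (intro runs_cp[where n = n]) auto
  moreover have "runs (While 0 nz vertex_cmd) ?s2 ?s3 (X * (C_vertex X + 2) + 1)"
    using X by (intro runs_vertices[where p = 0 and xs = xs and n = n]) (auto simp: fun_eq_iff)
  moreover have "outputs (If 11 nz Skip (If 4 nz Skip write_cmd)) ?s3 ?o (C_write X + 2 + 2)"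
  proof (intro outputs_If)
    assume "nz (top0 (?s3 11))"
    then have "odd (length xs)" by (auto split: if_splits simp: odd_iff_mod_2_eq_one)
    then show "outputs Skip ?s3 ?o (C_write X + 2)" by (intro outputs_Skip) (auto simp: graph_ok_def)
  next
    assume "nz (top0 (?s3 4))"
    then have "\<exists>x\<in>set xs. \<not> x < n" by (auto split: if_splits simp: filter_empty_conv)
    then show "outputs Skip ?s3 ?o (C_write X)" by (intro outputs_Skip) (auto simp: graph_ok_def)
  next
    assume "\<not> nz (top0 (?s3 11))" "\<not> nz (top0 (?s3 4))"
    then have e: "even (length xs)" and l: "\<forall>x\<in>set xs. x < n"
      by (auto split: if_splits simp: filter_empty_conv even_iff_mod_2_eq_zero)
    \<comment> \<open>After a successful range check the cut-off at \<open>n\<close> has changed no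
      entry.\<close>
    have m: "map (\<lambda>x. min x n) xs = pairs (unpairs xs)"
      unfolding pairs_unpairs[OF e] using l by (intro map_idI) auto
    have len: "length (unpairs xs) \<le> X"
      using length_unpairs[of xs] length_str_ge[of xs] X by linarith
    have "outputs write_cmd ?s3 (if \<forall>(u, v)\<in>set (unpairs xs). u \<noteq> v then target_inst n k (unpairs xs) else [])
        (C_write X)"
      using X e l len m by (intro outputs_write) (auto simp: scratch_def pairs_unpairs filter_empty_conv)
    moreover have "graph_ok n xs \<longleftrightarrow> (\<forall>(u, v)\<in>set (unpairs xs). u \<noteq> v)"
      using e l by (auto simp: graph_ok_def)
    ultimately show "outputs write_cmd ?s3 ?o (C_write X)" by simp
  qed
  ultimately show ?thesis unfolding graph_cmd_def C_graph_def by (intro outputs_Seq)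
qed

text \<open>Register 3 already holds the length of the word; adding \<open>k\<close> turns it into
  the pool for reading \<open>n\<close>, and a nonempty rest certifies that \<open>n\<close> is
  small enough.\<close>

definition sizes_cmd :: cmd where
  "sizes_cmd = read_k ;; cp 7 9 3 ;; read_num 5 8 3 ;; If 3 nz graph_cmd Skip"

definition C_sizes :: "nat \<Rightarrow> nat" where
  "C_sizes X = (X * (C_read_k X + 2) + 1) + (C_cp X + ((X * (C_read X + 2) + 1) + (C_graph X + 2)))"

text \<open>The factor 4 is chosen generously so that \<open>X\<close> covers \<open>3 * n\<close>,
  \<open>n + 2\<close> and \<open>k + 1\<close> whenever \<open>n < k + m\<close>.\<close>

lemma outputs_sizes:
  assumes X: "4 * (k + m + 2) \<le> X" and m: "length (str xs) + length (bin n) + length (bin k) \<le> m"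
  shows "outputs sizes_cmd (empty_store(2 := str xs, 3 := tk m, 5 := rev (bin n), 6 := rev (bin k)))
    (if n < k + m \<and> graph_ok n xs then target_inst n k (unpairs xs) else []) (C_sizes X)"
proof -
  let ?o = "if n < k + m \<and> graph_ok n xs then target_inst n k (unpairs xs) else []"
  let ?z = "empty_store(2 := str xs, 3 := tk m, 5 := rev (bin n))"
  let ?s1 = "?z(7 := tk k)"
  let ?s2 = "?z(3 := tk (k + m), 7 := tk k)"
  let ?s3 = "empty_store(2 := str xs, 3 := tk (k + m - min n (k + m)), 7 := tk k, 8 := tk (min n (k + m)))"
  have "runs read_k (?z(6 := rev (bin k))) ?s1 (X * (C_read_k X + 2) + 1)"
    using X m set_bin[of k] by (intro runs_read_k[where a = 0 and xs = "rev (bin k)"]) (auto simp: fun_eq_iff)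
  moreover have "runs (cp 7 9 3) ?s1 ?s2 (C_cp X)"
    using X by (intro runs_cp[where n = k]) (auto simp: fun_eq_iff)
  moreover have "runs (read_num 5 8 3) ?s2 ?s3 (X * (C_read X + 2) + 1)"
    using X m by (intro runs_read_num[where n = n and c = "k + m" and ys = "[]"]) (auto simp: fun_eq_iff)
  moreover have "outputs (If 3 nz graph_cmd Skip) ?s3 ?o (C_graph X + 2)"
  proof (rule outputs_If)
    assume "nz (top0 (?s3 3))"
    then have n: "n < k + m" by (auto split: if_splits)
    then have mn: "min n (k + m) = n" by simp
    have "?o = (if graph_ok n xs then target_inst n k (unpairs xs) else [])" using n by simp
    then show "outputs graph_cmd ?s3 ?o (C_graph X)"
      unfolding mn using X m n by (simp only:) (intro outputs_graph, auto)
  next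
    assume "\<not> nz (top0 (?s3 3))"
    then have "\<not> n < k + m" by (auto split: if_splits)
    then show "outputs Skip ?s3 ?o (C_graph X)" by (intro outputs_Skip) auto
  qed
  ultimately show ?thesis unfolding sizes_cmd_def C_sizes_def by (intro outputs_Seq)
qed

definition reduction_cmd :: cmd where
  "reduction_cmd = If 0 (\<lambda>x. x = 3)
     (While 0 nz check_step ;;
      If 4 nz Skip (split_num 5 ;; If 2 nz (split_num 6 ;; sizes_cmd) Skip)) Skip"

definition C_reduction :: "nat \<Rightarrow> nat" where
  "C_reduction X = ((X * (17 + 2) + 1) + ((C_split X + ((C_split X + C_sizes X) + 2)) + 2)) + 2"

section \<open>The reduction as a function on words\<close>

fun red_list :: "nat list \<Rightarrow> nat list" where
  "red_list (n # k # xs) = (if n < k + length (str (n # k # xs)) \<and> graph_ok n xs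
     then target_inst n k (unpairs xs) else [])"
| "red_list _ = []"

definition red :: "nat list \<Rightarrow> nat list" where
  "red w = (if \<exists>l. w = str l then red_list (THE l. w = str l) else [])"

lemma bin_inj: "bin m = bin n \<Longrightarrow> m = n"
  using horner_bin by metis

text \<open>A number ends at the first separator, and \<open>bin\<close> is injective. Unique
  decoding pins down the choices made in \<open>kappa\<close> and in \<open>red\<close>.\<close>

lemma str_inj: "str l = str l' \<Longrightarrow> l = l'"
proof (induction l arbitrary: l')
  case Nil
  then show ?case by (cases l') (auto simp: enc_nat_def)
next
  case (Cons x l)
  then obtain y l'' where l': "l' = y # l''" by (cases l') (auto simp: enc_nat_def)
  have tw: "takeWhile (\<lambda>z. z \<noteq> 3) (bin z @ 3 # r) = bin z" for z r
    using set_bin[of z] by (subst takeWhile_append2) auto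
  have eq: "bin x @ 3 # str l = bin y @ 3 # str l''"
    using Cons.prems unfolding l' by (simp add: enc_nat_def)
  have b: "bin x = bin y" using arg_cong[OF eq, of "takeWhile (\<lambda>z. z \<noteq> 3)"] unfolding tw .
  then have "str l = str l''" using eq by simp
  then show ?case using Cons.IH bin_inj[OF b] l' by blast
qed

lemma red_str: "red (str l) = red_list l"
proof -
  have "(THE l'. str l = str l') = l" using str_inj by (intro the_equality) auto
  then show ?thesis unfolding red_def by auto
qed

lemma kappa_str: "kappa (str l) = (if 2 \<le> length l then l ! 1 else 0)"
proof -
  have "(SOME l'. str l = str l') = l" using str_inj by (intro some_equality) auto
  moreover have "(\<exists>l'. str l = str l' \<and> 2 \<le> length l') \<longleftrightarrow> 2 \<le> length l" using str_inj by blast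
  ultimately show ?thesis unfolding kappa_def by simp
qed

lemma outputs_reduction:
  assumes w: "w \<in> lists {1, 2, 3}" and X: "4 * (kappa w + length w + 2) \<le> X"
  shows "outputs reduction_cmd (init_store w) (red w) (C_reduction X)"
proof -
  have init: "init_store w = empty_store(0 := rev w)" by (auto simp: init_store_def)
  have set_w: "set w \<subseteq> {1, 2, 3}" using w by auto
  have w1: "init_store w 1 = []" by (simp add: init_store_def)
  show ?thesis unfolding reduction_cmd_def C_reduction_def
  proof (rule outputs_If)
    assume "\<not> top0 (init_store w 0) = 3"
    then have "red w = []"
    proof (cases "\<exists>l. w = str l")
      case True
      then obtain l where l: "w = str l" by blast
      then have "l = []"
        using \<open>\<not> top0 (init_store w 0) = 3\<close> top0_rev_str[of l]
        by (auto simp: init_store_def split: if_splits)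
      then show ?thesis unfolding l red_str by simp
    qed (simp add: red_def)
    then show "outputs Skip (init_store w) (red w)
        ((X * (17 + 2) + 1) + ((C_split X + ((C_split X + C_sizes X) + 2)) + 2))"
      using w1 by (intro outputs_Skip)
  next
    assume "top0 (init_store w 0) = 3"
    then have top: "top0 (rev w) = 3" by (simp add: init_store_def)
    let ?s1 = "empty_store(2 := w, 3 := tk (length w), 4 := tk (bad (rev w)))"
    have chk: "runs (While 0 nz check_step) (init_store w) ?s1 (X * (17 + 2) + 1)"
      unfolding init using set_w X by (intro runs_check[where v = "rev w"]) (auto simp: fun_eq_iff)
    have "outputs (If 4 nz Skip (split_num 5 ;; If 2 nz (split_num 6 ;; sizes_cmd) Skip)) ?s1 (red w)
        ((C_split X + ((C_split X + C_sizes X) + 2)) + 2)"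
    proof (rule outputs_If)
      assume "nz (top0 (?s1 4))"
      then have "bad (rev w) \<noteq> 0" by (auto split: if_splits)
      then have "red w = []" using bad_str by (auto simp: red_def)
      then show "outputs Skip ?s1 (red w) (C_split X + ((C_split X + C_sizes X) + 2))"
        by (intro outputs_Skip) auto
    next
      assume "\<not> nz (top0 (?s1 4))"
      then have b: "bad (rev w) = 0" by (auto split: if_splits)
      then obtain l where l: "w = str l"
        using not_bad_imp_str[of "rev w"] top set_w by auto
      have s1: "?s1 = empty_store(2 := w, 3 := tk (length w))" using b by (auto simp: fun_eq_iff)
      obtain n l' where nl: "l = n # l'" using top l by (cases l) auto
      let ?s2 = "empty_store(2 := str l', 3 := tk (length w), 5 := rev (bin n))"
      have "runs (split_num 5) ?s1 ?s2 (C_split X)"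
        unfolding s1 using l nl set_bin[of n] X
        by (intro runs_split_num[where xs = "bin n" and ys = "str l'"]) (auto simp: enc_nat_def fun_eq_iff)
      moreover have "outputs (If 2 nz (split_num 6 ;; sizes_cmd) Skip) ?s2 (red w) ((C_split X + C_sizes X) + 2)"
      proof (rule outputs_If)
        assume "\<not> nz (top0 (?s2 2))"
        then have "l' = []"
          using set_str[of l'] length_str_ge[of l'] by (cases "str l'") auto
        then have "red w = []" unfolding l red_str nl by simp
        then show "outputs Skip ?s2 (red w) (C_split X + C_sizes X)" by (intro outputs_Skip) auto
      next
        assume "nz (top0 (?s2 2))"
        then obtain k xs where kx: "l' = k # xs" by (cases l') auto
        let ?s3 = "empty_store(2 := str xs, 3 := tk (length w), 5 := rev (bin n), 6 := rev (bin k))"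
        have k: "kappa w = k" unfolding l kappa_str nl kx by simp
        have len: "length (str xs) + length (bin n) + length (bin k) \<le> length w"
          unfolding l nl kx by (simp add: enc_nat_def)
        have "red w = (if n < k + length w \<and> graph_ok n xs then target_inst n k (unpairs xs) else [])"
          unfolding l red_str nl kx by simp
        moreover have "runs (split_num 6) ?s2 ?s3 (C_split X)"
          unfolding kx using set_bin[of k] X len
          by (intro runs_split_num[where xs = "bin k" and ys = "str xs"]) (auto simp: enc_nat_def fun_eq_iff)
        moreover have "outputs sizes_cmd ?s3
            (if n < k + length w \<and> graph_ok n xs then target_inst n k (unpairs xs) else []) (C_sizes X)"
          using X len unfolding k by (intro outputs_sizes) auto
        ultimately show "outputs (split_num 6 ;; sizes_cmd) ?s2 (red w) (C_split X + C_sizes X)"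
          using outputs_Seq by simp
      qed
      ultimately show "outputs (split_num 5 ;; If 2 nz (split_num 6 ;; sizes_cmd) Skip) ?s1 (red w)
          (C_split X + ((C_split X + C_sizes X) + 2))" by (rule outputs_Seq)
    qed
    with chk show "outputs (While 0 nz check_step ;;
        If 4 nz Skip (split_num 5 ;; If 2 nz (split_num 6 ;; sizes_cmd) Skip)) (init_store w) (red w)
        ((X * (17 + 2) + 1) + ((C_split X + ((C_split X + C_sizes X) + 2)) + 2))"
      by (rule outputs_Seq)
  qed
qed

subsection \<open>Correctness of the reduction on words\<close>

lemma red_list_correct: "str l \<in> DS_lang \<longleftrightarrow> red_list l \<in> CVCL1_lang"
proof (cases "\<exists>n k xs. l = n # k # xs")
  case False
  then have "red_list l = []" by (cases l rule: red_list.cases) auto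
  moreover have "[] \<notin> CVCL1_lang" by (auto simp: CVCL1_lang_def enc_nat_def)
  moreover have "str l \<notin> DS_lang" using False str_inj by (fastforce simp: DS_lang_def simp del: str_simps)
  ultimately show ?thesis by simp
next
  case True
  then obtain n k xs where l: "l = n # k # xs" by blast
  have nil: "[] \<notin> CVCL1_lang" by (auto simp: CVCL1_lang_def enc_nat_def)
  have ds: "str l \<in> DS_lang \<longleftrightarrow> (\<exists>E. xs = pairs E \<and> ds_yes n k E)"
  proof
    assume "str l \<in> DS_lang"
    then obtain n' k' E where "str l = str ([n', k'] @ pairs E)" "ds_yes n' k' E"
      unfolding DS_lang_def by blast
    then show "\<exists>E. xs = pairs E \<and> ds_yes n k E" using str_inj[of l] l by fastforce
  next
    assume "\<exists>E. xs = pairs E \<and> ds_yes n k E"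
    then show "str l \<in> DS_lang" unfolding DS_lang_def l by auto
  qed
  have valid: "valid_graph n E \<longleftrightarrow> graph_ok n (pairs E)" for E
  proof -
    have "even (length (pairs E))" by (induction E) auto
    then show ?thesis by (auto simp: valid_graph_def graph_ok_def set_pairs case_prod_beta ball_Un)
  qed
  have inst: "target_inst n k L \<in> CVCL1_lang \<longleftrightarrow>
      cvcl1_yes (n + 2) (k + 1) (3 * n) (out_caps n) (out_edges n L)" for L
  proof
    assume "target_inst n k L \<in> CVCL1_lang"
    then obtain B k' N c E where eq: "target_inst n k L = str ([B, k', N] @ c @ pairs E)"
      and y: "cvcl1_yes B k' N c E" unfolding CVCL1_lang_def by blast
    have "[n + 2, k + 1, 3 * n] @ out_caps n @ pairs (out_edges n L) = [B, k', N] @ c @ pairs E"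
      using eq unfolding target_inst_def by (rule str_inj)
    then have B: "B = n + 2" "k' = k + 1" "N = 3 * n" and ce: "out_caps n @ pairs (out_edges n L) = c @ pairs E"
      by auto
    \<comment> \<open>The third number of an instance fixes the length of the capacity list, so the
      flat list splits into capacities and edges in only one way.\<close>
    have "length c = length (out_caps n)" using y B by (simp add: cvcl1_yes_def out_caps_def)
    then have "c = out_caps n" "pairs E = pairs (out_edges n L)" using ce by auto
    then have "E = out_edges n L" using unpairs_pairs by metis
    then show "cvcl1_yes (n + 2) (k + 1) (3 * n) (out_caps n) (out_edges n L)"
      using y B \<open>c = out_caps n\<close> by simp
  next
    assume "cvcl1_yes (n + 2) (k + 1) (3 * n) (out_caps n) (out_edges n L)"
    then show "target_inst n k L \<in> CVCL1_lang" unfolding CVCL1_lang_def target_inst_def by blast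
  qed
  show ?thesis
  proof
    assume "str l \<in> DS_lang"
    then obtain E where E: "xs = pairs E" "ds_yes n k E" using ds by blast
    then have v: "valid_graph n E" by (simp add: ds_yes_def)
    have "n \<le> k + 2 * length E" by (rule ds_yes_imp_few_vertices[OF v E(2)])
    moreover have "length (pairs E) = 2 * length E" by (induction E) auto
    \<comment> \<open>Each number takes at least one symbol, and the entries \<open>n\<close> and
      \<open>k\<close> make the inequality strict; thus the size test rejects no
      yes-instance.\<close>
    then have "2 * length E < length (str l)"
      using length_str_ge[of l] unfolding l E(1) by simp
    ultimately have "n < k + length (str l)" by linarith
    then have "red_list l = target_inst n k E"
      using valid v by (simp add: l E(1) del: str_simps)
    then show "red_list l \<in> CVCL1_lang" using inst reduction_correct[OF v] E(2) by simp
  next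
    assume "red_list l \<in> CVCL1_lang"
    then have g: "graph_ok n xs" and r: "target_inst n k (unpairs xs) \<in> CVCL1_lang"
      using nil unfolding l by (auto split: if_splits)
    have p: "pairs (unpairs xs) = xs" using g by (intro pairs_unpairs) (simp add: graph_ok_def)
    then have "valid_graph n (unpairs xs)" using g valid by simp
    then have "ds_yes n k (unpairs xs)" using reduction_correct r inst by blast
    then show "str l \<in> DS_lang" using ds p by metis
  qed
qed

lemma red_correct: "w \<in> DS_lang \<longleftrightarrow> red w \<in> CVCL1_lang"
proof (cases "\<exists>l. w = str l")
  case True
  then show ?thesis using red_list_correct red_str by auto
next
  case False
  then have "w \<notin> DS_lang" by (auto simp: DS_lang_def simp del: str_simps)
  moreover have "[] \<notin> CVCL1_lang" by (auto simp: CVCL1_lang_def enc_nat_def)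
  ultimately show ?thesis using False by (simp add: red_def)
qed

lemma kappa_red: "kappa (red w) \<le> kappa w + 1"
proof (cases "\<exists>n k xs. w = str (n # k # xs)")
  case True
  then obtain n k xs where w: "w = str (n # k # xs)" by blast
  have "kappa [] = 0" using kappa_str[of "[]"] by simp
  then show ?thesis unfolding w red_str kappa_str target_inst_def
    by (simp add: target_inst_def kappa_str del: str_simps)
next
  case False
  then have "red w = []" unfolding red_def
    by (metis red_def red_list.elims red_str)
  then show ?thesis using kappa_str[of "[]"] by simp
qed

section \<open>Polynomial bounds\<close>

text \<open>The base is at least 2 for every \<open>x\<close>, so constants and sums are absorbed by
  raising the exponent.\<close>

definition poly_bounded :: "(nat \<Rightarrow> nat) \<Rightarrow> bool" where
  "poly_bounded f \<longleftrightarrow> (\<exists>c. \<forall>x. f x \<le> (x + 2) ^ c)"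

lemma poly_bounded_const [intro!]: "poly_bounded (\<lambda>_. m)"
  unfolding poly_bounded_def
proof (intro exI allI)
  fix x :: nat
  have "m \<le> 2 ^ m" by (rule less_imp_le[OF less_exp])
  also have "\<dots> \<le> (x + 2) ^ m" by (rule power_mono) auto
  finally show "m \<le> (x + 2) ^ m" .
qed

lemma poly_bounded_id [intro!]: "poly_bounded (\<lambda>x. x)"
  unfolding poly_bounded_def by (rule exI[of _ 1]) simp

lemma poly_bounded_add [intro!]:
  assumes "poly_bounded f" "poly_bounded g"
  shows "poly_bounded (\<lambda>x. f x + g x)"
proof -
  obtain a b where ab: "\<And>x. f x \<le> (x + 2) ^ a" "\<And>x. g x \<le> (x + 2) ^ b"
    using assms unfolding poly_bounded_def by blast
  have "f x + g x \<le> (x + 2) ^ (Suc (a + b))" for x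
  proof -
    have "(x + 2) ^ a \<le> (x + 2) ^ (a + b)" "(x + 2) ^ b \<le> (x + 2) ^ (a + b)"
      by (intro power_increasing; simp)+
    then have "f x + g x \<le> 2 * (x + 2) ^ (a + b)" using ab[of x] by linarith
    also have "\<dots> \<le> (x + 2) * (x + 2) ^ (a + b)" by (intro mult_le_mono1) simp
    finally show ?thesis by simp
  qed
  then show ?thesis unfolding poly_bounded_def by blast
qed

lemma poly_bounded_mult [intro!]:
  assumes "poly_bounded f" "poly_bounded g"
  shows "poly_bounded (\<lambda>x. f x * g x)"
proof -
  obtain a b where ab: "\<And>x. f x \<le> (x + 2) ^ a" "\<And>x. g x \<le> (x + 2) ^ b"
    using assms unfolding poly_bounded_def by blast
  then have "f x * g x \<le> (x + 2) ^ (a + b)" for x by (simp add: power_add mult_le_mono)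
  then show ?thesis unfolding poly_bounded_def by blast
qed

lemma poly_bounded_reduction:
  "poly_bounded (\<lambda>x. tm_time x (C_reduction (4 * (x + 2))))"
  unfolding tm_time_def C_reduction_def C_sizes_def C_graph_def C_write_def C_split_def C_vertex_def
    C_read_def C_read_k_def C_self_def C_header_def C_caps_def C_edges_def C_row_def C_edge_cmd_def
    C_scan_def C_edge_def C_cmp_def C_emit_def C_halve_def C_cp_def C_mv_def
  by (intro poly_bounded_add poly_bounded_mult poly_bounded_const poly_bounded_id)

text \<open>A computable function that dominates the polynomial \<open>(n + 2) ^ c\<close> and is easy to
  write down in binary: \<open>2 ^ m - 1\<close> has only one bits.\<close>

definition bound_fun :: "nat \<Rightarrow> nat \<Rightarrow> nat" where
  "bound_fun c n = 2 ^ (Suc c * Suc (length (bin n))) - 1"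

lemma bin_ones: "bin (2 ^ m - 1) = replicate m 2"
proof (induction m)
  case (Suc m)
  have "(1::nat) \<le> 2 ^ m" by simp
  then have "(2::nat) ^ Suc m - 1 = Suc (2 * (2 ^ m - 1))" unfolding power_Suc by linarith
  then show ?case using Suc by (simp add: bin_rec del: power_Suc)
qed simp

lemma less_bin: "n < 2 ^ length (bin n)"
proof (induction n rule: less_induct)
  case (less n)
  show ?case
  proof (cases "n = 0")
    case False
    then have "n div 2 < 2 ^ length (bin (n div 2))" using less by simp
    then show ?thesis using False by (simp add: bin_rec)
  qed simp
qed

text \<open>With \<open>L\<close> digits, \<open>n < 2 ^ L\<close> gives
  \<open>n + 2 \<le> 2 ^ Suc L\<close>. The factor \<open>Suc c\<close> in the exponent, instead of
  \<open>c\<close>, makes the comparison strict and so pays for the subtracted 1.\<close>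

lemma bound_fun_ge: "(n + 2) ^ c \<le> bound_fun c n"
proof -
  let ?L = "length (bin n)"
  have "(1::nat) \<le> 2 ^ ?L" by simp
  then have "n + 2 \<le> 2 ^ Suc ?L" using less_bin[of n] by simp
  then have "(n + 2) ^ c \<le> (2 ^ Suc ?L) ^ c" by (rule power_mono) simp
  also have "\<dots> = 2 ^ (Suc ?L * c)" by (simp only: power_mult)
  also have "\<dots> < 2 ^ (Suc c * Suc ?L)" by (rule power_strict_increasing) auto
  finally show ?thesis by (simp add: bound_fun_def)
qed

primrec push_ones :: "nat \<Rightarrow> cmd" where
  "push_ones 0 = Skip"
| "push_ones (Suc m) = Push 1 2 ;; push_ones m"

lemma runs_push_ones: "runs (push_ones m) s (s(1 := replicate m 2 @ s 1)) m"
proof (induction m arbitrary: s)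
  case 0
  show ?case by (auto simp: runs_def intro: exec.Skip)
next
  case (Suc m)
  have a: "runs (Push 1 2) s (s(1 := 2 # s 1)) 1" by (rule runs_loopfree) auto
  have "(s(1 := 2 # s 1))(1 := replicate m 2 @ (s(1 := 2 # s 1)) 1) = s(1 := replicate (Suc m) 2 @ s 1)"
    by (auto simp: fun_eq_iff replicate_app_Cons_same)
  then show ?case using runs_Seq[OF a Suc.IH] by (simp only: push_ones.simps plus_1_eq_Suc)
qed

definition bound_cmd :: "nat \<Rightarrow> cmd" where
  "bound_cmd c = push_ones (Suc c) ;; While 0 nz (Pop 0 ;; push_ones (Suc c))"

lemma computable_bound_fun: "computable_nat (bound_fun c)"
proof -
  have wf: "wf_cmd 2 (bound_cmd c)"
  proof -
    have "wf_cmd 2 (push_ones m)" for m by (induction m) auto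
    then show ?thesis by (simp add: bound_cmd_def)
  qed
  have "\<exists>t. halts_with (tm_of 2 (bound_cmd c)) (bin n) t (bin (bound_fun c n))" for n
  proof -
    let ?s = "init_store (bin n)" and ?m = "Suc c" and ?L = "length (bin n)"
    let ?\<sigma> = "\<lambda>j. ?s(0 := drop j (rev (bin n)), 1 := replicate (?m * Suc j) 2)"
    have "runs (push_ones ?m) ?s (?\<sigma> 0) ?m"
      using runs_push_ones[of ?m ?s] by (simp add: init_store_def fun_upd_def cong: if_cong)
    moreover have "runs (While 0 nz (Pop 0 ;; push_ones ?m)) (?\<sigma> 0) (?\<sigma> ?L) (?L * (1 + ?m + 2) + 1)"
    proof (rule runs_While[where \<sigma> = ?\<sigma> and n = ?L])
      fix j assume j: "j < ?L"
      then have d: "drop j (rev (bin n)) = rev (bin n) ! j # drop (Suc j) (rev (bin n))"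
        by (simp add: Cons_nth_drop_Suc)
      have "rev (bin n) ! j \<in> set (bin n)" using j nth_mem[of j "rev (bin n)"] by simp
      then have nzj: "rev (bin n) ! j \<noteq> 0" using set_bin[of n] by auto
      let ?s1 = "(?\<sigma> j)(0 := drop (Suc j) (rev (bin n)))"
      have a: "runs (Pop 0) (?\<sigma> j) ?s1 1" by (rule runs_loopfree) (auto simp: fun_eq_iff d)
      have "replicate ?m 2 @ replicate (?m * Suc j) (2::nat) = replicate (?m * Suc (Suc j)) 2"
        by (simp add: replicate_add[symmetric] del: replicate_Suc)
      then have "?s1(1 := replicate ?m 2 @ ?s1 1) = ?\<sigma> (Suc j)"
        by (auto simp: fun_eq_iff simp del: replicate_Suc mult_Suc mult_Suc_right)
      then have "runs (Pop 0 ;; push_ones ?m) (?\<sigma> j) (?\<sigma> (Suc j)) (1 + ?m)"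
        using runs_Seq[OF a runs_push_ones[of ?m ?s1]] by simp
      then show "nz (top0 (?\<sigma> j 0)) \<and> runs (Pop 0 ;; push_ones ?m) (?\<sigma> j) (?\<sigma> (Suc j)) (1 + ?m)"
        using nzj d by simp
    qed auto
    ultimately have "runs (bound_cmd c) ?s (?\<sigma> ?L) (?m + (?L * (1 + ?m + 2) + 1))"
      unfolding bound_cmd_def by (rule runs_Seq)
    then obtain t where "exec (bound_cmd c) ?s t (?\<sigma> ?L)" unfolding runs_def by blast
    moreover have "bin n \<in> lists {1, 2, 3}" using set_bin[of n] by auto
    ultimately obtain t' where "halts_with (tm_of 2 (bound_cmd c)) (bin n) t' (rev (?\<sigma> ?L 1))"
      using tm_of_correct[OF _ wf] by blast
    moreover have "rev (?\<sigma> ?L 1) = bin (bound_fun c n)"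
      unfolding bound_fun_def bin_ones by (simp del: mult_Suc mult_Suc_right replicate_Suc)
    ultimately show ?thesis by metis
  qed
  then show ?thesis unfolding computable_nat_def
    using wf_tm_of[OF _ wf] by (intro exI[of _ "tm_of 2 (bound_cmd c)"]) simp
qed

lemma wf_reduction_cmd: "wf_cmd 22 reduction_cmd"
  by (simp add: reduction_cmd_def sizes_cmd_def graph_cmd_def write_cmd_def split_num_def vertex_cmd_def
      read_num_def read_step_def tick_def read_k_def read_k_step_def self_cmd_def header_cmd_def
      caps_cmd_def edges_cmd_def row_cmd_def edge_cmd_def scan_both_def scan_def compare_edge_def
      cmp_def emit_def halve_def cp_def mv_def clr_def check_step_def rewind_cmd_def)

theorem theorem4:
  shows "W2_hard CVCL1_lang kappa"
proof -
  let ?M = "tm_of 22 reduction_cmd"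
  obtain c where c: "\<And>x. tm_time x (C_reduction (4 * (x + 2))) \<le> (x + 2) ^ c"
    using poly_bounded_reduction unfolding poly_bounded_def by blast
  \<comment> \<open>The same function serves as time factor and as bound on the new parameter; the
    exponent \<open>Suc c\<close> is at least 1, as the latter needs.\<close>
  have "\<exists>t \<le> bound_fun (Suc c) (kappa w) * (length w + 1) ^ c. halts_with ?M w t (red w)"
    if w: "w \<in> lists {1, 2, 3}" for w
  proof -
    let ?x = "kappa w + length w" and ?k = "kappa w" and ?n = "length w"
    let ?T = "C_reduction (4 * (?x + 2))"
    obtain s' t where t: "t \<le> ?T" "exec reduction_cmd (init_store w) t s'" "s' 1 = rev (red w)"
      using outputs_reduction[OF w order_refl] unfolding outputs_def runs_def by blast
    obtain t' where t': "t' \<le> tm_time ?n t" "halts_with ?M w t' (rev (s' 1))"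
      using tm_of_correct[OF _ wf_reduction_cmd w t(2)] by auto
    have "tm_time ?n t \<le> tm_time ?x ?T"
      unfolding tm_time_def using t(1) by (intro add_mono mult_le_mono) auto
    also have "\<dots> \<le> (?x + 2) ^ c" by (rule c)
    \<comment> \<open>Passing from the sum to a product separates the parameter from the
      length.\<close>
    also have "\<dots> \<le> ((?k + 2) * (?n + 1)) ^ c" by (rule power_mono) auto
    also have "\<dots> = (?k + 2) ^ c * (?n + 1) ^ c" by (rule power_mult_distrib)
    also have "\<dots> \<le> bound_fun (Suc c) ?k * (?n + 1) ^ c"
    proof (rule mult_le_mono1)
      have "(?k + 2) ^ c \<le> (?k + 2) ^ Suc c" by (rule power_increasing) auto
      then show "(?k + 2) ^ c \<le> bound_fun (Suc c) ?k" using bound_fun_ge order_trans by blast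
    qed
    finally show ?thesis using t' t(3) by (metis order_trans rev_rev_ident)
  qed
  then have "computes_in_time ?M red (\<lambda>w. bound_fun (Suc c) (kappa w) * (length w + 1) ^ c)"
    unfolding computes_in_time_def using wf_tm_of[OF _ wf_reduction_cmd] by simp
  moreover have "kappa (red w) \<le> bound_fun (Suc c) (kappa w)" for w
  proof -
    have "kappa (red w) \<le> (kappa w + 2) ^ 1" using kappa_red[of w] by simp
    also have "\<dots> \<le> (kappa w + 2) ^ Suc c" by (rule power_increasing) auto
    also have "\<dots> \<le> bound_fun (Suc c) (kappa w)" by (rule bound_fun_ge)
    finally show ?thesis .
  qed
  ultimately show ?thesis
    unfolding W2_hard_def fpt_reducible_def using computable_bound_fun red_correct by blast
qed

end
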